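(* Let $P(\lambda)=\sum_{i=0}^k\lambda^iA_i$ be a regular $n\times n$ matrix polynomial of degree $k$ with $A_i\in\mathbb{C}^{n\times n}$, and let $1\leqslant r<kn$. Let $S_1$ be the perturbation class of all matrices of the form $I_{r+1}\otimes\begin{bmatrix}\Delta A_0&\cdots&\Delta A_k\end{bmatrix}$ and $S_2$ the perturbation class of all matrices of the form $I_{r+1}\otimes\begin{bmatrix}\Delta A_0&\cdots&\Delta A_{\min\{r,k\}}\end{bmatrix}$, where $\Delta A_i\in\mathbb{C}^{n\times n}$. Let $\lambda_0\in\mathbb{C}$ be a scalar which is not an eigenvalue of $P(\lambda)$. Then $$\delta_2(P,\lambda_0,r+1)=\begin{cases}\left[\mu^{r+1}_{S_1,\|\cdot\|_2}\left((I_{r+1}\otimes M(\lambda_0;r))\,E\,(T(P,\lambda_0))^{-1}\right)\right]^{-1}&\text{if }\lambda_0\neq0,\\[1ex]\left[\mu^{r+1}_{S_2,\|\cdot\|_2}\left(E\,(T(P,0))^{-1}\right)\right]^{-1}&\text{if }\lambda_0=0,\end{cases}$$ and $$\delta_F(P,\lambda_0,r+1)=\begin{cases}\dfrac{1}{\sqrt{r+1}}\left[\mu^{r+1}_{S_1,\|\cdot\|_F}\left((I_{r+1}\otimes M(\lambda_0;r))\,E\,(T(P,\lambda_0))^{-1}\right)\right]^{-1}&\text{if }\lambda_0\neq0,\\[1ex]\dfrac{1}{\sqrt{r+1}}\left[\mu^{r+1}_{S_2,\|\cdot\|_F}\left(E\,(T(P,0))^{-1}\right)\right]^{-1}&\text{if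 }\lambda_0=0.\end{cases}$$
   Context: Norms: $\|\cdot\|_2$ and $\|\cdot\|_F$ are the spectral and Frobenius norms of matrices. For $\Delta P(\lambda)=\sum_{i=0}^k\lambda^i\Delta A_i$, put $|||\Delta P|||_F=\left(\sum_{i=0}^k\|\Delta A_i\|_F^2\right)^{1/2}$ and $|||\Delta P|||_2=\|[\Delta A_0\ \cdots\ \Delta A_k]\|_2$. Elementary divisors are defined via the Smith form: $P(\lambda)=E_0(\lambda)D(\lambda)F_0(\lambda)$ with $E_0,F_0$ matrix polynomials with nonzero constant determinants and $D=\mathrm{diag}(d_1,\dots,d_t,0,\dots,0)$, $d_i$ monic, $d_{i-1}\mid d_i$; if $d_i(\lambda)=\prod_j(\lambda-\lambda_{ij})^{c_{ij}}$ with distinct $\lambda_{ij}$ and $c_{ij}\geqslant1$, the factors $(\lambda-\lambda_{ij})^{c_{ij}}$ are the elementary divisors. $P$ is regular if $\det P(\lambda)\not\equiv0$; its eigenvalues are then the roots of $\det P(\lambda)$. Distance: for $s=2$ or $F$, $\delta_s(P,\lambda_0,r+1)$ is the infimum of $|||\Delta P|||_s$ over all $\Delta P(\lambda)=\sum_{i=0}^k\lambda^i\Delta A_i$, $\Delta A_i\in\mathbb{C}^{n\times n}$ (any of which may be zero), such that $P+\Delta P$ has an elementary divisor $(\lambda-\lambda_0)^j$ with $j\geqslant r+1$. Generalized $\mu$-value: a perturbation class is a nonempty closed subset $S\subset\mathbb{C}^{p\times q}$ such that $\Delta\in S$ implies $t\Delta\in S$ for $0\leqslant t\leqslant1$. For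 a norm $\|\cdot\|$ on $\mathbb{C}^{p\times q}$, $M\in\mathbb{C}^{q\times p}$ and a positive integer $m$, $$\mu^m_{S,\|\cdot\|}(M):=\left(\inf\{\|\Delta\|:\Delta\in S,\ \mathrm{rank}(I-\Delta M)\leqslant p-m\}\right)^{-1},$$ and $\mu^m_{S,\|\cdot\|}(M)=0$ if there is no such $\Delta\in S$. Matrices, with $p:=\min\{r,k\}$ below: $T(P,\lambda_0)$ is the $(r+1)n\times(r+1)n$ block lower triangular Toeplitz matrix whose $n\times n$ block $(i,j)$ is $\frac{1}{(i-j)!}P^{i-j}(\lambda_0)$ for $i\geqslant j$ and $0$ for $i<j$ ($1\leqslant i,j\leqslant r+1$), where $P^{i}$ is the $i$-th derivative. $M(\lambda_0;r)=H(\lambda_0)\otimes I_n$, where $H(\lambda_0)$ is the $(k+1)\times(p+1)$ matrix with $(i,j)$ entry $\left.\frac{1}{(j-1)!}\frac{d^{j-1}\lambda^{i-1}}{d\lambda^{j-1}}\right|_{\lambda=\lambda_0}$. For $i=1,\dots,r+1$ let $E_i$ be the $(r+1)\times(r+1)$ matrix with $(a,b)$ entry equal to $1$ if $a+b=i+1$ and $0$ otherwise, and let $\tilde E_i\in\mathbb{C}^{(k+1)\times(r+1)}$ (used when $r>k$) consist of the first $k+1$ rows of $E_i$. Then $E=\begin{bmatrix}E_1^T&\cdots&E_{r+1}^T\end{bmatrix}^T\otimes I_n$ if $r\leqslant k$, and $E=\begin{bmatrix}\tilde E_1^T&\cdots&\tilde E_{r+1}^T\end{bmatrix}^T\otimes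 I_n$ if $r>k$. *)

theory Defs
  imports
    "HOL-Library.Extended_Nonnegative_Real"
    "Jordan_Normal_Form.DL_Rank"
    "Jordan_Normal_Form.Gauss_Jordan_Elimination"
begin

definition kron :: "'a::times mat \<Rightarrow> 'a mat \<Rightarrow> 'a mat" where
  "kron A B = mat (dim_row A * dim_row B) (dim_col A * dim_col B)
     (\<lambda>(i,j). A $$ (i div dim_row B, j div dim_col B) * B $$ (i mod dim_row B, j mod dim_col B))"

(* [B 0  B 1  ...  B m], all blocks n x n *)
definition block_row :: "nat \<Rightarrow> nat \<Rightarrow> (nat \<Rightarrow> 'a mat) \<Rightarrow> 'a mat" where
  "block_row n m B = mat n ((m + 1) * n) (\<lambda>(i,j). B (j div n) $$ (i, j mod n))"

definition vec_norm2 :: "complex vec \<Rightarrow> real" where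
  "vec_norm2 v = sqrt (\<Sum>i<dim_vec v. (cmod (v $ i))\<^sup>2)"

definition spec_norm :: "complex mat \<Rightarrow> real" where
  "spec_norm A = (SUP v \<in> {v \<in> carrier_vec (dim_col A). vec_norm2 v \<le> 1}. vec_norm2 (A *\<^sub>v v))"

definition frob_norm :: "complex mat \<Rightarrow> real" where
  "frob_norm A = sqrt (\<Sum>i<dim_row A. \<Sum>j<dim_col A. (cmod (A $$ (i,j)))\<^sup>2)"

(* \<lambda> \<mapsto> A 0 + \<lambda> A 1 + ... + \<lambda>^k A k, as a matrix over the polynomial ring *)
definition matpoly :: "nat \<Rightarrow> nat \<Rightarrow> (nat \<Rightarrow> complex mat) \<Rightarrow> complex poly mat" where
  "matpoly n k A = mat n n (\<lambda>(a,b). \<Sum>i\<le>k. monom (A i $$ (a,b)) i)"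

definition triple_norm_2 :: "nat \<Rightarrow> nat \<Rightarrow> (nat \<Rightarrow> complex mat) \<Rightarrow> real" where
  "triple_norm_2 n k B = spec_norm (block_row n k B)"

definition triple_norm_F :: "nat \<Rightarrow> (nat \<Rightarrow> complex mat) \<Rightarrow> real" where
  "triple_norm_F k B = sqrt (\<Sum>i\<le>k. (frob_norm (B i))\<^sup>2)"

definition regular_matpoly :: "complex poly mat \<Rightarrow> bool" where
  "regular_matpoly P \<longleftrightarrow> det P \<noteq> 0"

definition matpoly_eigenvalues :: "complex poly mat \<Rightarrow> complex set" where
  "matpoly_eigenvalues P = {z. poly (det P) z = 0}"

definition unimodular :: "nat \<Rightarrow> complex poly mat \<Rightarrow> bool" where
  "unimodular n U \<longleftrightarrow> U \<in> carrier_mat n n \<and> (\<exists>c. c \<noteq> 0 \<and> det U = [:c:])"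

(* ds = [d_1, ..., d_t] are the nonzero diagonal entries of a Smith form of the n x n matrix P *)
definition smith_form :: "nat \<Rightarrow> complex poly mat \<Rightarrow> complex poly list \<Rightarrow> bool" where
  "smith_form n P ds \<longleftrightarrow>
     length ds \<le> n \<and>
     (\<forall>i < length ds. lead_coeff (ds ! i) = 1) \<and>
     (\<forall>i. Suc i < length ds \<longrightarrow> ds ! i dvd ds ! Suc i) \<and>
     (\<exists>E\<^sub>0 F\<^sub>0. unimodular n E\<^sub>0 \<and> unimodular n F\<^sub>0 \<and>
        P = E\<^sub>0 * mat_diag n (\<lambda>i. if i < length ds then ds ! i else 0) * F\<^sub>0)"

definition elementary_divisors :: "nat \<Rightarrow> complex poly mat \<Rightarrow> complex poly set" where
  "elementary_divisors n P = {[:-a, 1:] ^ c a | a c.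
     \<exists>ds R. \<exists>d \<in> set ds. smith_form n P ds \<and> finite R \<and> (\<forall>b\<in>R. 1 \<le> c b) \<and>
       d = (\<Prod>b\<in>R. [:-b, 1:] ^ c b) \<and> a \<in> R}"

(* The distance \<delta>(P, z0, m), where nrm is the norm of the coefficient family (\<Delta>A_0, ..., \<Delta>A_k).
   It is extended-valued, so the infimum of the empty set is \<infinity>. *)
definition el_div_distance ::
  "((nat \<Rightarrow> complex mat) \<Rightarrow> real) \<Rightarrow> nat \<Rightarrow> nat \<Rightarrow> complex poly mat \<Rightarrow> complex \<Rightarrow> nat \<Rightarrow> ennreal" where
  "el_div_distance nrm n k P z0 m =
     (INF B \<in> {B. (\<forall>i\<le>k. B i \<in> carrier_mat n n) \<and>
                  (\<exists>j\<ge>m. [:-z0, 1:] ^ j \<in> elementary_divisors n (P + matpoly n k B))}.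
        ennreal (nrm B))"

(* Closedness in the p x q matrices is expressed by entrywise limits of sequences. *)
definition perturbation_class :: "nat \<Rightarrow> nat \<Rightarrow> complex mat set \<Rightarrow> bool" where
  "perturbation_class p q S \<longleftrightarrow>
     S \<subseteq> carrier_mat p q \<and> S \<noteq> {} \<and>
     (\<forall>X L. (\<forall>m. X m \<in> S) \<and> L \<in> carrier_mat p q \<and>
        (\<forall>i<p. \<forall>j<q. (\<lambda>m. X m $$ (i,j)) \<longlonglongrightarrow> L $$ (i,j)) \<longrightarrow> L \<in> S) \<and>
     (\<forall>D\<in>S. \<forall>t::real. 0 \<le> t \<and> t \<le> 1 \<longrightarrow> complex_of_real t \<cdot>\<^sub>m D \<in> S)"

(* For M of size q x p and S a perturbation class of p x q matrices.  Since inverse \<infinity> = 0 in ennreal,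
   the value is 0 if there is no admissible \<Delta>.  The rank condition avoids truncated subtraction. *)
definition gen_mu :: "(complex mat \<Rightarrow> real) \<Rightarrow> complex mat set \<Rightarrow> nat \<Rightarrow> complex mat \<Rightarrow> ennreal" where
  "gen_mu nrm S m M =
     inverse (INF D \<in> {D \<in> S. vec_space.rank (dim_col M) (1\<^sub>m (dim_col M) - D * M) + m \<le> dim_col M}.
       ennreal (nrm D))"

(* Matrices I_{r+1} \<otimes> [B 0 ... B m]; S_1 is the case m = k and S_2 the case m = min r k. *)
definition block_class :: "nat \<Rightarrow> nat \<Rightarrow> nat \<Rightarrow> complex mat set" where
  "block_class n r m =
     {kron (1\<^sub>m (r + 1)) (block_row n m B) | B. \<forall>i\<le>m. B i \<in> carrier_mat n n}"

(* Block and entry indices below are 0-based. *)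

definition T_mat :: "nat \<Rightarrow> nat \<Rightarrow> complex poly mat \<Rightarrow> complex \<Rightarrow> complex mat" where
  "T_mat n r P z0 = mat ((r + 1) * n) ((r + 1) * n) (\<lambda>(a,b).
     let i = a div n; j = b div n in
     if j \<le> i then poly ((pderiv ^^ (i - j)) (P $$ (a mod n, b mod n))) z0 / fact (i - j) else 0)"

definition H_mat :: "nat \<Rightarrow> nat \<Rightarrow> complex \<Rightarrow> complex mat" where
  "H_mat k r z0 = mat (k + 1) (min r k + 1) (\<lambda>(i,j).
     poly ((pderiv ^^ j) (monom 1 i)) z0 / fact j)"

definition M_mat :: "nat \<Rightarrow> nat \<Rightarrow> nat \<Rightarrow> complex \<Rightarrow> complex mat" where
  "M_mat n k r z0 = kron (H_mat k r z0) (1\<^sub>m n)"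

(* The first min r k + 1 rows of the (r+1) x (r+1) matrix with ones on the i-th antidiagonal:
   all r+1 rows if r \<le> k, the first k+1 rows if r > k. *)
definition E_block :: "nat \<Rightarrow> nat \<Rightarrow> nat \<Rightarrow> complex mat" where
  "E_block k r i = mat (min r k + 1) (r + 1) (\<lambda>(a,b). if a + b = i then 1 else 0)"

(* E_block k r 0, ..., E_block k r r stacked vertically, tensored with I_n *)
definition E_mat :: "nat \<Rightarrow> nat \<Rightarrow> nat \<Rightarrow> complex mat" where
  "E_mat n k r = kron
     (mat ((r + 1) * (min r k + 1)) (r + 1)
        (\<lambda>(a,b). E_block k r (a div (min r k + 1)) $$ (a mod (min r k + 1), b)))
     (1\<^sub>m n)"

lemma kron_block_row_index:
  assumes "i < (r + 1) * n" "j < (r + 1) * ((m + 1) * n)"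
  shows "kron (1\<^sub>m (r + 1)) (block_row n m B :: complex mat) $$ (i,j) =
    (if i div n = j div ((m + 1) * n)
     then B ((j mod ((m + 1) * n)) div n) $$ (i mod n, j mod n) else 0)"
proof -
  have n: "n > 0" using assms(1) by (cases n) auto
  have 1: "i div n < r + 1" using assms(1) by (metis less_mult_imp_div_less)
  have 2: "j div ((m + 1) * n) < r + 1" using assms(2) by (metis less_mult_imp_div_less)
  have 3: "j mod ((m + 1) * n) < (m + 1) * n" using n by simp
  have 4: "j mod ((m + 1) * n) mod n = j mod n" by (simp add: mod_mod_cancel)
  show ?thesis
    unfolding kron_def block_row_def using assms n 1 2 3 4 by simp
qed

lemma perturbation_class_block_class:
  "perturbation_class ((r + 1) * n) ((r + 1) * ((m + 1) * n)) (block_class n r m)"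
proof -
  let ?p = "(r + 1) * n" and ?q = "(r + 1) * ((m + 1) * n)"
  have dim: "kron (1\<^sub>m (r + 1)) (block_row n m B :: complex mat) \<in> carrier_mat ?p ?q" for B
    by (simp add: kron_def block_row_def)
  have closed: "L \<in> block_class n r m"
    if X: "\<And>l. X l \<in> block_class n r m" and L: "L \<in> carrier_mat ?p ?q"
      and lim: "\<And>i j. i < ?p \<Longrightarrow> j < ?q \<Longrightarrow> (\<lambda>l. X l $$ (i,j)) \<longlonglongrightarrow> L $$ (i,j)" for X L
  proof -
    obtain B where B: "\<And>l. X l = kron (1\<^sub>m (r + 1)) (block_row n m (B l))"
      using X unfolding block_class_def by (simp, metis)
    define C where "C = (\<lambda>s. mat n n (\<lambda>(a,b). L $$ (a, s * n + b)))"
    have "L = kron (1\<^sub>m (r + 1)) (block_row n m C)"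
    proof (rule eq_matI)
      fix i j
      assume "i < dim_row (kron (1\<^sub>m (r + 1)) (block_row n m C))"
        and "j < dim_col (kron (1\<^sub>m (r + 1)) (block_row n m C))"
      then have i: "i < ?p" and j: "j < ?q" using dim[of C] by auto
      then have n: "n > 0" by (cases n) auto
      let ?s = "(j mod ((m + 1) * n)) div n"
      show "L $$ (i,j) = kron (1\<^sub>m (r + 1)) (block_row n m C) $$ (i,j)"
      proof (cases "i div n = j div ((m + 1) * n)")
        case False
        then have "(\<lambda>l. X l $$ (i,j)) = (\<lambda>l. 0)"
          unfolding B kron_block_row_index[OF i j] by simp
        with lim[OF i j] have "L $$ (i,j) = 0"
          by (simp add: LIMSEQ_const_iff)
        with False show ?thesis unfolding kron_block_row_index[OF i j] by simp
      next
        case True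
        have jm: "j mod ((m + 1) * n) < (m + 1) * n" using n by simp
        have jm': "j mod ((m + 1) * n) mod n = j mod n" by (simp add: mod_mod_cancel)
        have sj: "?s * n + j mod n = j mod ((m + 1) * n)"
          using div_mult_mod_eq[of "j mod ((m + 1) * n)" n] unfolding jm' .
        have i': "i mod n < ?p" using n by (simp add: trans_less_add1)
        have j': "j mod ((m + 1) * n) < ?q" using jm by (simp add: trans_less_add1)
        have "X l $$ (i,j) = X l $$ (i mod n, j mod ((m + 1) * n))" for l
          unfolding B kron_block_row_index[OF i j] kron_block_row_index[OF i' j']
          using True jm jm' n by simp
        then have "L $$ (i,j) = L $$ (i mod n, j mod ((m + 1) * n))"
          using LIMSEQ_unique[OF lim[OF i j]] lim[OF i' j'] by simp
        also have "\<dots> = C ?s $$ (i mod n, j mod n)"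
          unfolding C_def using n sj by simp
        also have "\<dots> = kron (1\<^sub>m (r + 1)) (block_row n m C) $$ (i,j)"
          unfolding kron_block_row_index[OF i j] using True by simp
        finally show ?thesis .
      qed
    qed (use L dim[of C] in auto)
    then show ?thesis unfolding block_class_def C_def by force
  qed
  have scale: "t \<cdot>\<^sub>m D \<in> block_class n r m" if "D \<in> block_class n r m" for t :: complex and D
  proof -
    obtain B where B: "D = kron (1\<^sub>m (r + 1)) (block_row n m B)" "\<forall>i\<le>m. B i \<in> carrier_mat n n"
      using \<open>D \<in> block_class n r m\<close> unfolding block_class_def by auto
    have "t \<cdot>\<^sub>m D = kron (1\<^sub>m (r + 1)) (block_row n m (\<lambda>i. t \<cdot>\<^sub>m B i))"
    proof (rule eq_matI)
      fix i j
      assume "i < dim_row (kron (1\<^sub>m (r + 1)) (block_row n m (\<lambda>i. t \<cdot>\<^sub>m B i)))"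
        and "j < dim_col (kron (1\<^sub>m (r + 1)) (block_row n m (\<lambda>i. t \<cdot>\<^sub>m B i)))"
      then have i: "i < ?p" and j: "j < ?q" using dim[of "\<lambda>i. t \<cdot>\<^sub>m B i"] by auto
      then have n: "n > 0" by (cases n) auto
      let ?s = "(j mod ((m + 1) * n)) div n"
      have "j mod ((m + 1) * n) < (m + 1) * n" using n by simp
      then have "?s < m + 1" by (metis less_mult_imp_div_less)
      then have "B ?s \<in> carrier_mat n n" using B(2) by simp
      then show "(t \<cdot>\<^sub>m D) $$ (i,j) = kron (1\<^sub>m (r + 1)) (block_row n m (\<lambda>i. t \<cdot>\<^sub>m B i)) $$ (i,j)"
        unfolding B(1) kron_block_row_index[OF i j]
        using dim[of B] i j n kron_block_row_index[OF i j, of B] by auto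
    qed (use B(1) dim[of B] dim[of "\<lambda>i. t \<cdot>\<^sub>m B i"] in auto)
    then show ?thesis unfolding block_class_def using B(2) by force
  qed
  have "block_class n r m \<noteq> {}"
    unfolding block_class_def by (auto intro: exI[of _ "\<lambda>_. 0\<^sub>m n n"])
  moreover have "block_class n r m \<subseteq> carrier_mat ?p ?q"
    using dim unfolding block_class_def by auto
  ultimately show ?thesis
    unfolding perturbation_class_def using closed scale by blast
qed

end

theory Submission
  imports Defs "HOL-Computational_Algebra.Fundamental_Theorem_Algebra" "HOL-Analysis.L2_Norm"
begin

text \<open>Write \<open>L = \<lambda> - z0\<close>. For a matrix polynomial \<open>Q\<close> let \<open>T(Q)\<close> be the block Toeplitz matrix of its Taylor
coefficients at \<open>z0\<close> up to order \<open>r\<close>, and let \<open>\<Delta> = I \<otimes> [B_0 ... B_m]\<close> be a structured perturbation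
with matrix polynomial \<open>B(\<lambda>)\<close>.

The rank condition is a statement about \<open>P - B\<close>. The matrix that multiplies \<open>T(P)\<^sup>-\<^sup>1\<close> in the argument
of the \<open>\<mu>\<close>-value is made such that \<open>\<Delta>\<close> times it equals \<open>T(B)\<close> (\<open>perturbation_product\<close>). Hence
\<open>I - \<Delta> M = T(P - B) T(P)\<^sup>-\<^sup>1\<close>, and the rank condition says that the kernel of \<open>T(P - B)\<close> has dimension at
least \<open>r + 1\<close>. Tensoring with the identity keeps the spectral norm and multiplies the Frobenius norm by
\<open>sqrt (r + 1)\<close>, and the sign of \<open>B\<close> does not affect the norms. So the right-hand sides are infima of the
norm of \<open>B\<close> over all \<open>B\<close> such that the kernel of \<open>T(P + B)\<close> is that large. At \<open>z0 = 0\<close> the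
coefficients of \<open>B\<close> of order above \<open>r\<close> do not occur in \<open>T(B)\<close>; cutting them off never increases the norm.

Elementary divisors against kernels. \<open>T(Q)\<close> is multiplication by \<open>Q\<close> on polynomial vectors modulo
\<open>L^(r+1)\<close>. If \<open>L^j\<close> with \<open>j \<ge> r + 1\<close> is an elementary divisor of \<open>Q\<close>, some polynomial vector \<open>x\<close> with
\<open>x(z0) \<noteq> 0\<close> satisfies \<open>L^(r+1) dvd Q x\<close>, and \<open>x, L x, ..., L^r x\<close> give \<open>r + 1\<close> independent kernel vectors.
The converse fails for a single \<open>Q\<close>: the kernel dimension may be spread over several elementary divisors
of lower degree, and \<open>Q\<close> may be singular. But it always forces \<open>L^(r+1) dvd det Q\<close>, and then \<open>Q\<close> is a limit of
regular matrix polynomials of the same grade that do have an elementary divisor of degree at least \<open>r + 1\<close>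
(\<open>root_vector_approx\<close>). As both sides are infima, this suffices.

The approximation. A root vector of order \<open>m\<close> is an \<open>x\<close> with \<open>x(z0) \<noteq> 0\<close> and \<open>L^m dvd Q x\<close>. For regular
\<open>Q\<close>, as long as \<open>L^(m+1) dvd det Q\<close>, a small change of one column of \<open>Q\<close> that keeps the determinant makes
room for a root vector of order \<open>m + 1\<close> (\<open>regular_root_vector_extend\<close>, an application of Cramer's rule). A
singular \<open>Q\<close> is first replaced by a nearby regular one whose determinant is a multiple of \<open>L^(k n)\<close>; here
\<open>r < k n\<close> enters. With \<open>z0\<close> moved to \<open>0\<close>, the companion pencil \<open>z B + C\<close> of \<open>Q\<close> is singular. Along a flag on
which it is triangular, \<open>B\<close> can be perturbed so that the determinant becomes a nonzero multiple of the top
power of \<open>z\<close> (\<open>pencil_regularize\<close>). The perturbed pencil is no longer a companion pencil, but all its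
block rows except the last still have a polynomial kernel close to \<open>(I, z I, ..., z^(k-1) I)\<close>, and applying
the last block row to this kernel recovers a matrix polynomial of grade \<open>k\<close> close to \<open>Q\<close> that has
an invertible leading coefficient and no eigenvalue other than \<open>0\<close> (\<open>singular_matpoly_approx\<close>).\<close>

section \<open>Rank and families of kernel vectors\<close>

lemma homogeneous_system_nontrivial:
  fixes m :: "'i \<Rightarrow> nat \<Rightarrow> 'a::field"
  assumes "finite I" "card I < d"
  obtains c where "\<forall>i\<in>I. (\<Sum>j<d. m i j * c j) = 0" "\<exists>j<d. c j \<noteq> 0"
proof -
  obtain f where f: "bij_betw f {0..<card I} I"
    using ex_bij_betw_nat_finite[OF assms(1)] by auto
  define M where "M = mat d d (\<lambda>(r,j). if r < card I then m (f r) j else 0)"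
  have M: "M \<in> carrier_mat d d" by (simp add: M_def)
  have "det M = 0"
    using assms(2) laplace_expansion_row[OF M, of "d - 1"] by (simp add: M_def)
  then obtain v where v: "v \<in> carrier_vec d" "v \<noteq> 0\<^sub>v d" "M *\<^sub>v v = 0\<^sub>v d"
    using det_0_iff_vec_prod_zero_field[OF M] by auto
  have z: "(\<Sum>j<d. m i j * v $ j) = 0" if "i \<in> I" for i
  proof -
    have "i \<in> f ` {0..<card I}" using bij_betw_imp_surj_on[OF f] that by blast
    then obtain r where r: "r < card I" "f r = i" by auto
    have "(M *\<^sub>v v) $ r = 0" using v(3) r assms(2) by simp
    then show ?thesis
      using r assms(2) v(1) by (simp add: M_def scalar_prod_def lessThan_atLeast0)
  qed
  have "\<exists>j<d. v $ j \<noteq> 0"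
  proof (rule ccontr)
    assume "\<not> ?thesis"
    then have "v = 0\<^sub>v d" using v(1) by (intro eq_vecI) auto
    then show False using v(2) by simp
  qed
  with z show ?thesis by (intro that[of "\<lambda>j. v $ j"] ballI)
qed

definition indep_kernel_family :: "complex mat \<Rightarrow> nat \<Rightarrow> (nat \<Rightarrow> complex vec) \<Rightarrow> bool" where
  "indep_kernel_family A R x \<longleftrightarrow>
     (\<forall>l<R. x l \<in> carrier_vec (dim_col A) \<and> A *\<^sub>v x l = 0\<^sub>v (dim_row A)) \<and>
     (\<forall>c. (\<forall>i<dim_col A. (\<Sum>l<R. c l * x l $ i) = 0) \<longrightarrow> (\<forall>l<R. c l = 0))"

lemma mult_mat_vec_zero_iff:
  assumes "A \<in> carrier_mat nr nc" "v \<in> carrier_vec nc"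
  shows "A *\<^sub>v v = 0\<^sub>v nr \<longleftrightarrow> (\<forall>i<nr. (\<Sum>j<nc. A $$ (i,j) * v $ j) = 0)"
  using assms by (auto simp: vec_eq_iff scalar_prod_def lessThan_atLeast0)

text \<open>The basis consists of column positions and not of column vectors, because equal columns at different
positions contribute separately to the kernel.\<close>

lemma rank_column_basis:
  assumes A: "(A :: complex mat) \<in> carrier_mat d d"
  obtains J a where "J \<subseteq> {..<d}" "card J = vec_space.rank d A"
    "\<And>c. \<forall>i<d. (\<Sum>j\<in>J. c j * A $$ (i,j)) = 0 \<Longrightarrow> \<forall>j\<in>J. c j = 0"
    "\<And>l i. l < d \<Longrightarrow> i < d \<Longrightarrow> A $$ (i,l) = (\<Sum>j\<in>J. a l j * A $$ (i,j))"
proof -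
  interpret vec_space "TYPE(complex)" d .
  let ?C = "set (cols A)"
  have C: "?C \<subseteq> carrier_vec d" using cols_dim A by blast
  obtain S where S: "finite S" "maximal S (\<lambda>T. T \<subseteq> ?C \<and> lin_indpt T)"
    using maximal_exists_superset[of ?C "\<lambda>T. T \<subseteq> ?C \<and> lin_indpt T" "{}"]
    by (auto simp: lin_dep_def)
  have SC: "S \<subseteq> ?C" and ind: "lin_indpt S" using S(2) by (auto simp: maximal_def)
  have SV: "S \<subseteq> carrier_vec d" using SC C by auto
  have rk: "rank A = card S" by (rule rank_card_indpt[OF A S(2)])
  have "\<forall>s\<in>S. \<exists>j<d. col A j = s"
    using SC A by (fastforce simp: cols_def)
  then obtain g where g: "\<And>s. s \<in> S \<Longrightarrow> g s < d \<and> col A (g s) = s" by metis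
  have inj: "inj_on g S" by (metis g inj_onI)
  define J where "J = g ` S"
  have entry: "A $$ (i, g s) = s $ i" if "s \<in> S" "i < d" for s i
    using g[OF that(1)] A that(2) by (metis carrier_matD(1) carrier_matD(2) index_col)
  have J1: "J \<subseteq> {..<d}" using g J_def by auto
  have J2: "card J = rank A" using rk card_image[OF inj] J_def by simp
  have J3: "\<forall>j\<in>J. c j = 0" if "\<forall>i<d. (\<Sum>j\<in>J. c j * A $$ (i,j)) = 0" for c
  proof -
    have "lincomb (\<lambda>s. c (g s)) S = 0\<^sub>v d"
    proof (rule eq_vecI)
      fix i assume "i < dim_vec (0\<^sub>v d)"
      then have i: "i < d" by simp
      have "lincomb (\<lambda>s. c (g s)) S $ i = (\<Sum>s\<in>S. c (g s) * s $ i)"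
        using lincomb_index[OF i SV] by simp
      also have "\<dots> = (\<Sum>s\<in>S. c (g s) * A $$ (i, g s))"
        by (rule sum.cong) (simp_all add: entry i)
      also have "\<dots> = (\<Sum>j\<in>J. c j * A $$ (i,j))"
        unfolding J_def by (simp add: sum.reindex[OF inj])
      finally show "lincomb (\<lambda>s. c (g s)) S $ i = 0\<^sub>v d $ i" using that i by simp
    qed (simp add: lincomb_dim[OF S(1) SV])
    then have "\<forall>s\<in>S. c (g s) = 0"
      using ind S(1) unfolding lin_dep_def by auto
    then show ?thesis by (auto simp: J_def)
  qed
  have "\<exists>b. \<forall>i<d. A $$ (i,l) = (\<Sum>j\<in>J. b j * A $$ (i,j))" if l: "l < d" for l
  proof -
    have cl: "col A l \<in> ?C" using l A by (auto simp: cols_def)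
    have "col A l \<in> span S"
    proof (rule ccontr)
      assume ns: "col A l \<notin> span S"
      then have nS: "col A l \<notin> S" using in_own_span[OF SV] by auto
      have "lin_indpt (insert (col A l) S)"
        using lin_dep_iff_in_span[OF SV ind _ nS] ns cl C by auto
      then have "insert (col A l) S = S"
        using S(2) SC cl unfolding maximal_def by (metis insert_subset subset_insertI)
      then show False using nS by blast
    qed
    then obtain b where b: "col A l = lincomb b S"
      using finite_span[OF S(1) SV] by auto
    have "A $$ (i,l) = (\<Sum>j\<in>J. b (col A j) * A $$ (i,j))" if i: "i < d" for i
    proof -
      have "A $$ (i,l) = col A l $ i" using i l A by simp
      also have "\<dots> = (\<Sum>s\<in>S. b s * s $ i)" unfolding b using lincomb_index[OF i SV] by simp
      also have "\<dots> = (\<Sum>s\<in>S. b (col A (g s)) * A $$ (i, g s))"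
        by (rule sum.cong) (simp_all add: entry i g)
      also have "\<dots> = (\<Sum>j\<in>J. b (col A j) * A $$ (i,j))"
        unfolding J_def by (simp add: sum.reindex[OF inj])
      finally show ?thesis .
    qed
    then show ?thesis by (intro exI[of _ "\<lambda>j. b (col A j)"]) blast
  qed
  then obtain a where "\<And>l i. l < d \<Longrightarrow> i < d \<Longrightarrow> A $$ (i,l) = (\<Sum>j\<in>J. a l j * A $$ (i,j))"
    by metis
  then show ?thesis using that J1 J2 J3 by blast
qed

text \<open>Rank and nullity. Every column position outside a column basis yields a kernel vector, and these are
independent by their unit entries. Conversely, more independent kernel vectors than positions outside the basis
would have a nontrivial combination supported on the basis, that is, a relation between basis columns.\<close>

lemma rank_le_iff_indep_kernel_family:
  assumes A: "(A :: complex mat) \<in> carrier_mat d d"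
  shows "vec_space.rank d A + R \<le> d \<longleftrightarrow> (\<exists>x. indep_kernel_family A R x)"
proof -
  obtain J a where J: "J \<subseteq> {..<d}" "card J = vec_space.rank d A"
    and ind: "\<And>c. \<forall>i<d. (\<Sum>j\<in>J. c j * A $$ (i,j)) = 0 \<Longrightarrow> \<forall>j\<in>J. c j = 0"
    and spn: "\<And>l i. l < d \<Longrightarrow> i < d \<Longrightarrow> A $$ (i,l) = (\<Sum>j\<in>J. a l j * A $$ (i,j))"
    by (rule rank_column_basis[OF A]) (rule that)
  have finJ: "finite J" using J(1) finite_subset by blast
  have cardJ: "card ({..<d} - J) = d - card J"
    using J(1) finJ by (simp add: card_Diff_subset)
  have Jd: "card J \<le> d" using J(1) card_mono[of "{..<d}" J] by simp
  show ?thesis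
  proof
    assume "vec_space.rank d A + R \<le> d"
    then have "card {..<R} \<le> card ({..<d} - J)" using cardJ J(2) by simp
    then obtain e where e: "inj_on e {..<R}" "e ` {..<R} \<subseteq> {..<d} - J"
      using card_le_inj[of "{..<R}" "{..<d} - J"] by auto
    define x where "x l = vec d (\<lambda>i. if i \<in> J then - a (e l) i else if i = e l then 1 else 0)" for l
    have el: "e l < d" "e l \<notin> J" if "l < R" for l using e(2) that by auto
    have xc: "x l \<in> carrier_vec d" for l by (simp add: x_def)
    have xk: "A *\<^sub>v x l = 0\<^sub>v d" if l: "l < R" for l
    proof -
      have "(\<Sum>j<d. A $$ (i,j) * x l $ j) = 0" if i: "i < d" for i
      proof -
        have "(\<Sum>j<d. A $$ (i,j) * x l $ j) =
            (\<Sum>j\<in>J. A $$ (i,j) * x l $ j) + (\<Sum>j\<in>{..<d} - J. A $$ (i,j) * x l $ j)"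
          unfolding sum.subset_diff[OF J(1) finite_lessThan, of "\<lambda>j. A $$ (i,j) * x l $ j"]
          by (rule add.commute)
        also have "(\<Sum>j\<in>J. A $$ (i,j) * x l $ j) = - (\<Sum>j\<in>J. a (e l) j * A $$ (i,j))"
          unfolding sum_negf[symmetric]
          by (rule sum.cong) (use J(1) in \<open>auto simp: x_def\<close>)
        also have "(\<Sum>j\<in>{..<d} - J. A $$ (i,j) * x l $ j) =
            (\<Sum>j\<in>{..<d} - J. if j = e l then A $$ (i,j) else 0)"
          by (rule sum.cong) (auto simp: x_def)
        also have "\<dots> = A $$ (i, e l)" using el[OF l] by (simp add: sum.delta)
        finally show ?thesis using spn[OF el(1)[OF l] i] by simp
      qed
      then show ?thesis using mult_mat_vec_zero_iff[OF A, of "x l"] by (simp add: x_def)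
    qed
    have xi: "c l = 0" if c: "\<forall>i<d. (\<Sum>l<R. c l * x l $ i) = 0" and l: "l < R" for c l
    proof -
      have "(\<Sum>l'<R. c l' * x l' $ e l) = (\<Sum>l'<R. if l' = l then c l' else 0)"
      proof (rule sum.cong)
        fix l' assume "l' \<in> {..<R}"
        then have "e l = e l' \<longleftrightarrow> l' = l" using inj_on_eq_iff[OF e(1)] l by auto
        then show "c l' * x l' $ e l = (if l' = l then c l' else 0)"
          using el[OF l] by (simp add: x_def)
      qed simp
      also have "\<dots> = c l" using l by (simp add: sum.delta)
      finally show ?thesis using c[rule_format, OF el(1)[OF l]] by metis
    qed
    show "\<exists>x. indep_kernel_family A R x"
      unfolding indep_kernel_family_def carrier_matD[OF A]
      by (intro exI[of _ x] conjI allI impI) (rule xc, erule xk, erule (1) xi)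
  next
    assume "\<exists>x. indep_kernel_family A R x"
    then obtain x where X: "indep_kernel_family A R x" by blast
    note X = X[unfolded indep_kernel_family_def carrier_matD[OF A]]
    have x: "x l \<in> carrier_vec d" "A *\<^sub>v x l = 0\<^sub>v d" if "l < R" for l
      using X that by blast+
    have xi: "\<forall>l<R. c l = 0" if "\<forall>i<d. (\<Sum>l<R. c l * x l $ i) = 0" for c
      using conjunct2[OF X, rule_format, of c, OF that[rule_format]] by blast
    show "vec_space.rank d A + R \<le> d"
    proof (rule ccontr)
      assume "\<not> ?thesis"
      then have "card ({..<d} - J) < R" using cardJ J(2) Jd by simp
      then obtain c where c: "\<forall>i\<in>{..<d} - J. (\<Sum>l<R. x l $ i * c l) = 0" "\<exists>l<R. c l \<noteq> 0"
        using homogeneous_system_nontrivial[of "{..<d} - J" R "\<lambda>i l. x l $ i"] by auto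
      define y where "y i = (\<Sum>l<R. c l * x l $ i)" for i
      have y0: "y i = 0" if "i < d" "i \<notin> J" for i
        using c(1) that by (simp add: y_def mult.commute)
      have "(\<Sum>j\<in>J. y j * A $$ (i,j)) = 0" if i: "i < d" for i
      proof -
        have "(\<Sum>j\<in>J. y j * A $$ (i,j)) = (\<Sum>j<d. y j * A $$ (i,j))"
          by (rule sum.mono_neutral_left) (use J(1) y0 in auto)
        also have "\<dots> = (\<Sum>j<d. \<Sum>l<R. c l * (A $$ (i,j) * x l $ j))"
          unfolding y_def sum_distrib_right by (simp add: algebra_simps)
        also have "\<dots> = (\<Sum>l<R. c l * (\<Sum>j<d. A $$ (i,j) * x l $ j))"
          by (subst sum.swap) (simp add: sum_distrib_left)
        also have "\<dots> = 0"
          by (intro sum.neutral ballI)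
            (use mult_mat_vec_zero_iff[OF A x(1)] x(2) i in simp)
        finally show ?thesis .
      qed
      then have "\<forall>j\<in>J. y j = 0" by (intro ind allI impI)
      then have "\<forall>i<d. y i = 0" using y0 by blast
      then have "\<forall>l<R. c l = 0" unfolding y_def by (rule xi)
      then show False using c(2) by blast
    qed
  qed
qed

section \<open>Taylor coefficients and the block Toeplitz matrix\<close>

definition taylor_coeff :: "complex \<Rightarrow> complex poly \<Rightarrow> nat \<Rightarrow> complex" where
  "taylor_coeff z0 p m = poly ((pderiv ^^ m) p) z0 / fact m"

text \<open>Taylor coefficients at \<open>z0\<close> are ordinary coefficients after the substitution that moves \<open>z0\<close> to \<open>0\<close>; the
product rule and the divisibility criterion below are read off there.\<close>

lemma taylor_coeff_eq_coeff_pcompose: "taylor_coeff z0 p m = coeff (p \<circ>\<^sub>p [:z0, 1:]) m"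
proof -
  have "(pderiv ^^ m) (p \<circ>\<^sub>p [:z0, 1:]) = ((pderiv ^^ m) p) \<circ>\<^sub>p [:z0, 1:]"
  proof (induction m)
    case (Suc m)
    then show ?case by (simp add: pderiv_pcompose pderiv_pCons)
  qed simp
  then have "poly ((pderiv ^^ m) p) z0 = coeff ((pderiv ^^ m) (p \<circ>\<^sub>p [:z0, 1:])) 0"
    by (simp add: poly_pcompose flip: poly_0_coeff_0)
  also have "\<dots> = fact m * coeff (p \<circ>\<^sub>p [:z0, 1:]) m"
    by (simp add: coeff_higher_pderiv pochhammer_fact)
  finally show ?thesis by (simp add: taylor_coeff_def)
qed

lemma taylor_coeff_mult:
  "taylor_coeff z0 (p * q) m = (\<Sum>i\<le>m. taylor_coeff z0 p (m - i) * taylor_coeff z0 q i)"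
  unfolding taylor_coeff_eq_coeff_pcompose pcompose_mult
  by (subst mult.commute) (simp add: coeff_mult mult.commute[of "coeff (p \<circ>\<^sub>p _) _"])

lemma taylor_coeff_sum: "taylor_coeff z0 (sum f I) m = (\<Sum>i\<in>I. taylor_coeff z0 (f i) m)"
  unfolding taylor_coeff_eq_coeff_pcompose by (simp add: pcompose_sum coeff_sum)

lemma taylor_coeff_smult: "taylor_coeff z0 (Polynomial.smult c p) m = c * taylor_coeff z0 p m"
  unfolding taylor_coeff_eq_coeff_pcompose by (simp add: pcompose_smult)

lemma shift_unshift: "(p \<circ>\<^sub>p [:z0, 1:]) \<circ>\<^sub>p [:-z0, 1:] = (p :: complex poly)"
proof -
  have "[:z0, 1:] \<circ>\<^sub>p [:-z0, 1:] = [:0, 1:]" by (simp add: pcompose_pCons)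
  then show ?thesis by (simp flip: pcompose_assoc)
qed

lemma power_pcompose: "(p ^ m) \<circ>\<^sub>p q = (p \<circ>\<^sub>p q) ^ m"
  by (induction m) (simp_all add: pcompose_mult pcompose_1)

lemma linear_power_shift: "([:-z0, 1:] ^ m) \<circ>\<^sub>p [:z0, 1:] = monom (1 :: complex) m"
proof -
  have "[:-z0, 1:] \<circ>\<^sub>p [:z0, 1:] = [:0, 1 :: complex:]" by (simp add: pcompose_pCons)
  then show ?thesis by (simp add: power_pcompose monom_altdef)
qed

lemma taylor_coeff_linear_power: "taylor_coeff z0 ([:-z0, 1:] ^ j) m = (if m = j then 1 else 0)"
  unfolding taylor_coeff_eq_coeff_pcompose linear_power_shift by simp

lemma linear_power_dvd_iff: "[:-z0, 1:] ^ R dvd p \<longleftrightarrow> (\<forall>m<R. taylor_coeff z0 p m = 0)"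
proof -
  have "[:-z0, 1:] ^ R dvd p \<longleftrightarrow> monom 1 R dvd p \<circ>\<^sub>p [:z0, 1:]"
  proof
    assume "[:-z0, 1:] ^ R dvd p"
    then obtain s where "p = [:-z0, 1:] ^ R * s" by auto
    then show "monom 1 R dvd p \<circ>\<^sub>p [:z0, 1:]" by (simp add: pcompose_mult linear_power_shift)
  next
    assume "monom 1 R dvd p \<circ>\<^sub>p [:z0, 1:]"
    then obtain s where s: "p \<circ>\<^sub>p [:z0, 1:] = monom 1 R * s" by auto
    have "p = (monom 1 R * s) \<circ>\<^sub>p [:-z0, 1:]" using shift_unshift[of p z0] s by simp
    also have "\<dots> = [:-z0, 1:] ^ R * (s \<circ>\<^sub>p [:-z0, 1:])"
      by (simp add: pcompose_mult monom_altdef power_pcompose pcompose_pCons)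
    finally show "[:-z0, 1:] ^ R dvd p" by (metis dvd_triv_left)
  qed
  then show ?thesis by (simp add: monom_1_dvd_iff' taylor_coeff_eq_coeff_pcompose)
qed

lemma sum_blocks: "(\<Sum>c<R * n. g c) = (\<Sum>j<R. \<Sum>b<n. g (j * n + b :: nat))"
proof -
  have "(\<Sum>c<R * n. g c) = (\<Sum>j<R. sum g {j * n..<j * n + n})"
    by (rule sum.nat_group[symmetric])
  moreover have "sum g {j * n..<j * n + n} = (\<Sum>b<n. g (j * n + b))" for j
    using sum.shift_bounds_nat_ivl[of g 0 "j * n" n] by (simp add: lessThan_atLeast0 add.commute)
  ultimately show ?thesis by simp
qed

lemma block_index_less:
  assumes "j < R" "b < n"
  shows "j * n + b < R * (n::nat)"
proof -
  have "j * n + b < (j + 1) * n" using assms(2) by simp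
  also have "\<dots> \<le> R * n" using assms(1) by (intro mult_le_mono1) simp
  finally show ?thesis .
qed

text \<open>The blocks are ordered by increasing order of the Taylor coefficient, as the blocks of \<open>T_mat\<close> are.\<close>

definition jet :: "complex \<Rightarrow> nat \<Rightarrow> nat \<Rightarrow> complex poly vec \<Rightarrow> complex vec" where
  "jet z0 n R x = vec (R * n) (\<lambda>i. taylor_coeff z0 (x $ (i mod n)) (i div n))"

text \<open>The right inverse of \<open>jet\<close>: polynomial vectors of degree below \<open>R\<close>.\<close>

definition taylor_vec :: "complex \<Rightarrow> nat \<Rightarrow> nat \<Rightarrow> complex vec \<Rightarrow> complex poly vec" where
  "taylor_vec z0 n R v = vec n (\<lambda>a. \<Sum>j<R. Polynomial.smult (v $ (j * n + a)) ([:-z0, 1:] ^ j))"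

lemma jet_index:
  assumes "m < R" "a < n"
  shows "jet z0 n R x $ (m * n + a) = taylor_coeff z0 (x $ a) m"
  using assms block_index_less[OF assms] by (simp add: jet_def)

lemma jet_carrier [simp]: "jet z0 n R x \<in> carrier_vec (R * n)"
  by (simp add: jet_def)

lemma taylor_vec_carrier [simp]: "taylor_vec z0 n R v \<in> carrier_vec n"
  by (simp add: taylor_vec_def)

lemma block_index_cases:
  assumes "i < R * (n::nat)"
  obtains m a where "m < R" "a < n" "i = m * n + a"
proof -
  have "n > 0" using assms by (cases n) auto
  then show ?thesis using that[of "i div n" "i mod n"] assms
    by (simp add: less_mult_imp_div_less)
qed

lemma jet_taylor_vec:
  assumes v: "v \<in> carrier_vec (R * n)"
  shows "jet z0 n R (taylor_vec z0 n R v) = v"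
proof (rule eq_vecI)
  fix i assume "i < dim_vec v"
  then have "i < R * n" using v by simp
  then obtain m a where ma: "m < R" "a < n" "i = m * n + a" by (rule block_index_cases)
  have "jet z0 n R (taylor_vec z0 n R v) $ i =
      (\<Sum>j<R. v $ (j * n + a) * (if m = j then 1 else 0))"
    using ma by (simp add: jet_index taylor_vec_def taylor_coeff_sum taylor_coeff_smult
        taylor_coeff_linear_power del: mult_pCons_left)
  also have "\<dots> = v $ i" using ma by (simp add: if_distrib cong: if_cong)
  finally show "jet z0 n R (taylor_vec z0 n R v) $ i = v $ i" .
qed (use v in \<open>simp add: jet_def\<close>)

lemma T_mat_carrier [simp]: "T_mat n r Q z0 \<in> carrier_mat ((r + 1) * n) ((r + 1) * n)"
  by (simp add: T_mat_def)

lemma T_mat_index: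
  assumes "m < r + 1" "a < n" "j < r + 1" "b < n"
  shows "T_mat n r Q z0 $$ (m * n + a, j * n + b) =
    (if j \<le> m then taylor_coeff z0 (Q $$ (a,b)) (m - j) else 0)"
  using assms block_index_less[OF assms(1,2)] block_index_less[OF assms(3,4)]
  by (simp add: T_mat_def taylor_coeff_def Let_def)

text \<open>Leibniz' rule in matrix form: the block Toeplitz matrix is multiplication by \<open>Q\<close> on polynomial vectors
modulo \<open>(\<lambda> - z0)^(r+1)\<close>.\<close>

lemma T_mat_jet:
  assumes Q: "Q \<in> carrier_mat n n" and x: "x \<in> carrier_vec n"
  shows "T_mat n r Q z0 *\<^sub>v jet z0 n (r + 1) x = jet z0 n (r + 1) (Q *\<^sub>v x)"
proof (rule eq_vecI)
  fix i assume "i < dim_vec (jet z0 n (r + 1) (Q *\<^sub>v x))"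
  then have i: "i < (r + 1) * n" by (simp add: jet_def)
  then obtain m a where ma: "m < r + 1" "a < n" "i = m * n + a" by (rule block_index_cases)
  let ?t = "taylor_coeff z0"
  have "(T_mat n r Q z0 *\<^sub>v jet z0 n (r + 1) x) $ i =
      (\<Sum>c<(r + 1) * n. T_mat n r Q z0 $$ (i,c) * jet z0 n (r + 1) x $ c)"
    using i by (simp add: T_mat_def jet_def scalar_prod_def lessThan_atLeast0)
  also have "\<dots> = (\<Sum>j<r + 1. \<Sum>b<n. T_mat n r Q z0 $$ (i,j * n + b) * jet z0 n (r + 1) x $ (j * n + b))"
    by (rule sum_blocks)
  also have "\<dots> = (\<Sum>j<r + 1. \<Sum>b<n. (if j \<le> m then ?t (Q $$ (a,b)) (m - j) * ?t (x $ b) j else 0))"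
    by (intro sum.cong refl) (use ma in \<open>simp add: T_mat_index jet_index del: mult_Suc\<close>)
  also have "\<dots> = (\<Sum>b<n. \<Sum>j<r + 1. (if j \<le> m then ?t (Q $$ (a,b)) (m - j) * ?t (x $ b) j else 0))"
    by (rule sum.swap)
  also have "\<dots> = (\<Sum>b<n. \<Sum>j\<le>m. ?t (Q $$ (a,b)) (m - j) * ?t (x $ b) j)"
  proof (rule sum.cong[OF refl])
    fix b
    show "(\<Sum>j<r + 1. (if j \<le> m then ?t (Q $$ (a,b)) (m - j) * ?t (x $ b) j else 0)) =
        (\<Sum>j\<le>m. ?t (Q $$ (a,b)) (m - j) * ?t (x $ b) j)"
      by (rule sum.mono_neutral_cong_right) (use ma in auto)
  qed
  also have "\<dots> = ?t (\<Sum>b<n. Q $$ (a,b) * x $ b) m"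
    by (simp add: taylor_coeff_sum taylor_coeff_mult)
  also have "(\<Sum>b<n. Q $$ (a,b) * x $ b) = (Q *\<^sub>v x) $ a"
    using Q x ma by (simp add: scalar_prod_def lessThan_atLeast0)
  finally show "(T_mat n r Q z0 *\<^sub>v jet z0 n (r + 1) x) $ i = jet z0 n (r + 1) (Q *\<^sub>v x) $ i"
    using ma by (simp add: jet_index)
qed (simp add: T_mat_def jet_def)

lemma jet_eq_0_iff:
  assumes x: "x \<in> carrier_vec n"
  shows "jet z0 n R x = 0\<^sub>v (R * n) \<longleftrightarrow> (\<forall>a<n. [:-z0, 1:] ^ R dvd x $ a)"
proof
  assume j: "jet z0 n R x = 0\<^sub>v (R * n)"
  have "taylor_coeff z0 (x $ a) m = 0" if "a < n" "m < R" for a m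
    using jet_index[OF that(2,1), of z0 x] j block_index_less[OF that(2,1)] by simp
  then show "\<forall>a<n. [:-z0, 1:] ^ R dvd x $ a" by (simp add: linear_power_dvd_iff)
next
  assume d: "\<forall>a<n. [:-z0, 1:] ^ R dvd x $ a"
  show "jet z0 n R x = 0\<^sub>v (R * n)"
  proof (rule eq_vecI)
    fix i assume "i < dim_vec (0\<^sub>v (R * n))"
    then have i: "i < R * n" by simp
    then obtain m a where ma: "m < R" "a < n" "i = m * n + a" by (rule block_index_cases)
    then have "taylor_coeff z0 (x $ a) m = 0" using d by (simp add: linear_power_dvd_iff)
    then show "jet z0 n R x $ i = 0\<^sub>v (R * n) $ i" using ma i by (simp add: jet_index)
  qed (simp add: jet_def)
qed

lemma T_mat_jet_eq_0_iff:
  assumes Q: "Q \<in> carrier_mat n n" and x: "x \<in> carrier_vec n"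
  shows "T_mat n r Q z0 *\<^sub>v jet z0 n (r + 1) x = 0\<^sub>v ((r + 1) * n) \<longleftrightarrow>
    (\<forall>a<n. [:-z0, 1:] ^ (r + 1) dvd (Q *\<^sub>v x) $ a)"
  unfolding T_mat_jet[OF assms] using assms by (intro jet_eq_0_iff) simp

text \<open>Multiply \<open>A y\<close> by the adjugate of \<open>A\<close>.\<close>

lemma dvd_det_mult:
  fixes A :: "'a::comm_ring_1 mat"
  assumes A: "A \<in> carrier_mat n n" and y: "y \<in> carrier_vec n"
    and d: "\<forall>i<n. p dvd (A *\<^sub>v y) $ i" and i: "i < n"
  shows "p dvd det A * y $ i"
proof -
  have "adj_mat A *\<^sub>v (A *\<^sub>v y) = (adj_mat A * A) *\<^sub>v y"
    by (rule assoc_mult_mat_vec[symmetric, OF adj_mat(1)[OF A] A y])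
  also have "\<dots> = det A \<cdot>\<^sub>v y" unfolding adj_mat(3)[OF A] using y by (intro eq_vecI) auto
  finally have "det A * y $ i = (adj_mat A *\<^sub>v (A *\<^sub>v y)) $ i" using i y by simp
  also have "\<dots> = (\<Sum>j<n. adj_mat A $$ (i,j) * (A *\<^sub>v y) $ j)"
    using adj_mat(1)[OF A] i A by (simp add: scalar_prod_def lessThan_atLeast0)
  also have "p dvd \<dots>" using d by (intro dvd_sum dvd_mult) auto
  finally show ?thesis .
qed

lemma dvd_mult_mat_vec:
  fixes A :: "'a::comm_ring_1 mat"
  assumes "A \<in> carrier_mat n n" "y \<in> carrier_vec n" "\<forall>j<n. p dvd y $ j" "i < n"
  shows "p dvd (A *\<^sub>v y) $ i"
proof -
  have "(A *\<^sub>v y) $ i = (\<Sum>j<n. A $$ (i,j) * y $ j)"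
    using assms by (simp add: scalar_prod_def lessThan_atLeast0)
  also have "p dvd \<dots>" using assms(3) by (intro dvd_sum dvd_mult) auto
  finally show ?thesis .
qed

lemma unimodular_dvd_iff:
  assumes E: "unimodular n E" and y: "y \<in> carrier_vec n"
  shows "(\<forall>i<n. p dvd (E *\<^sub>v y) $ i) \<longleftrightarrow> (\<forall>i<n. p dvd y $ i)"
proof -
  obtain c where c: "c \<noteq> 0" "det E = [:c:]" and Ec: "E \<in> carrier_mat n n"
    using E by (auto simp: unimodular_def)
  have u: "p dvd [:c:] * q \<longleftrightarrow> p dvd q" for q
    using c(1) by (simp add: dvd_smult_iff)
  show ?thesis
    using dvd_det_mult[OF Ec y, of p] dvd_mult_mat_vec[OF Ec y, of p] unfolding c(2) u by blast
qed

text \<open>A kernel vector is the jet of some \<open>x\<close> such that \<open>L^(r+1)\<close> divides \<open>Q x\<close>, hence also \<open>det Q\<close> times each entry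
of \<open>x\<close>. As \<open>det Q\<close> does not vanish at \<open>z0\<close>, the power divides the entries themselves, and the jet is zero.\<close>

lemma T_mat_invertible:
  assumes Q: "Q \<in> carrier_mat n n" and z: "poly (det Q) z0 \<noteq> 0"
  shows "det (T_mat n r Q z0) \<noteq> 0"
proof
  assume "det (T_mat n r Q z0) = 0"
  then obtain v where v: "v \<in> carrier_vec ((r + 1) * n)" "v \<noteq> 0\<^sub>v ((r + 1) * n)"
    "T_mat n r Q z0 *\<^sub>v v = 0\<^sub>v ((r + 1) * n)"
    using det_0_iff_vec_prod_zero_field[OF T_mat_carrier] by blast
  define x where "x = taylor_vec z0 n (r + 1) v"
  have x: "x \<in> carrier_vec n" by (simp add: x_def)
  have jx: "jet z0 n (r + 1) x = v" unfolding x_def by (rule jet_taylor_vec[OF v(1)])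
  have "\<forall>a<n. [:-z0, 1:] ^ (r + 1) dvd (Q *\<^sub>v x) $ a"
    by (rule iffD1[OF T_mat_jet_eq_0_iff[OF Q x, where r = r and ?z0.0 = z0, unfolded jx] v(3)])
  then have d: "[:-z0, 1:] ^ (r + 1) dvd det Q * x $ a" if "a < n" for a
    using dvd_det_mult[OF Q x] that by blast
  have "[:-z0, 1:] ^ (r + 1) dvd x $ a" if "a < n" for a
  proof (cases "x $ a = 0")
    case False
    moreover have "det Q \<noteq> 0" using z by auto
    ultimately have ne: "det Q * x $ a \<noteq> 0" by simp
    then have "r + 1 \<le> order z0 (det Q * x $ a)" using d[OF that] order_divides by blast
    also have "\<dots> = order z0 (x $ a)" using order_mult[OF ne] order_0I[OF z] by simp
    finally show ?thesis using order_divides by blast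
  qed simp
  then have "v = 0\<^sub>v ((r + 1) * n)" using jet_eq_0_iff[OF x, of z0 "r + 1"] jx by blast
  then show False using v(2) by blast
qed

section \<open>Existence of the Smith form\<close>

lemma mult_mat_index:
  "X \<in> carrier_mat n m \<Longrightarrow> Y \<in> carrier_mat m p \<Longrightarrow> i < n \<Longrightarrow> j < p \<Longrightarrow>
    (X * Y) $$ (i,j) = (\<Sum>l<m. X $$ (i,l) * Y $$ (l,j))"
  by (simp add: scalar_prod_def lessThan_atLeast0)

lemma unimodular_carrier: "unimodular n E \<Longrightarrow> E \<in> carrier_mat n n"
  by (simp add: unimodular_def)

lemma unimodularI: "E \<in> carrier_mat n n \<Longrightarrow> det E = [:c:] \<Longrightarrow> c \<noteq> 0 \<Longrightarrow> unimodular n E"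
  by (auto simp: unimodular_def)

lemma unimodular_one: "unimodular n (1\<^sub>m n)"
  by (rule unimodularI[of _ _ 1]) (simp_all add: one_pCons)

lemma unimodular_mult:
  assumes "unimodular n E" "unimodular n F"
  shows "unimodular n (E * F)"
  using assms det_mult[of E n F] unfolding unimodular_def
  by (auto simp: mult_eq_0_iff)

lemma unimodular_inverse:
  assumes E: "unimodular n E"
  obtains E' where "unimodular n E'" "E' * E = 1\<^sub>m n" "E * E' = 1\<^sub>m n"
proof -
  obtain c where c: "c \<noteq> 0" "det E = [:c:]" and Ec: "E \<in> carrier_mat n n"
    using E by (auto simp: unimodular_def)
  define E' where "E' = [:1 / c:] \<cdot>\<^sub>m adj_mat E"
  have E'c: "E' \<in> carrier_mat n n" using adj_mat(1)[OF Ec] by (simp add: E'_def)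
  have 1: "E' * E = 1\<^sub>m n"
    unfolding E'_def using adj_mat[OF Ec] c Ec
    by (subst mult_smult_assoc_mat[of _ n n _ n]) (auto intro!: eq_matI simp: one_pCons)
  have 2: "E * E' = 1\<^sub>m n"
    unfolding E'_def using adj_mat[OF Ec] c Ec
    by (subst mult_smult_distrib[of _ n n _ n]) (auto intro!: eq_matI simp: one_pCons)
  have "det E' * [:c:] = 1" using det_mult[OF E'c Ec] 1 c by simp
  then have "det E' dvd 1" by (metis dvd_triv_left)
  then have "degree (det E') = 0" "det E' \<noteq> 0" by (auto simp: is_unit_poly_iff)
  then obtain b where "det E' = [:b:]" "b \<noteq> 0" by (metis degree_0_id pCons_eq_0_iff degree_eq_zeroE)
  then have "unimodular n E'" using E'c by (auto simp: unimodular_def)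
  then show ?thesis using 1 2 that by blast
qed

text \<open>One matrix serves for rows and for columns, since it is its own transpose.\<close>

lemma unimodular_swap:
  assumes "i0 < n"
  obtains S where "unimodular n S"
    "\<And>M j. M \<in> carrier_mat n n \<Longrightarrow> j < n \<Longrightarrow> (S * M) $$ (0,j) = M $$ (i0,j)"
    "\<And>M j. M \<in> carrier_mat n n \<Longrightarrow> j < n \<Longrightarrow> (M * S) $$ (j,0) = M $$ (j,i0)"
proof (cases "i0 = 0")
  case True
  then show ?thesis using that[of "1\<^sub>m n"] unimodular_one by simp
next
  case False
  let ?S = "swaprows_mat n 0 i0 :: complex poly mat"
  have "[:-1:] = (-1 :: complex poly)" by (simp add: one_pCons)
  then have "det ?S = [:-1:]" using det_swaprows_mat[of 0 n i0] assms False by simp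
  then have u: "unimodular n ?S" by (intro unimodularI[of _ _ "-1"]) auto
  have 1: "(?S * M) $$ (0,j) = M $$ (i0,j)" if M: "M \<in> carrier_mat n n" and j: "j < n" for M j
  proof -
    have "(?S * M) $$ (0,j) = (\<Sum>l<n. ?S $$ (0,l) * M $$ (l,j))"
      using M j assms by (simp add: scalar_prod_def lessThan_atLeast0)
    also have "\<dots> = (\<Sum>l<n. if l = i0 then M $$ (l,j) else 0)"
      by (rule sum.cong) (use assms False in auto)
    finally show ?thesis using assms by simp
  qed
  have 2: "(M * ?S) $$ (j,0) = M $$ (j,i0)" if M: "M \<in> carrier_mat n n" and j: "j < n" for M j
  proof -
    have "(M * ?S) $$ (j,0) = (\<Sum>l<n. M $$ (j,l) * ?S $$ (l,0))"
      using M j assms by (simp add: scalar_prod_def lessThan_atLeast0)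
    also have "\<dots> = (\<Sum>l<n. if l = i0 then M $$ (j,l) else 0)"
      by (rule sum.cong) (use assms False in auto)
    finally show ?thesis using assms by simp
  qed
  show ?thesis by (rule that[OF u 1 2])
qed

definition col_transvection :: "nat \<Rightarrow> (nat \<Rightarrow> complex poly) \<Rightarrow> complex poly mat" where
  "col_transvection n q = mat n n (\<lambda>(i,j). if i = j then 1 else if j = 0 then q i else 0)"

definition row_transvection :: "nat \<Rightarrow> (nat \<Rightarrow> complex poly) \<Rightarrow> complex poly mat" where
  "row_transvection n q = mat n n (\<lambda>(i,j). if i = j then 1 else if i = 0 then q j else 0)"

lemma unimodular_col_transvection: "unimodular n (col_transvection n q)"
proof -
  have "det (col_transvection n q) = prod_list (diag_mat (col_transvection n q))"
    by (rule det_lower_triangular[of n]) (auto simp: col_transvection_def)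
  also have "diag_mat (col_transvection n q) = replicate n 1"
    by (auto simp: diag_mat_def col_transvection_def intro!: nth_equalityI)
  finally have "det (col_transvection n q) = [:1:]" by simp
  then show ?thesis by (intro unimodularI[of _ _ 1]) (auto simp: col_transvection_def)
qed

lemma unimodular_row_transvection: "unimodular n (row_transvection n q)"
proof -
  have "det (row_transvection n q) = prod_list (diag_mat (row_transvection n q))"
    by (rule det_upper_triangular[of _ n]) (auto simp: row_transvection_def upper_triangular_def)
  also have "diag_mat (row_transvection n q) = replicate n 1"
    by (auto simp: diag_mat_def row_transvection_def intro!: nth_equalityI)
  finally have "det (row_transvection n q) = [:1:]" by simp
  then show ?thesis by (intro unimodularI[of _ _ 1]) (auto simp: row_transvection_def)
qed

lemma col_transvection_mult:
  assumes M: "M \<in> carrier_mat n n" and ij: "i < n" "j < n"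
  shows "(col_transvection n q * M) $$ (i,j) = M $$ (i,j) + (if i = 0 then 0 else q i * M $$ (0,j))"
proof -
  have "(col_transvection n q * M) $$ (i,j) = (\<Sum>l<n. col_transvection n q $$ (i,l) * M $$ (l,j))"
    using M ij by (simp add: scalar_prod_def lessThan_atLeast0 col_transvection_def)
  also have "\<dots> = (\<Sum>l<n. (if l = i then M $$ (l,j) else 0) +
      (if l = 0 then (if i = 0 then 0 else q i * M $$ (0,j)) else 0))"
    by (rule sum.cong) (use ij in \<open>auto simp: col_transvection_def\<close>)
  also have "\<dots> = M $$ (i,j) + (if i = 0 then 0 else q i * M $$ (0,j))"
    unfolding sum.distrib using ij by (simp add: sum.delta)
  finally show ?thesis .
qed

lemma mult_row_transvection:
  assumes M: "M \<in> carrier_mat n n" and ij: "i < n" "j < n"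
  shows "(M * row_transvection n q) $$ (i,j) = M $$ (i,j) + (if j = 0 then 0 else M $$ (i,0) * q j)"
proof -
  have "(M * row_transvection n q) $$ (i,j) = (\<Sum>l<n. M $$ (i,l) * row_transvection n q $$ (l,j))"
    using M ij by (simp add: scalar_prod_def lessThan_atLeast0 row_transvection_def)
  also have "\<dots> = (\<Sum>l<n. (if l = j then M $$ (i,l) else 0) +
      (if l = 0 then (if j = 0 then 0 else M $$ (i,0) * q j) else 0))"
    by (rule sum.cong) (use ij in \<open>auto simp: row_transvection_def\<close>)
  also have "\<dots> = M $$ (i,j) + (if j = 0 then 0 else M $$ (i,0) * q j)"
    unfolding sum.distrib using ij by (simp add: sum.delta)
  finally show ?thesis .
qed

lemma row_transvection_mult_0:
  assumes M: "M \<in> carrier_mat n n" and ij: "i0 < n" "i0 \<noteq> 0" "j < n"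
  shows "(row_transvection n (\<lambda>l. if l = i0 then 1 else 0) * M) $$ (0,j) = M $$ (0,j) + M $$ (i0,j)"
proof -
  let ?R = "row_transvection n (\<lambda>l. if l = i0 then 1 else 0)"
  have "(?R * M) $$ (0,j) = (\<Sum>l<n. ?R $$ (0,l) * M $$ (l,j))"
    using M ij by (simp add: scalar_prod_def lessThan_atLeast0 row_transvection_def)
  also have "\<dots> = (\<Sum>l<n. (if l = 0 then M $$ (l,j) else 0) + (if l = i0 then M $$ (l,j) else 0))"
    by (rule sum.cong) (use ij in \<open>auto simp: row_transvection_def\<close>)
  also have "\<dots> = M $$ (0,j) + M $$ (i0,j)"
    unfolding sum.distrib using ij by (simp add: sum.delta)
  finally show ?thesis .
qed

definition reachable :: "nat \<Rightarrow> complex poly mat \<Rightarrow> complex poly mat \<Rightarrow> bool" where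
  "reachable n M M' \<longleftrightarrow> (\<exists>E F. unimodular n E \<and> unimodular n F \<and> M' = E * M * F)"

lemma reachable_refl: "M \<in> carrier_mat n n \<Longrightarrow> reachable n M M"
  unfolding reachable_def using unimodular_one[of n]
  by (intro exI[of _ "1\<^sub>m n"]) simp

lemma reachable_carrier: "M \<in> carrier_mat n n \<Longrightarrow> reachable n M M' \<Longrightarrow> M' \<in> carrier_mat n n"
  unfolding reachable_def unimodular_def by auto

lemma reachable_left:
  assumes M: "M \<in> carrier_mat n n" and r: "reachable n M M'" and X: "unimodular n X"
  shows "reachable n M (X * M')"
proof -
  obtain E F where EF: "unimodular n E" "unimodular n F" "M' = E * M * F"
    using r by (auto simp: reachable_def)
  note c = EF(1,2)[THEN unimodular_carrier] X[THEN unimodular_carrier] M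
  have "X * M' = (X * E) * M * F"
    unfolding EF(3) using c by (simp add: assoc_mult_mat[of _ n n _ n _ n])
  then show ?thesis unfolding reachable_def using unimodular_mult[OF X EF(1)] EF(2) by blast
qed

lemma reachable_right:
  assumes M: "M \<in> carrier_mat n n" and r: "reachable n M M'" and X: "unimodular n X"
  shows "reachable n M (M' * X)"
proof -
  obtain E F where EF: "unimodular n E" "unimodular n F" "M' = E * M * F"
    using r by (auto simp: reachable_def)
  note c = EF(1,2)[THEN unimodular_carrier] X[THEN unimodular_carrier] M
  have "M' * X = E * M * (F * X)"
    unfolding EF(3) using c by (simp add: assoc_mult_mat[of _ n n _ n _ n])
  then show ?thesis unfolding reachable_def using unimodular_mult[OF EF(2) X] EF(1) by blast
qed

text \<open>Among the nonzero entries of all equivalent matrices take one of least degree and move it to the corner.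
Elementary operations that divide with remainder by it produce no nonzero remainder, so it divides its column
and its row, which can be cleared. Adding another row to the first one then shows that it divides every entry.\<close>

lemma smith_pivot:
  assumes M: "M \<in> carrier_mat n n" and nz: "M \<noteq> 0\<^sub>m n n"
  obtains M' d where "reachable n M M'" "lead_coeff d = 1" "M' $$ (0,0) = d"
    "\<And>i. i < n \<Longrightarrow> i \<noteq> 0 \<Longrightarrow> M' $$ (i,0) = 0" "\<And>j. j < n \<Longrightarrow> j \<noteq> 0 \<Longrightarrow> M' $$ (0,j) = 0"
    "\<And>i j. i < n \<Longrightarrow> j < n \<Longrightarrow> d dvd M' $$ (i,j)"
proof -
  define Q where "Q e \<longleftrightarrow> (\<exists>M' i j. reachable n M M' \<and> i < n \<and> j < n \<and> M' $$ (i,j) \<noteq> 0 \<and> degree (M' $$ (i,j)) = e)" for e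
  have "\<exists>i<n. \<exists>j<n. M $$ (i,j) \<noteq> 0"
  proof (rule ccontr)
    assume "\<not> ?thesis"
    then have "M = 0\<^sub>m n n" using M by (intro eq_matI) auto
    then show False using nz by blast
  qed
  then have "\<exists>e. Q e" unfolding Q_def using reachable_refl[OF M] by blast
  then have QL: "Q (LEAST e. Q e)" by (rule LeastI_ex)
  define e where "e = (LEAST e. Q e)"
  have min: "e \<le> degree (M' $$ (i,j))" if "reachable n M M'" "i < n" "j < n" "M' $$ (i,j) \<noteq> 0" for M' i j
    unfolding e_def by (rule Least_le) (use that in \<open>auto simp: Q_def\<close>)
  obtain M1 i1 j1 where M1: "reachable n M M1" "i1 < n" "j1 < n" "M1 $$ (i1,j1) \<noteq> 0" "degree (M1 $$ (i1,j1)) = e"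
    using QL unfolding Q_def e_def by blast
  note M1c = reachable_carrier[OF M M1(1)]
  have n0: "0 < n" using M1(2) by simp
  obtain S where S: "unimodular n S"
    "\<And>M j. M \<in> carrier_mat n n \<Longrightarrow> j < n \<Longrightarrow> (S * M) $$ (0,j) = M $$ (i1,j)"
    by (rule unimodular_swap[OF M1(2)]) (rule that)
  obtain S' where S': "unimodular n S'"
    "\<And>M j. M \<in> carrier_mat n n \<Longrightarrow> j < n \<Longrightarrow> (M * S') $$ (j,0) = M $$ (j,j1)"
    by (rule unimodular_swap[OF M1(3)]) (rule that)
  have SM: "S * M1 \<in> carrier_mat n n" using unimodular_carrier[OF S(1)] M1c by simp
  define M2 where "M2 = S * M1 * S'"
  have M2: "reachable n M M2" unfolding M2_def
    by (intro reachable_right[OF M] reachable_left[OF M] M1 S S')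
  note M2c = reachable_carrier[OF M M2]
  have M200: "M2 $$ (0,0) = M1 $$ (i1,j1)"
    unfolding M2_def S'(2)[OF SM n0] S(2)[OF M1c M1(3)] ..
  \<comment> \<open>minimality turns every remainder of a division by the pivot into zero\<close>
  have divides: "M' $$ (0,0) dvd p"
    if r: "reachable n M M''" and a: "i < n" "j < n" "M'' $$ (i,j) = p mod M' $$ (0,0)"
      and d: "degree (M' $$ (0,0)) = e" "M' $$ (0,0) \<noteq> 0" for M' M'' i j p
  proof (rule ccontr)
    assume "\<not> ?thesis"
    then have nz: "p mod M' $$ (0,0) \<noteq> 0" by (simp add: dvd_eq_mod_eq_0)
    then have "e \<le> degree (p mod M' $$ (0,0))" using min[OF r a(1,2)] a(3) by simp
    then show False using degree_mod_less'[OF d(2) nz] d(1) by simp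
  qed
  have col: "M' $$ (0,0) dvd M' $$ (i,0)"
    if r: "reachable n M M'" and d: "degree (M' $$ (0,0)) = e" "M' $$ (0,0) \<noteq> 0" and i: "i < n" for M' i
  proof (cases "i = 0")
    case False
    let ?q = "\<lambda>i. - (M' $$ (i,0) div M' $$ (0,0))"
    have "(col_transvection n ?q * M') $$ (i,0) = M' $$ (i,0) mod M' $$ (0,0)"
      using col_transvection_mult[OF reachable_carrier[OF M r] i n0] False
      by (simp add: minus_div_mult_eq_mod[symmetric])
    then show ?thesis
      by (rule divides[OF reachable_left[OF M r unimodular_col_transvection] i n0 _ d])
  qed simp
  have row: "M' $$ (0,0) dvd M' $$ (0,j)"
    if r: "reachable n M M'" and d: "degree (M' $$ (0,0)) = e" "M' $$ (0,0) \<noteq> 0" and j: "j < n" for M' j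
  proof (cases "j = 0")
    case False
    let ?q = "\<lambda>j. - (M' $$ (0,j) div M' $$ (0,0))"
    have "(M' * row_transvection n ?q) $$ (0,j) = M' $$ (0,j) mod M' $$ (0,0)"
      using mult_row_transvection[OF reachable_carrier[OF M r] n0 j] False
      by (simp add: minus_mult_div_eq_mod[symmetric])
    then show ?thesis
      by (rule divides[OF reachable_right[OF M r unimodular_row_transvection] n0 j _ d])
  qed simp
  define M3 where "M3 = col_transvection n (\<lambda>i. - (M2 $$ (i,0) div M2 $$ (0,0))) * M2"
  have M3: "reachable n M M3" unfolding M3_def
    by (rule reachable_left[OF M M2 unimodular_col_transvection])
  note M3c = reachable_carrier[OF M M3]
  have M3i: "M3 $$ (i,j) = M2 $$ (i,j) + (if i = 0 then 0 else - (M2 $$ (i,0) div M2 $$ (0,0)) * M2 $$ (0,j))"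
    if "i < n" "j < n" for i j unfolding M3_def by (rule col_transvection_mult[OF M2c that])
  have M300: "M3 $$ (0,0) = M2 $$ (0,0)" using M3i n0 by simp
  have M3d: "degree (M3 $$ (0,0)) = e" "M3 $$ (0,0) \<noteq> 0" using M300 M200 M1 by auto
  have M3col: "M3 $$ (i,0) = 0" if "i < n" "i \<noteq> 0" for i
    using M3i[OF that(1) n0] that col[OF M2 _ _ that(1)] M200 M1 by simp
  define M4 where "M4 = M3 * row_transvection n (\<lambda>j. - (M3 $$ (0,j) div M3 $$ (0,0)))"
  have M4: "reachable n M M4" unfolding M4_def
    by (rule reachable_right[OF M M3 unimodular_row_transvection])
  note M4c = reachable_carrier[OF M M4]
  have M4i: "M4 $$ (i,j) = M3 $$ (i,j) + (if j = 0 then 0 else M3 $$ (i,0) * - (M3 $$ (0,j) div M3 $$ (0,0)))"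
    if "i < n" "j < n" for i j unfolding M4_def by (rule mult_row_transvection[OF M3c that])
  have M400: "M4 $$ (0,0) = M3 $$ (0,0)" using M4i n0 by simp
  have M4d: "degree (M4 $$ (0,0)) = e" "M4 $$ (0,0) \<noteq> 0" using M400 M3d by auto
  have M4col: "M4 $$ (i,0) = 0" if "i < n" "i \<noteq> 0" for i
    using M4i[OF that(1) n0] M3col[OF that] by simp
  have M4row: "M4 $$ (0,j) = 0" if "j < n" "j \<noteq> 0" for j
    using M4i[OF n0 that(1)] that row[OF M3 M3d that(1)] by simp
  have M4dvd: "M4 $$ (0,0) dvd M4 $$ (i,j)" if ij: "i < n" "j < n" for i j
  proof (cases "i = 0 \<or> j = 0")
    case True
    then show ?thesis using M4row M4col ij by (cases "i = 0"; cases "j = 0") auto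
  next
    case False
    let ?R = "row_transvection n (\<lambda>l. if l = i then 1 else 0)"
    have R: "reachable n M (?R * M4)" by (rule reachable_left[OF M M4 unimodular_row_transvection])
    have e0: "(?R * M4) $$ (0,l) = M4 $$ (0,l) + M4 $$ (i,l)" if "l < n" for l
      by (rule row_transvection_mult_0[OF M4c ij(1) _ that]) (use False in simp)
    have 00: "(?R * M4) $$ (0,0) = M4 $$ (0,0)" using e0[OF n0] M4col[of i] ij False by simp
    have "(?R * M4) $$ (0,0) dvd (?R * M4) $$ (0,j)"
      by (rule row[OF R _ _ ij(2)]) (use 00 M4d in simp_all)
    then show ?thesis using 00 e0[OF ij(2)] M4row[of j] ij False by simp
  qed
  define c where "c = 1 / lead_coeff (M4 $$ (0,0))"
  have lc: "lead_coeff (M4 $$ (0,0)) \<noteq> 0" using M4d(2) leading_coeff_0_iff by blast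
  then have c0: "c \<noteq> 0" unfolding c_def by simp
  define M5 where "M5 = ([:c:] \<cdot>\<^sub>m 1\<^sub>m n) * M4"
  have "unimodular n ([:c:] \<cdot>\<^sub>m 1\<^sub>m n)"
    by (rule unimodularI[of _ _ "c ^ n"]) (use c0 in \<open>auto simp: poly_const_pow\<close>)
  then have M5: "reachable n M M5" unfolding M5_def by (rule reachable_left[OF M M4])
  have M5i: "M5 $$ (i,j) = Polynomial.smult c (M4 $$ (i,j))" if "i < n" "j < n" for i j
    using that M4c by (simp add: M5_def mult_smult_assoc_mat[of _ n n _ n])
  show ?thesis
  proof (rule that[OF M5, of "Polynomial.smult c (M4 $$ (0,0))"])
    show "lead_coeff (Polynomial.smult c (M4 $$ (0,0))) = 1"
      using lc unfolding lead_coeff_smult c_def by simp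
  qed (use M5i M4col M4row M4dvd n0 c0 in \<open>auto simp: smult_dvd_iff dvd_smult_iff intro: dvd_smult\<close>)
qed

lemma mat_diag_mult_vec:
  assumes "y \<in> carrier_vec n" "i < n"
  shows "(mat_diag n f *\<^sub>v y) $ i = f i * (y $ i :: 'a::comm_ring_1)"
proof -
  have "(mat_diag n f *\<^sub>v y) $ i = (\<Sum>l<n. mat_diag n f $$ (i,l) * y $ l)"
    using assms by (simp add: mat_diag_def scalar_prod_def lessThan_atLeast0)
  also have "\<dots> = (\<Sum>l<n. if l = i then f l * y $ l else 0)"
    by (rule sum.cong) (use assms in \<open>auto simp: mat_diag_def\<close>)
  finally show ?thesis using assms by simp
qed

lemma det_mat_diag: "det (mat_diag n f :: 'a::comm_ring_1 mat) = (\<Prod>i<n. f i)"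
proof -
  have "det (mat_diag n f) = prod_list (diag_mat (mat_diag n f))"
    by (rule det_upper_triangular[of _ n]) (auto simp: mat_diag_def upper_triangular_def)
  also have "diag_mat (mat_diag n f) = map f [0..<n]"
    by (auto simp: diag_mat_def mat_diag_def intro!: nth_equalityI)
  finally show ?thesis by (simp add: prod.list_conv_set_nth lessThan_atLeast0)
qed

text \<open>Induction on the size: the pivot splits off. It divides all entries of the remaining block, hence also of
every matrix equivalent to that block, in particular the next diagonal entry.\<close>

lemma smith_reduction:
  assumes "M \<in> carrier_mat n n"
  shows "\<exists>ds. length ds \<le> n \<and> (\<forall>i < length ds. lead_coeff (ds ! i) = 1) \<and>
    (\<forall>i. Suc i < length ds \<longrightarrow> ds ! i dvd ds ! Suc i) \<and>
    reachable n M (mat_diag n (\<lambda>i. if i < length ds then ds ! i else 0))"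
  using assms
proof (induction n arbitrary: M)
  case 0
  then have "M = mat_diag 0 (\<lambda>i. if i < length [] then [] ! i else 0)"
    by (intro eq_matI) (auto simp: mat_diag_def)
  then show ?case using reachable_refl[OF 0] by (intro exI[of _ "[]"]) simp
next
  case (Suc n)
  show ?case
  proof (cases "M = 0\<^sub>m (Suc n) (Suc n)")
    case True
    then have "M = mat_diag (Suc n) (\<lambda>i. if i < length [] then [] ! i else 0)"
      by (intro eq_matI) (auto simp: mat_diag_def)
    then show ?thesis using reachable_refl[OF Suc.prems] by (intro exI[of _ "[]"]) simp
  next
    case False
    obtain M' d where M': "reachable (Suc n) M M'" "lead_coeff d = 1" "M' $$ (0,0) = d"
      "\<And>i. i < Suc n \<Longrightarrow> i \<noteq> 0 \<Longrightarrow> M' $$ (i,0) = 0" "\<And>j. j < Suc n \<Longrightarrow> j \<noteq> 0 \<Longrightarrow> M' $$ (0,j) = 0"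
      "\<And>i j. i < Suc n \<Longrightarrow> j < Suc n \<Longrightarrow> d dvd M' $$ (i,j)"
      by (rule smith_pivot[OF Suc.prems False]) (rule that)
    note M'c = reachable_carrier[OF Suc.prems M'(1)]
    define N where "N = mat n n (\<lambda>(i,j). M' $$ (Suc i, Suc j))"
    have Nc: "N \<in> carrier_mat n n" by (simp add: N_def)
    have M'4: "M' = four_block_mat (mat 1 1 (\<lambda>_. d)) (0\<^sub>m 1 n) (0\<^sub>m n 1) N"
      using M'c M'(3-5) by (intro eq_matI) (auto simp: N_def)
    obtain ds where ds: "length ds \<le> n" "\<forall>i < length ds. lead_coeff (ds ! i) = 1"
      "\<forall>i. Suc i < length ds \<longrightarrow> ds ! i dvd ds ! Suc i"
      "reachable n N (mat_diag n (\<lambda>i. if i < length ds then ds ! i else 0))"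
      using Suc.IH[OF Nc] by blast
    define D where "D = mat_diag n (\<lambda>i. if i < length ds then ds ! i else 0)"
    obtain E F where EF: "unimodular n E" "unimodular n F" "D = E * N * F"
      using ds(4) unfolding D_def reachable_def by blast
    note c = EF(1,2)[THEN unimodular_carrier]
    define bl where "bl X = four_block_mat (1\<^sub>m 1) (0\<^sub>m 1 n) (0\<^sub>m n 1) X" for X :: "complex poly mat"
    have blu: "unimodular (Suc n) (bl X)" if X: "unimodular n X" for X
    proof -
      have "det (bl X) = det (1\<^sub>m 1) * det X"
        unfolding bl_def by (rule det_four_block_mat_upper_right_zero) (use X in \<open>auto simp: unimodular_def\<close>)
      moreover have "bl X \<in> carrier_mat (1 + n) (1 + n)"
        unfolding bl_def using unimodular_carrier[OF X] by (intro four_block_carrier_mat) auto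
      ultimately show ?thesis using X unfolding unimodular_def by auto
    qed
    have "bl E * M' = four_block_mat (mat 1 1 (\<lambda>_. d)) (0\<^sub>m 1 n) (0\<^sub>m n 1) (E * N)"
      unfolding M'4 bl_def using c Nc
      by (subst mult_four_block_mat[of _ 1 1 _ n _ n _ _ 1 _ n]) auto
    then have prod: "bl E * M' * bl F = four_block_mat (mat 1 1 (\<lambda>_. d)) (0\<^sub>m 1 n) (0\<^sub>m n 1) D"
      unfolding bl_def EF(3) using c Nc
      by (simp, subst mult_four_block_mat[of _ 1 1 _ n _ n _ _ 1 _ n]) auto
    also have "\<dots> = mat_diag (Suc n) (\<lambda>i. if i < length (d # ds) then (d # ds) ! i else 0)"
      unfolding D_def by (intro eq_matI) (auto simp: mat_diag_def nth_Cons split: nat.splits)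
    finally have R: "reachable (Suc n) M (mat_diag (Suc n) (\<lambda>i. if i < length (d # ds) then (d # ds) ! i else 0))"
      using reachable_right[OF Suc.prems reachable_left[OF Suc.prems M'(1) blu[OF EF(1)]] blu[OF EF(2)]] by simp
    have dN: "d dvd (E * N * F) $$ (i,j)" if ij: "i < n" "j < n" for i j
    proof -
      have 1: "d dvd (E * N) $$ (i,l)" if "l < n" for l
      proof -
        have "(E * N) $$ (i,l) = (\<Sum>m<n. E $$ (i,m) * N $$ (m,l))"
          using c Nc ij that by (simp add: scalar_prod_def lessThan_atLeast0)
        also have "d dvd \<dots>" using M'(6) that by (intro dvd_sum dvd_mult) (simp add: N_def)
        finally show ?thesis .
      qed
      have "(E * N * F) $$ (i,j) = (\<Sum>l<n. (E * N) $$ (i,l) * F $$ (l,j))"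
        by (rule mult_mat_index) (use c Nc ij in auto)
      also have "d dvd \<dots>" using 1 by (intro dvd_sum dvd_mult2) simp
      finally show ?thesis .
    qed
    have d0: "d dvd ds ! 0" if "0 < length ds"
    proof -
      have "0 < n" using that ds(1) by linarith
      then show ?thesis using dN[of 0 0] that unfolding EF(3)[symmetric] D_def by (simp add: mat_diag_def)
    qed
    show ?thesis
    proof (intro exI[of _ "d # ds"] conjI allI impI)
      fix i assume i: "Suc i < length (d # ds)"
      then show "(d # ds) ! i dvd (d # ds) ! Suc i" using d0 ds(3) by (cases i) auto
    next
      fix i assume i: "i < length (d # ds)"
      then show "lead_coeff ((d # ds) ! i) = 1" using M'(2) ds(2) by (cases i) auto
    qed (use ds(1) R in auto)
  qed
qed

lemma smith_form_exists:
  assumes M: "M \<in> carrier_mat n n"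
  obtains ds where "smith_form n M ds"
proof -
  obtain ds where ds: "length ds \<le> n" "\<forall>i < length ds. lead_coeff (ds ! i) = 1"
    "\<forall>i. Suc i < length ds \<longrightarrow> ds ! i dvd ds ! Suc i"
    "reachable n M (mat_diag n (\<lambda>i. if i < length ds then ds ! i else 0))"
    using smith_reduction[OF M] by blast
  define D where "D = mat_diag n (\<lambda>i. if i < length ds then ds ! i else 0)"
  obtain E F where EF: "unimodular n E" "unimodular n F" "D = E * M * F"
    using ds(4) unfolding D_def reachable_def by blast
  obtain E' where E': "unimodular n E'" "E' * E = 1\<^sub>m n" by (rule unimodular_inverse[OF EF(1)])
  obtain F' where F': "unimodular n F'" "F * F' = 1\<^sub>m n" by (rule unimodular_inverse[OF EF(2)])
  note c = EF(1,2)[THEN unimodular_carrier] E'(1)[THEN unimodular_carrier] F'(1)[THEN unimodular_carrier]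
  have "E' * D * F' = E' * (E * (M * F)) * F'"
    unfolding EF(3) using c M by (simp add: assoc_mult_mat[of _ n n _ n _ n])
  also have "E' * (E * (M * F)) = M * F"
    using c M E'(2) assoc_mult_mat[of E' n n E n "M * F" n] by simp
  also have "M * F * F' = M"
    using c M F'(2) assoc_mult_mat[of M n n F n F' n] by simp
  finally have "M = E' * D * F'" by simp
  then have "smith_form n M ds"
    unfolding smith_form_def D_def using ds(1-3) E'(1) F'(1) by blast
  then show ?thesis by (rule that)
qed

lemma smult_sum_right: "Polynomial.smult c (sum f I) = (\<Sum>i\<in>I. Polynomial.smult c (f i))"
  by (induction I rule: infinite_finite_induct) (simp_all add: smult_add_right)

section \<open>Elementary divisors and the kernel of the block Toeplitz matrix\<close>

text \<open>Let \<open>Q = E D F\<close> be a Smith form. The vector \<open>y = F x\<close> does not vanish at \<open>z0\<close> either, as \<open>F\<close> is unimodular.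
For an entry \<open>y_i\<close> with \<open>y_i(z0) \<noteq> 0\<close>, the divisor \<open>L^R\<close> of \<open>d_i y_i\<close> must divide \<open>d_i\<close>.\<close>

lemma elementary_divisor_of_root_vector:
  assumes Q: "Q \<in> carrier_mat n n" and det: "det Q \<noteq> 0"
    and x: "x \<in> carrier_vec n" and i0: "i0 < n" "poly (x $ i0) z0 \<noteq> 0"
    and dv: "\<forall>a<n. [:-z0, 1:] ^ R dvd (Q *\<^sub>v x) $ a" and R: "1 \<le> R"
  obtains j where "R \<le> j" "[:-z0, 1:] ^ j \<in> elementary_divisors n Q"
proof -
  obtain ds where ds: "smith_form n Q ds" by (rule smith_form_exists[OF Q])
  define f where "f i = (if i < length ds then ds ! i else 0)" for i
  obtain E F where EF0: "unimodular n E" "unimodular n F" "Q = E * mat_diag n f * F"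
    using ds unfolding smith_form_def f_def by blast
  define D where "D = mat_diag n f"
  note EF = EF0[folded D_def]
  have Dc: "D \<in> carrier_mat n n" by (simp add: D_def)
  have Dv: "(D *\<^sub>v w) $ i = f i * w $ i" if "w \<in> carrier_vec n" "i < n" for w i
    unfolding D_def by (rule mat_diag_mult_vec[OF that])
  have Ddet: "det D = (\<Prod>i<n. f i)" unfolding D_def by (rule det_mat_diag)
  note c = EF(1,2)[THEN unimodular_carrier]
  define y where "y = F *\<^sub>v x"
  have y: "y \<in> carrier_vec n" using c x by (simp add: y_def)
  have "Q *\<^sub>v x = E *\<^sub>v (D *\<^sub>v y)"
    unfolding EF(3) y_def using c x
    by (simp add: assoc_mult_mat_vec[of _ n n _ n] Dc)
  then have "\<forall>a<n. [:-z0, 1:] ^ R dvd (D *\<^sub>v y) $ a"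
    using dv unimodular_dvd_iff[OF EF(1), of "D *\<^sub>v y"] y Dc by simp
  then have fy: "[:-z0, 1:] ^ R dvd f a * y $ a" if "a < n" for a
    using that Dv[OF y that] by metis
  have "\<exists>i<n. poly (y $ i) z0 \<noteq> 0"
  proof (rule ccontr)
    assume "\<not> ?thesis"
    then have "\<forall>i<n. [:-z0, 1:] dvd (F *\<^sub>v x) $ i" by (simp add: poly_eq_0_iff_dvd y_def)
    then have "\<forall>i<n. [:-z0, 1:] dvd x $ i" using unimodular_dvd_iff[OF EF(2) x] by blast
    then show False using i0 by (simp add: poly_eq_0_iff_dvd)
  qed
  then obtain i where i: "i < n" "poly (y $ i) z0 \<noteq> 0" by blast
  have "det Q = det E * (\<Prod>i<n. f i) * det F"
    unfolding EF(3) using c Dc by (simp add: det_mult[of _ n] Ddet)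
  then have "(\<Prod>i<n. f i) \<noteq> 0" using det by auto
  then have fi: "f i \<noteq> 0" using i(1) by simp
  then have ids: "i < length ds" by (simp add: f_def split: if_splits)
  have yi: "y $ i \<noteq> 0" using i(2) by auto
  have "f i * y $ i \<noteq> 0" using fi yi by simp
  moreover have "R \<le> order z0 (f i * y $ i)"
    using fy[OF i(1)] calculation order_divides by blast
  ultimately have Ro: "R \<le> order z0 (f i)" using order_mult[of "f i" "y $ i" z0] order_0I[OF i(2)] by simp
  have "lead_coeff (f i) = 1" using ds ids by (simp add: smith_form_def f_def)
  then have dec: "f i = (\<Prod>b | poly (f i) b = 0. [:-b, 1:] ^ order b (f i))"
    using complex_poly_decompose[of "f i"] by simp
  have "[:-z0, 1:] ^ order z0 (f i) \<in> elementary_divisors n Q"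
    unfolding elementary_divisors_def mem_Collect_eq
  proof (intro exI conjI bexI)
    show "smith_form n Q ds" by (rule ds)
    show "f i \<in> set ds" using ids by (simp add: f_def)
    show "finite {b. poly (f i) b = 0}" by (rule poly_roots_finite[OF fi])
    show "\<forall>b\<in>{b. poly (f i) b = 0}. 1 \<le> order b (f i)"
      using fi order_root[of "f i"] by (auto simp: Suc_le_eq)
    show "z0 \<in> {b. poly (f i) b = 0}" using Ro R order_root[of "f i" z0] by auto
    show "f i = (\<Prod>b | poly (f i) b = 0. [:-b, 1:] ^ order b (f i))" by (rule dec)
  qed simp
  then show ?thesis by (rule that[OF Ro])
qed

text \<open>If \<open>L^(r+1)\<close> divides the diagonal entry \<open>d_i\<close>, the column \<open>x\<close> of \<open>F\<^sup>-\<^sup>1\<close> with index \<open>i\<close> satisfies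
\<open>L^(r+1) dvd Q x\<close>. The jets of \<open>x, L x, ..., L^r x\<close> then lie in the kernel. They are independent, because a
combination is the jet of \<open>p x\<close> with \<open>p\<close> of degree at most \<open>r\<close>, and \<open>L^(r+1) dvd p x\<close> only if \<open>L^(r+1) dvd p\<close>.\<close>

lemma indep_kernel_family_of_elementary_divisor:
  assumes Q: "Q \<in> carrier_mat n n" and j: "r + 1 \<le> j"
    and el: "[:-z0, 1:] ^ j \<in> elementary_divisors n Q"
  obtains \<xi> where "indep_kernel_family (T_mat n r Q z0) (r + 1) \<xi>"
proof -
  define L where "L = [:-z0, 1:]"
  define R where "R = r + 1"
  have Ldvd: "L ^ R dvd p \<longleftrightarrow> (\<forall>m<R. taylor_coeff z0 p m = 0)" for p
    unfolding L_def by (rule linear_power_dvd_iff)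
  have Lt: "taylor_coeff z0 (L ^ j) m = (if m = j then 1 else 0)" for j m
    unfolding L_def by (rule taylor_coeff_linear_power)
  have Tc: "T_mat n r Q z0 \<in> carrier_mat (R * n) (R * n)" unfolding R_def by (rule T_mat_carrier)
  have Tker: "T_mat n r Q z0 *\<^sub>v jet z0 n R w = 0\<^sub>v (R * n) \<longleftrightarrow>
      (\<forall>a<n. L ^ R dvd (Q *\<^sub>v w) $ a)" if "w \<in> carrier_vec n" for w
    unfolding L_def R_def by (rule T_mat_jet_eq_0_iff[OF Q that])
  obtain a c ds S d where d: "d \<in> set ds" "smith_form n Q ds" "finite S" "a \<in> S"
    "d = (\<Prod>b\<in>S. [:-b, 1:] ^ c b)" "L ^ j = [:-a, 1:] ^ c a"
    using el unfolding elementary_divisors_def L_def by blast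
  have "L ^ j dvd d" unfolding d(5,6) by (rule dvd_prodI[OF d(3,4)])
  then have Ld: "L ^ R dvd d" using j unfolding R_def by (meson dvd_trans le_imp_power_dvd)
  define f where "f i = (if i < length ds then ds ! i else 0)" for i
  obtain E F where EF0: "unimodular n E" "unimodular n F" "Q = E * mat_diag n f * F"
    using d(2) unfolding smith_form_def f_def by blast
  define D where "D = mat_diag n f"
  note EF = EF0[folded D_def]
  have Dc: "D \<in> carrier_mat n n" by (simp add: D_def)
  have Dv: "(D *\<^sub>v w) $ i = f i * w $ i" if "w \<in> carrier_vec n" "i < n" for w i
    unfolding D_def by (rule mat_diag_mult_vec[OF that])
  obtain i where i: "i < length ds" "ds ! i = d" using d(1) by (auto simp: in_set_conv_nth)
  have "i < n" "f i = d" using i d(2) by (auto simp: smith_form_def f_def)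
  note i = this
  obtain F' where F': "unimodular n F'" "F * F' = 1\<^sub>m n" by (rule unimodular_inverse[OF EF(2)])
  note cr = EF(1,2)[THEN unimodular_carrier] F'(1)[THEN unimodular_carrier]
  define u where "u p = vec n (\<lambda>b. if b = i then p else 0)" for p :: "complex poly"
  have u: "u p \<in> carrier_vec n" for p by (simp add: u_def)
  define x where "x p = F' *\<^sub>v u p" for p
  have x: "x p \<in> carrier_vec n" for p using cr u by (simp add: x_def)
  have xi: "x p $ b = F' $$ (b,i) * p" if "b < n" for p b
  proof -
    have "x p $ b = (\<Sum>l<n. F' $$ (b,l) * u p $ l)"
      using cr that by (simp add: x_def u_def scalar_prod_def lessThan_atLeast0)
    also have "\<dots> = (\<Sum>l<n. if l = i then F' $$ (b,l) * p else 0)"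
      by (rule sum.cong) (auto simp: u_def)
    finally show ?thesis using i by simp
  qed
  have "L ^ R dvd (Q *\<^sub>v x p) $ b" if b: "b < n" for p b
  proof -
    have "F *\<^sub>v x p = u p"
      unfolding x_def using cr u F'(2) assoc_mult_mat_vec[of F n n F' n "u p"] by simp
    then have "Q *\<^sub>v x p = E *\<^sub>v (D *\<^sub>v u p)"
      unfolding EF(3) using cr x[of p] u[of p]
      by (simp add: assoc_mult_mat_vec[of _ n n _ n] Dc)
    moreover have "\<forall>b<n. L ^ R dvd (D *\<^sub>v u p) $ b"
      using Ld i by (simp add: Dv[OF u]) (simp add: u_def)
    then have "\<forall>b<n. L ^ R dvd (E *\<^sub>v (D *\<^sub>v u p)) $ b"
      using unimodular_dvd_iff[OF EF(1), of "D *\<^sub>v u p"] mult_mat_vec_carrier[OF Dc u] by blast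
    ultimately show ?thesis using b by simp
  qed
  then have ker: "T_mat n r Q z0 *\<^sub>v jet z0 n R (x p) = 0\<^sub>v (R * n)" for p
    using Tker[OF x] by simp
  have "indep_kernel_family (T_mat n r Q z0) R (\<lambda>l. jet z0 n R (x (L ^ l)))"
    unfolding indep_kernel_family_def carrier_matD[OF Tc]
  proof (intro conjI allI impI)
    fix c l assume c: "\<forall>k<R * n. (\<Sum>l<R. c l * jet z0 n R (x (L ^ l)) $ k) = 0" and l: "l < R"
    define p where "p = (\<Sum>l<R. Polynomial.smult (c l) (L ^ l))"
    have "taylor_coeff z0 (x p $ b) m = 0" if b: "b < n" and m: "m < R" for b m
    proof -
      have "x p $ b = (\<Sum>l<R. Polynomial.smult (c l) (x (L ^ l) $ b))"
        unfolding xi[OF b] p_def by (simp add: sum_distrib_left)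
      then have "taylor_coeff z0 (x p $ b) m = (\<Sum>l<R. c l * jet z0 n R (x (L ^ l)) $ (m * n + b))"
        using jet_index[OF m b] by (simp add: taylor_coeff_sum taylor_coeff_smult)
      then show ?thesis using c block_index_less[OF m b] by simp
    qed
    then have "\<forall>b<n. L ^ R dvd (F' *\<^sub>v u p) $ b" by (simp add: Ldvd x_def)
    then have "\<forall>b<n. L ^ R dvd u p $ b" using unimodular_dvd_iff[OF F'(1) u] by blast
    then have "L ^ R dvd p" using i by (auto simp: u_def)
    then have "taylor_coeff z0 p l = 0" using l by (simp add: Ldvd)
    moreover have "taylor_coeff z0 p l = (\<Sum>l'<R. if l' = l then c l' else 0)"
      unfolding p_def taylor_coeff_sum
      by (rule sum.cong) (auto simp: taylor_coeff_smult Lt)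
    ultimately show "c l = 0" using l by (simp add: sum.delta)
  qed (use ker in auto)
  then show ?thesis unfolding R_def by (rule that)
qed

text \<open>Suppose \<open>det Q \<noteq> 0\<close>, let \<open>e_i\<close> be the order of \<open>d_i\<close> at \<open>z0\<close>, and let \<open>R = r + 1\<close>. In Smith coordinates entry \<open>i\<close> of a kernel vector is
divisible by \<open>L^(R - e_i)\<close>, so at most \<open>e_i\<close> of its first \<open>R\<close> Taylor coefficients are free. If the sum of the
\<open>e_i\<close>, which is the order of \<open>det Q\<close> at \<open>z0\<close>, were below \<open>R\<close>, then \<open>R\<close> kernel vectors would be dependent.\<close>

lemma linear_power_dvd_det_of_indep_kernel_family:
  assumes Q: "Q \<in> carrier_mat n n" and \<xi>: "indep_kernel_family (T_mat n r Q z0) (r + 1) \<xi>"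
  shows "[:-z0, 1:] ^ (r + 1) dvd det Q"
proof (cases "det Q = 0")
  case det: False
  define L where "L = [:-z0, 1:]"
  define R where "R = r + 1"
  have Ldvd: "L ^ R dvd p \<longleftrightarrow> (\<forall>m<R. taylor_coeff z0 p m = 0)" for p
    unfolding L_def by (rule linear_power_dvd_iff)
  have Lt: "taylor_coeff z0 (L ^ j) m = (if m = j then 1 else 0)" for j m
    unfolding L_def by (rule taylor_coeff_linear_power)
  have Tc: "T_mat n r Q z0 \<in> carrier_mat (R * n) (R * n)" unfolding R_def by (rule T_mat_carrier)
  have Tker: "T_mat n r Q z0 *\<^sub>v jet z0 n R w = 0\<^sub>v (R * n) \<longleftrightarrow>
      (\<forall>a<n. L ^ R dvd (Q *\<^sub>v w) $ a)" if "w \<in> carrier_vec n" for w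
    unfolding L_def R_def by (rule T_mat_jet_eq_0_iff[OF Q that])
  obtain ds where ds: "smith_form n Q ds" by (rule smith_form_exists[OF Q])
  define f where "f i = (if i < length ds then ds ! i else 0)" for i
  obtain E F where EF0: "unimodular n E" "unimodular n F" "Q = E * mat_diag n f * F"
    using ds unfolding smith_form_def f_def by blast
  define D where "D = mat_diag n f"
  note EF = EF0[folded D_def]
  have Dc: "D \<in> carrier_mat n n" by (simp add: D_def)
  have Dv: "(D *\<^sub>v w) $ i = f i * w $ i" if "w \<in> carrier_vec n" "i < n" for w i
    unfolding D_def by (rule mat_diag_mult_vec[OF that])
  have Ddet: "det D = (\<Prod>i<n. f i)" unfolding D_def by (rule det_mat_diag)
  note cr = EF(1,2)[THEN unimodular_carrier]
  obtain cE where cE: "det E = [:cE:]" "cE \<noteq> 0" using EF(1) by (auto simp: unimodular_def)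
  obtain cF where cF: "det F = [:cF:]" "cF \<noteq> 0" using EF(2) by (auto simp: unimodular_def)
  have detQ: "det Q = [:cE:] * (\<Prod>i<n. f i) * [:cF:]"
    unfolding EF(3) using cr Dc by (simp add: det_mult[of _ n] Ddet cE cF)
  then have pf: "(\<Prod>i<n. f i) \<noteq> 0" using det by auto
  then have f0: "f i \<noteq> 0" if "i < n" for i using that by simp
  have ordprod: "order z0 (\<Prod>i<m. f i) = (\<Sum>i<m. order z0 (f i))" if "m \<le> n" for m
    using that
  proof (induction m)
    case (Suc m)
    have "(\<Prod>i<Suc m. f i) \<noteq> 0" using f0 Suc.prems by simp
    then show ?case using Suc order_mult[of "\<Prod>i<m. f i" "f m" z0] by simp
  qed simp
  define e where "e i = order z0 (f i)" for i
  show ?thesis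
  proof (rule ccontr)
    assume "\<not> ?thesis"
    then have nd: "\<not> L ^ R dvd det Q" by (simp only: L_def R_def not_False_eq_True)
    have "L ^ (\<Sum>i<n. e i) dvd (\<Prod>i<n. f i)"
      unfolding L_def order_divides using ordprod[of n] by (simp add: e_def)
    then have "L ^ (\<Sum>i<n. e i) dvd det Q" unfolding detQ by (metis dvd_mult dvd_mult2)
    then have small: "(\<Sum>i<n. e i) < R"
      using nd by (meson dvd_trans le_imp_power_dvd not_less)
    define X where "X l = taylor_vec z0 n R (\<xi> l)" for l
    have X: "X l \<in> carrier_vec n" for l by (simp add: X_def)
    note \<xi>' = \<xi>[unfolded indep_kernel_family_def carrier_matD[OF Tc], folded R_def]
    have jX: "jet z0 n R (X l) = \<xi> l" if "l < R" for l
      unfolding X_def by (rule jet_taylor_vec) (use \<xi>' that in blast)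
    define y where "y l = F *\<^sub>v X l" for l
    have y: "y l \<in> carrier_vec n" for l using cr X by (simp add: y_def)
    have dy: "L ^ (R - e i) dvd y l $ i" if l: "l < R" and i: "i < n" for l i
    proof -
      have "T_mat n r Q z0 *\<^sub>v jet z0 n R (X l) = 0\<^sub>v (R * n)"
        unfolding jX[OF l] using \<xi>' l by blast
      then have "\<forall>a<n. L ^ R dvd (Q *\<^sub>v X l) $ a"
        by (rule iffD1[OF Tker[OF X]])
      moreover have "Q *\<^sub>v X l = E *\<^sub>v (D *\<^sub>v y l)"
        unfolding EF(3) y_def using cr X[of l]
        by (simp add: assoc_mult_mat_vec[of _ n n _ n] Dc)
      ultimately have "\<forall>a<n. L ^ R dvd (D *\<^sub>v y l) $ a"
        using unimodular_dvd_iff[OF EF(1), of "D *\<^sub>v y l"] Dc y by simp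
      then have dv: "L ^ R dvd f i * y l $ i" using Dv[OF y i] i by metis
      show ?thesis
      proof (cases "y l $ i = 0")
        case False
        then have ne: "f i * y l $ i \<noteq> 0" using f0[OF i] by simp
        then have "R \<le> order z0 (f i * y l $ i)" using dv unfolding L_def order_divides by blast
        then have "R - e i \<le> order z0 (y l $ i)" unfolding order_mult[OF ne] e_def by simp
        then show ?thesis unfolding L_def order_divides by blast
      qed simp
    qed
    \<comment> \<open>the possibly nonzero Taylor coefficients of order below \<open>R\<close>, as pairs of entry and order\<close>
    define I where "I = (SIGMA i:{..<n}. {R - e i..<R})"
    have finI: "finite I" by (simp add: I_def)
    have "card I = (\<Sum>i<n. card {R - e i..<R})" unfolding I_def by (rule card_SigmaI) auto
    also have "\<dots> \<le> (\<Sum>i<n. e i)" by (rule sum_mono) simp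
    finally have "card I < R" using small by simp
    then obtain c where c: "\<forall>im\<in>I. (\<Sum>l<R. taylor_coeff z0 (y l $ fst im) (snd im) * c l) = 0"
      "\<exists>l<R. c l \<noteq> 0"
      by (rule homogeneous_system_nontrivial[OF finI, where m = "\<lambda>im l. taylor_coeff z0 (y l $ fst im) (snd im)"]) (rule that)
    define Z where "Z = vec n (\<lambda>a. \<Sum>l<R. Polynomial.smult (c l) (X l $ a))"
    have Z: "Z \<in> carrier_vec n" by (simp add: Z_def)
    have FZ: "(F *\<^sub>v Z) $ i = (\<Sum>l<R. Polynomial.smult (c l) (y l $ i))" if i: "i < n" for i
    proof -
      have "(F *\<^sub>v Z) $ i = (\<Sum>a<n. F $$ (i,a) * (\<Sum>l<R. Polynomial.smult (c l) (X l $ a)))"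
        using cr i by (simp add: Z_def scalar_prod_def lessThan_atLeast0)
      also have "\<dots> = (\<Sum>l<R. Polynomial.smult (c l) (\<Sum>a<n. F $$ (i,a) * X l $ a))"
        unfolding sum_distrib_left smult_sum_right mult_smult_right by (rule sum.swap)
      also have "\<dots> = (\<Sum>l<R. Polynomial.smult (c l) (y l $ i))"
        using cr i carrier_vecD[OF X] by (simp add: y_def scalar_prod_def lessThan_atLeast0)
      finally show ?thesis .
    qed
    have "taylor_coeff z0 ((F *\<^sub>v Z) $ i) m = 0" if i: "i < n" and m: "m < R" for i m
    proof -
      have t: "taylor_coeff z0 ((F *\<^sub>v Z) $ i) m = (\<Sum>l<R. taylor_coeff z0 (y l $ i) m * c l)"
        unfolding FZ[OF i] taylor_coeff_sum taylor_coeff_smult by (simp add: mult.commute)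
      show ?thesis
      proof (cases "m < R - e i")
        case True
        then have "taylor_coeff z0 (y l $ i) m = 0" if "l < R" for l
          using dy[OF that i] True unfolding L_def linear_power_dvd_iff by blast
        then show ?thesis unfolding t by (intro sum.neutral) simp
      next
        case False
        then have "(i, m) \<in> I" using i m by (simp add: I_def)
        then show ?thesis unfolding t using c(1) by fastforce
      qed
    qed
    then have "\<forall>i<n. L ^ R dvd (F *\<^sub>v Z) $ i" by (simp add: Ldvd)
    then have LZ: "\<forall>i<n. L ^ R dvd Z $ i" using unimodular_dvd_iff[OF EF(2) Z] by blast
    have "(\<Sum>l<R. c l * \<xi> l $ k) = 0" if k: "k < R * n" for k
    proof -
      obtain m a where ma: "m < R" "a < n" "k = m * n + a" by (rule block_index_cases[OF k])
      have "(\<Sum>l<R. c l * \<xi> l $ k) = (\<Sum>l<R. c l * taylor_coeff z0 (X l $ a) m)"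
      proof (rule sum.cong[OF refl])
        fix l assume "l \<in> {..<R}"
        then have "\<xi> l $ k = jet z0 n R (X l) $ (m * n + a)" using jX ma by simp
        then show "c l * \<xi> l $ k = c l * taylor_coeff z0 (X l $ a) m"
          unfolding jet_index[OF ma(1,2)] by simp
      qed
      also have "\<dots> = taylor_coeff z0 (Z $ a) m"
        using ma by (simp add: Z_def taylor_coeff_sum taylor_coeff_smult)
      also have "\<dots> = 0" using LZ ma by (simp add: Ldvd)
      finally show ?thesis .
    qed
    then have "\<forall>l<R. c l = 0" using \<xi>' by blast
    then show False using c(2) by blast
  qed
qed simp

section \<open>Lengthening root vectors of regular matrix polynomials\<close>

text \<open>The leading coefficient may vanish, as it may for perturbed polynomials.\<close>

definition has_grade :: "nat \<Rightarrow> nat \<Rightarrow> complex poly mat \<Rightarrow> bool" where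
  "has_grade n k Q \<longleftrightarrow> Q \<in> carrier_mat n n \<and> (\<forall>a<n. \<forall>b<n. degree (Q $$ (a,b)) \<le> k)"

definition coeffs_near :: "nat \<Rightarrow> real \<Rightarrow> complex poly mat \<Rightarrow> complex poly mat \<Rightarrow> bool" where
  "coeffs_near n \<epsilon> Q Q' \<longleftrightarrow>
     (\<forall>a<n. \<forall>b<n. \<forall>i. cmod (coeff (Q' $$ (a,b)) i - coeff (Q $$ (a,b)) i) < \<epsilon>)"

text \<open>In other terms, the Taylor coefficients of \<open>x\<close> at \<open>z0\<close> of order below \<open>R\<close> form a Jordan chain of length \<open>R\<close>.\<close>

definition root_vector :: "complex \<Rightarrow> nat \<Rightarrow> complex poly mat \<Rightarrow> complex poly vec \<Rightarrow> bool" where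
  "root_vector z0 R Q x \<longleftrightarrow> x \<in> carrier_vec (dim_col Q) \<and> (\<exists>p<dim_col Q. poly (x $ p) z0 \<noteq> 0) \<and>
     (\<forall>a<dim_row Q. [:-z0, 1:] ^ R dvd (Q *\<^sub>v x) $ a)"

lemma coeffs_near_trans:
  assumes "coeffs_near n \<epsilon> Q Q'" "coeffs_near n \<delta> Q' Q''"
  shows "coeffs_near n (\<epsilon> + \<delta>) Q Q''"
  unfolding coeffs_near_def
proof (intro allI impI)
  fix a b i assume ab: "a < n" "b < n"
  have "cmod (coeff (Q'' $$ (a,b)) i - coeff (Q $$ (a,b)) i) \<le>
      cmod (coeff (Q' $$ (a,b)) i - coeff (Q $$ (a,b)) i) + cmod (coeff (Q'' $$ (a,b)) i - coeff (Q' $$ (a,b)) i)"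
    using norm_triangle_ineq[of "coeff (Q' $$ (a,b)) i - coeff (Q $$ (a,b)) i"
        "coeff (Q'' $$ (a,b)) i - coeff (Q' $$ (a,b)) i"] by simp
  also have "\<dots> < \<epsilon> + \<delta>" using assms ab unfolding coeffs_near_def by (intro add_strict_mono) blast+
  finally show "cmod (coeff (Q'' $$ (a,b)) i - coeff (Q $$ (a,b)) i) < \<epsilon> + \<delta>" .
qed

lemma replace_col_carrier: "A \<in> carrier_mat n n \<Longrightarrow> replace_col A v p \<in> carrier_mat n n"
  by (simp add: replace_col_def)

lemma replace_col_index:
  "A \<in> carrier_mat n n \<Longrightarrow> i < n \<Longrightarrow> j < n \<Longrightarrow> replace_col A v p $$ (i,j) = (if j = p then v $ i else A $$ (i,j))"
  by (simp add: replace_col_def)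

lemma det_replace_col_smult:
  assumes A: "(A :: 'a::comm_ring_1 mat) \<in> carrier_mat n n" and p: "p < n" and v: "v \<in> carrier_vec n"
  shows "det (replace_col A (c \<cdot>\<^sub>v v) p) = c * det (replace_col A v p)"
proof -
  have cof: "cofactor (replace_col A (c \<cdot>\<^sub>v v) p) i p = cofactor (replace_col A v p) i p" if "i < n" for i
  proof -
    have "mat_delete (replace_col A (c \<cdot>\<^sub>v v) p) i p = mat_delete (replace_col A v p) i p"
      using A by (intro eq_matI) (auto simp: mat_delete_def replace_col_def)
    then show ?thesis by (simp add: cofactor_def)
  qed
  show ?thesis
    unfolding laplace_expansion_column[OF replace_col_carrier[OF A] p] sum_distrib_left
    by (intro sum.cong refl) (use A p v cof in \<open>simp add: replace_col_index mult.assoc\<close>)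
qed

lemma mult_mat_vec_index:
  "A \<in> carrier_mat n m \<Longrightarrow> v \<in> carrier_vec m \<Longrightarrow> i < n \<Longrightarrow> (A *\<^sub>v v) $ i = (\<Sum>j<m. A $$ (i,j) * v $ j)"
  by (simp add: scalar_prod_def lessThan_atLeast0)

lemma comm_ring_hom_poly: "comm_ring_hom (\<lambda>p. poly p (z :: complex))"
  by unfold_locales simp_all

lemma poly_det: "poly (det A) z = det (map_mat (\<lambda>p. poly p (z :: complex)) A)"
  using comm_ring_hom.hom_det[OF comm_ring_hom_poly, of z A] by simp

text \<open>Write \<open>Q x = L^m q\<close> and let \<open>p\<close> be an index with \<open>x_p(z0) \<noteq> 0\<close>. Cramer's rule gives \<open>L^m det N = x_p det Q\<close>,
where \<open>N\<close> is \<open>Q\<close> with column \<open>p\<close> replaced by \<open>q\<close>. Hence \<open>L dvd det N\<close>, and \<open>N(z0) c = 0\<close> for some \<open>c \<noteq> 0\<close>.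

If \<open>c_p \<noteq> 0\<close>, then \<open>c_p x\<close> plus \<open>L^m\<close> times the other entries of \<open>c\<close> is mapped to \<open>L^m N c\<close> by \<open>Q\<close> itself. If
\<open>c_p = 0\<close>, then \<open>Q(z0) c = 0\<close>, say \<open>Q c = L w\<close>. Adding a small multiple \<open>t w\<close> to column \<open>p\<close> keeps the determinant,
and the new matrix maps \<open>L x - t x_p c\<close> to \<open>L Q x\<close>; this vector does not vanish at \<open>z0\<close>.\<close>

lemma regular_root_vector_extend:
  assumes grade: "has_grade n k Q" and det: "det Q \<noteq> 0" and dv: "[:-z0, 1:] ^ Suc m dvd det Q"
    and x: "root_vector z0 m Q x" and eps: "0 < \<epsilon>"
  shows "\<exists>Q' x'. has_grade n k Q' \<and> coeffs_near n \<epsilon> Q Q' \<and> det Q' = det Q \<and> root_vector z0 (Suc m) Q' x'"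
proof -
  define L where "L = [:-z0, 1:]"
  have L0: "L \<noteq> 0" by (simp add: L_def)
  have Lz: "poly L z0 = 0" by (simp add: L_def)
  have Ldvd: "L dvd q \<longleftrightarrow> poly q z0 = 0" for q unfolding L_def by (rule poly_eq_0_iff_dvd[symmetric])
  have Q: "Q \<in> carrier_mat n n" and deg: "\<And>a b. a < n \<Longrightarrow> b < n \<Longrightarrow> degree (Q $$ (a,b)) \<le> k"
    using grade by (auto simp: has_grade_def)
  obtain p where p: "p < n" "poly (x $ p) z0 \<noteq> 0" and xc: "x \<in> carrier_vec n"
    and Qx: "\<forall>a<n. L ^ m dvd (Q *\<^sub>v x) $ a"
    using x Q by (auto simp: root_vector_def L_def)
  have "\<forall>a. \<exists>q. a < n \<longrightarrow> (Q *\<^sub>v x) $ a = L ^ m * q" using Qx by (auto elim: dvdE)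
  then obtain q0 where q0: "\<And>a. a < n \<Longrightarrow> (Q *\<^sub>v x) $ a = L ^ m * q0 a" by metis
  define q where "q = vec n q0"
  have q: "q \<in> carrier_vec n" by (simp add: q_def)
  have Qxq: "Q *\<^sub>v x = L ^ m \<cdot>\<^sub>v q" using Q q0 by (intro eq_vecI) (auto simp: q_def)
  define N where "N = replace_col Q q p"
  have N: "N \<in> carrier_mat n n" unfolding N_def by (rule replace_col_carrier[OF Q])
  have "L ^ m * det N = x $ p * det Q"
    using cramer_lemma_mat[OF Q xc p(1)] det_replace_col_smult[OF Q p(1) q, of "L ^ m"] unfolding Qxq N_def by simp
  moreover have "L ^ m * L dvd x $ p * det Q"
    using dv unfolding L_def by (simp add: mult.commute dvd_mult)
  ultimately have "L ^ m * L dvd L ^ m * det N" by simp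
  then have "L dvd det N" using L0 by simp
  then have detN: "det (map_mat (\<lambda>p. poly p z0) N) = 0" unfolding Ldvd poly_det .
  have Nz: "map_mat (\<lambda>p. poly p z0) N \<in> carrier_mat n n" using N by simp
  obtain c where c: "c \<in> carrier_vec n" "c \<noteq> 0\<^sub>v n" "map_mat (\<lambda>p. poly p z0) N *\<^sub>v c = 0\<^sub>v n"
    using detN det_0_iff_vec_prod_zero_field[OF Nz] by blast
  have Nc: "(\<Sum>b<n. poly (N $$ (i,b)) z0 * c $ b) = 0" if "i < n" for i
    using mult_mat_vec_index[OF Nz c(1) that] c(3) that N by simp
  have split: "(\<Sum>b<n. g b) = g p + (\<Sum>b\<in>{..<n} - {p}. g b)" for g :: "nat \<Rightarrow> complex poly"
    using p(1) by (simp add: sum.remove)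
  have Np: "N $$ (i,b) = (if b = p then q $ i else Q $$ (i,b))" if "i < n" "b < n" for i b
    unfolding N_def by (rule replace_col_index[OF Q that])
  show ?thesis
  proof (cases "c $ p = 0")
    case False
    define x' where "x' = vec n (\<lambda>b. if b = p then [:c $ p:] * x $ p else [:c $ p:] * x $ b + L ^ m * [:c $ b:])"
    have x'c: "x' \<in> carrier_vec n" by (simp add: x'_def)
    have "L ^ Suc m dvd (Q *\<^sub>v x') $ i" if i: "i < n" for i
    proof -
      have "(Q *\<^sub>v x') $ i = (\<Sum>b<n. Q $$ (i,b) * x' $ b)" by (rule mult_mat_vec_index[OF Q x'c i])
      also have "\<dots> = (\<Sum>b<n. [:c $ p:] * (Q $$ (i,b) * x $ b) + (if b = p then 0 else L ^ m * (Q $$ (i,b) * [:c $ b:])))"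
        by (rule sum.cong) (auto simp: x'_def algebra_simps)
      also have "\<dots> = [:c $ p:] * (Q *\<^sub>v x) $ i + (\<Sum>b<n. if b = p then 0 else L ^ m * (Q $$ (i,b) * [:c $ b:]))"
        unfolding mult_mat_vec_index[OF Q xc i] sum.distrib sum_distrib_left ..
      also have "(\<Sum>b<n. if b = p then 0 else L ^ m * (Q $$ (i,b) * [:c $ b:])) =
          L ^ m * (\<Sum>b\<in>{..<n} - {p}. N $$ (i,b) * [:c $ b:])"
        unfolding split sum_distrib_left using i Np by simp
      also have "[:c $ p:] * (Q *\<^sub>v x) $ i = L ^ m * (N $$ (i,p) * [:c $ p:])"
        unfolding Qxq using i q Np[OF i p(1)] by (simp add: algebra_simps)
      finally have "(Q *\<^sub>v x') $ i = L ^ m * (\<Sum>b<n. N $$ (i,b) * [:c $ b:])"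
        unfolding split by (simp only: distrib_left)
      moreover have "L dvd (\<Sum>b<n. N $$ (i,b) * [:c $ b:])"
        unfolding Ldvd using Nc[OF i] by (simp add: poly_sum mult.commute)
      ultimately show ?thesis by (simp add: mult.commute mult_dvd_mono)
    qed
    moreover have "poly (x' $ p) z0 \<noteq> 0" using False p by (simp add: x'_def)
    ultimately have "root_vector z0 (Suc m) Q x'"
      using x'c p(1) Q unfolding root_vector_def L_def by auto
    moreover have "coeffs_near n \<epsilon> Q Q" using eps by (simp add: coeffs_near_def)
    ultimately show ?thesis using grade by blast
  next
    case cp: True
    define v where "v = vec n (\<lambda>b. [:c $ b:])"
    have v: "v \<in> carrier_vec n" by (simp add: v_def)
    have "L dvd (Q *\<^sub>v v) $ i" if i: "i < n" for i
    proof -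
      have "poly ((Q *\<^sub>v v) $ i) z0 = (\<Sum>b<n. poly (Q $$ (i,b)) z0 * c $ b)"
        unfolding mult_mat_vec_index[OF Q v i] by (simp add: poly_sum v_def mult.commute)
      also have "\<dots> = (\<Sum>b<n. poly (N $$ (i,b)) z0 * c $ b)"
        by (rule sum.cong) (use Np[OF i] cp in auto)
      finally show ?thesis unfolding Ldvd Nc[OF i] .
    qed
    then have "\<forall>a. \<exists>w. a < n \<longrightarrow> (Q *\<^sub>v v) $ a = L * w" by (auto elim: dvdE)
    then obtain w where w: "\<And>a. a < n \<Longrightarrow> (Q *\<^sub>v v) $ a = L * w a" by metis
    have degw: "degree (w a) \<le> k" if a: "a < n" for a
    proof (cases "w a = 0")
      case False
      have "degree (w a) \<le> degree (L * w a)" using False L0 by (simp add: degree_mult_eq)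
      also have "\<dots> = degree (\<Sum>b<n. Q $$ (a,b) * v $ b)"
        unfolding w[OF a, symmetric] mult_mat_vec_index[OF Q v a] ..
      also have "\<dots> \<le> k"
        by (intro degree_sum_le order_trans[OF degree_mult_le]) (use deg a in \<open>auto simp: v_def\<close>)
      finally show ?thesis .
    qed simp
    define C where "C = (\<Sum>a<n. \<Sum>j\<le>k. cmod (coeff (w a) j)) + 1"
    have C: "cmod (coeff (w a) j) < C" if a: "a < n" for a j
    proof (cases "j \<le> k")
      case True
      have "cmod (coeff (w a) j) \<le> (\<Sum>j\<le>k. cmod (coeff (w a) j))"
        using True by (intro member_le_sum) auto
      also have "\<dots> \<le> (\<Sum>a<n. \<Sum>j\<le>k. cmod (coeff (w a) j))"
        using a by (intro member_le_sum[of a]) (auto intro: sum_nonneg)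
      finally show ?thesis by (simp add: C_def)
    next
      case False
      then have "coeff (w a) j = 0" using degw[OF a] by (intro coeff_eq_0) simp
      moreover have "0 < C" unfolding C_def by (intro add_nonneg_pos sum_nonneg) auto
      ultimately show ?thesis by simp
    qed
    have C0: "0 < C" using C[OF p(1), of 0] by (meson norm_ge_zero order_le_less_trans)
    define t where "t = complex_of_real (\<epsilon> / C)"
    have t0: "t \<noteq> 0" using eps C0 by (simp add: t_def)
    define Q' where "Q' = mat n n (\<lambda>(i,b). if b = p then Q $$ (i,p) + Polynomial.smult t (w i) else Q $$ (i,b))"
    have Q'c: "Q' \<in> carrier_mat n n" by (simp add: Q'_def)
    have Q'i: "Q' $$ (i,b) = Q $$ (i,b) + (if b = p then Polynomial.smult t (w i) else 0)" if "i < n" "b < n" for i b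
      using that by (simp add: Q'_def)
    have g: "has_grade n k Q'"
      unfolding has_grade_def
    proof (intro conjI allI impI Q'c)
      fix a b assume ab: "a < n" "b < n"
      have "degree (Polynomial.smult t (w a)) \<le> k" using degw[OF ab(1)] order_trans[OF degree_smult_le] by blast
      then show "degree (Q' $$ (a,b)) \<le> k"
        unfolding Q'i[OF ab] using deg[OF ab] by (intro degree_add_le) auto
    qed
    have near: "coeffs_near n \<epsilon> Q Q'"
      unfolding coeffs_near_def
    proof (intro allI impI)
      fix a b i assume ab: "a < n" "b < n"
      have "cmod t = \<epsilon> / C" using eps C0 unfolding t_def norm_of_real by simp
      moreover have "\<epsilon> / C * cmod (coeff (w a) i) < \<epsilon> / C * C"
        using C[OF ab(1), of i] eps C0 by (intro mult_strict_left_mono) auto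
      ultimately have "cmod t * cmod (coeff (w a) i) < \<epsilon> / C * C" by simp
      then show "cmod (coeff (Q' $$ (a,b)) i - coeff (Q $$ (a,b)) i) < \<epsilon>"
        unfolding Q'i[OF ab] using C0 eps by (simp add: norm_mult)
    qed
    \<comment> \<open>\<open>Q u = L q'\<close> for the new column \<open>q'\<close>, so Cramer's rule yields the determinant of the perturbed matrix\<close>
    define u where "u = vec n (\<lambda>b. if b = p then L else [:t * c $ b:])"
    have u: "u \<in> carrier_vec n" by (simp add: u_def)
    define q' where "q' = vec n (\<lambda>i. Q' $$ (i,p))"
    have q': "q' \<in> carrier_vec n" by (simp add: q'_def)
    have "Q *\<^sub>v u = L \<cdot>\<^sub>v q'"
    proof (rule eq_vecI)
      fix i assume "i < dim_vec (L \<cdot>\<^sub>v q')"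
      then have i: "i < n" by (simp add: q'_def)
      have "(Q *\<^sub>v u) $ i = (\<Sum>b<n. (if b = p then L * Q $$ (i,b) else 0) + [:t:] * (Q $$ (i,b) * v $ b))"
        unfolding mult_mat_vec_index[OF Q u i]
        by (rule sum.cong) (auto simp: u_def v_def cp mult.commute)
      also have "\<dots> = L * Q $$ (i,p) + [:t:] * (Q *\<^sub>v v) $ i"
        unfolding sum.distrib mult_mat_vec_index[OF Q v i] sum_distrib_left using p(1) by simp
      also have "\<dots> = (L \<cdot>\<^sub>v q') $ i"
        unfolding w[OF i] using i p(1) by (simp add: q'_def Q'i algebra_simps)
      finally show "(Q *\<^sub>v u) $ i = (L \<cdot>\<^sub>v q') $ i" .
    qed (use Q in \<open>simp add: q'_def\<close>)
    then have "L * det (replace_col Q q' p) = L * det Q"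
      using cramer_lemma_mat[OF Q u p(1)] det_replace_col_smult[OF Q p(1) q', of L] p(1) by (simp add: u_def)
    moreover have "replace_col Q q' p = Q'"
      using Q Q'c p(1) by (intro eq_matI) (auto simp: replace_col_def q'_def Q'i)
    ultimately have det': "det Q' = det Q" using L0 by simp
    define x' where "x' = vec n (\<lambda>b. L * x $ b - [:t * c $ b:] * x $ p)"
    have x'c: "x' \<in> carrier_vec n" by (simp add: x'_def)
    have "L ^ Suc m dvd (Q' *\<^sub>v x') $ i" if i: "i < n" for i
    proof -
      have "(Q' *\<^sub>v x') $ i = (\<Sum>b<n. Q' $$ (i,b) * x' $ b)" by (rule mult_mat_vec_index[OF Q'c x'c i])
      also have "\<dots> = (\<Sum>b<n. L * (Q $$ (i,b) * x $ b) + ([:- t:] * x $ p) * (Q $$ (i,b) * v $ b) +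
          (if b = p then [:t:] * w i * L * x $ p else 0))"
        by (rule sum.cong[OF refl]) (use i cp in \<open>auto simp: Q'i x'_def v_def algebra_simps\<close>)
      also have "\<dots> = L * (Q *\<^sub>v x) $ i + ([:- t:] * x $ p) * (Q *\<^sub>v v) $ i + [:t:] * w i * L * x $ p"
        unfolding sum.distrib mult_mat_vec_index[OF Q v i] mult_mat_vec_index[OF Q xc i] sum_distrib_left
        using p(1) by simp
      also have "\<dots> = L * (Q *\<^sub>v x) $ i"
        unfolding w[OF i] by (simp add: algebra_simps)
      finally show ?thesis using Qx i by (simp add: mult_dvd_mono)
    qed
    moreover have "\<exists>b<n. poly (x' $ b) z0 \<noteq> 0"
    proof -
      obtain b where b: "b < n" "c $ b \<noteq> 0" using c(1,2) by (metis carrier_vecD eq_vecI index_zero_vec)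
      then have "poly (x' $ b) z0 = - (t * c $ b) * poly (x $ p) z0" by (simp add: x'_def Lz)
      then show ?thesis using b t0 p(2) by (intro exI[of _ b]) simp
    qed
    ultimately have "root_vector z0 (Suc m) Q' x'"
      using x'c Q'c unfolding root_vector_def L_def by auto
    then show ?thesis using g near det' by blast
  qed
qed

text \<open>Start with a constant vector, a root vector of order \<open>0\<close>, and lengthen \<open>R\<close> times. The determinant stays the
same, so its divisibility is available in every step.\<close>

lemma regular_root_vector_approx:
  assumes grade: "has_grade n k Q" and det: "det Q \<noteq> 0" and dv: "[:-z0, 1:] ^ R dvd det Q"
    and n: "0 < n" and eps: "0 < \<epsilon>"
  shows "\<exists>Q' x'. has_grade n k Q' \<and> coeffs_near n \<epsilon> Q Q' \<and> det Q' \<noteq> 0 \<and> root_vector z0 R Q' x'"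
proof -
  have "\<exists>Q' x'. has_grade n k Q' \<and> coeffs_near n \<delta> Q Q' \<and> det Q' = det Q \<and> root_vector z0 m Q' x'"
    if "m \<le> R" "0 < \<delta>" for m \<delta>
    using that
  proof (induction m arbitrary: \<delta>)
    case 0
    have Qc: "Q \<in> carrier_mat n n" using grade by (simp add: has_grade_def)
    have "root_vector z0 0 Q (vec n (\<lambda>_. 1))"
      using n Qc unfolding root_vector_def by auto
    moreover have "coeffs_near n \<delta> Q Q" using 0 by (simp add: coeffs_near_def)
    ultimately show ?case using grade by blast
  next
    case (Suc m)
    then have "m \<le> R" "0 < \<delta> / 2" by auto
    then obtain Q1 x1 where 1: "has_grade n k Q1" "coeffs_near n (\<delta> / 2) Q Q1" "det Q1 = det Q"
      "root_vector z0 m Q1 x1" using Suc.IH by blast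
    have "[:-z0, 1:] ^ Suc m dvd det Q1"
      unfolding 1(3) using dv Suc.prems(1) by (meson dvd_trans le_imp_power_dvd)
    then obtain Q2 x2 where 2: "has_grade n k Q2" "coeffs_near n (\<delta> / 2) Q1 Q2" "det Q2 = det Q1"
      "root_vector z0 (Suc m) Q2 x2"
      using regular_root_vector_extend[OF 1(1) _ _ 1(4), of "\<delta> / 2"] det 1(3) Suc.prems(2) by auto
    have "coeffs_near n \<delta> Q Q2" using coeffs_near_trans[OF 1(2) 2(2)] by simp
    then show ?case using 2 1(3) by metis
  qed
  from this[OF order_refl eps] show ?thesis using det by metis
qed

section \<open>Regularizing singular pencils along a flag\<close>

lemma invertible_of_det:
  assumes A: "(A :: complex mat) \<in> carrier_mat n n" and d: "det A \<noteq> 0"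
  obtains A' where "A' \<in> carrier_mat n n" "A * A' = 1\<^sub>m n" "A' * A = 1\<^sub>m n"
proof -
  define A' where "A' = (1 / det A) \<cdot>\<^sub>m adj_mat A"
  have c: "A' \<in> carrier_mat n n" using adj_mat(1)[OF A] by (simp add: A'_def)
  have 1: "A' * A = 1\<^sub>m n"
    unfolding A'_def using adj_mat[OF A] d A
    by (subst mult_smult_assoc_mat[of _ n n _ n]) auto
  have 2: "A * A' = 1\<^sub>m n"
    unfolding A'_def using adj_mat[OF A] d A
    by (subst mult_smult_distrib[of _ n n _ n]) auto
  show ?thesis by (rule that[OF c 2 1])
qed

lemma invertible_with_first_column:
  assumes v: "(v :: complex vec) \<in> carrier_vec n" "v \<noteq> 0\<^sub>v n"
  obtains V V' where "V \<in> carrier_mat n n" "V' \<in> carrier_mat n n" "V * V' = 1\<^sub>m n" "V' * V = 1\<^sub>m n"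
    "\<And>i. i < n \<Longrightarrow> V $$ (i,0) = v $ i"
proof -
  obtain p where p: "p < n" "v $ p \<noteq> 0" using v by (metis carrier_vecD eq_vecI index_zero_vec)
  \<comment> \<open>column \<open>0\<close> holds \<open>v\<close>, and the unit vector it displaces goes to column \<open>p\<close>, where \<open>v\<close> has a nonzero entry\<close>
  define V where "V = mat n n (\<lambda>(i,j). if j = 0 then v $ i else if j = p then (if i = 0 then 1 else 0)
    else if i = j then 1 else (0::complex))"
  have V: "V \<in> carrier_mat n n" by (simp add: V_def)
  have "det V \<noteq> 0"
  proof
    assume "det V = 0"
    then obtain c where c: "c \<in> carrier_vec n" "c \<noteq> 0\<^sub>v n" "V *\<^sub>v c = 0\<^sub>v n"
      using det_0_iff_vec_prod_zero_field[OF V] by blast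
    have n0: "0 < n" using p by simp
    have row: "v $ i * c $ 0 + (\<Sum>j\<in>{..<n} - {0}. V $$ (i,j) * c $ j) = 0" if i: "i < n" for i
    proof -
      have "0 = (\<Sum>j<n. V $$ (i,j) * c $ j)" using mult_mat_vec_index[OF V c(1) i] c(3) i by simp
      also have "\<dots> = V $$ (i,0) * c $ 0 + (\<Sum>j\<in>{..<n} - {0}. V $$ (i,j) * c $ j)"
        using n0 by (simp add: sum.remove[of "{..<n}" 0])
      finally show ?thesis using i n0 by (simp add: V_def)
    qed
    have "(\<Sum>j\<in>{..<n} - {0}. V $$ (p,j) * c $ j) = 0"
      by (rule sum.neutral) (use p in \<open>auto simp: V_def\<close>)
    then have c0: "c $ 0 = 0" using row[OF p(1)] p(2) by simp
    have "c $ l = 0" if l: "l < n" "l \<noteq> 0" for l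
    proof -
      define i where "i = (if l = p then 0 else l)"
      have i: "i < n" using l n0 by (simp add: i_def)
      have "(\<Sum>j\<in>{..<n} - {0}. V $$ (i,j) * c $ j) = (\<Sum>j\<in>{..<n} - {0}. if j = l then c $ j else 0)"
        by (rule sum.cong[OF refl]) (use l i in \<open>auto simp: V_def i_def\<close>)
      also have "\<dots> = c $ l" using l by simp
      finally show ?thesis using row[OF i] c0 by simp
    qed
    then have "c $ l = 0\<^sub>v n $ l" if "l < n" for l using c0 that by (cases "l = 0") auto
    then have "c = 0\<^sub>v n" using c(1) by (intro eq_vecI) auto
    then show False using c(2) by blast
  qed
  then obtain V' where "V' \<in> carrier_mat n n" "V * V' = 1\<^sub>m n" "V' * V = 1\<^sub>m n"
    by (rule invertible_of_det[OF V]) (rule that)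
  then show ?thesis using that[OF V] by (simp add: V_def)
qed

definition pencil :: "nat \<Rightarrow> complex mat \<Rightarrow> complex mat \<Rightarrow> complex poly mat" where
  "pencil n B C = mat n n (\<lambda>(i,j). [:C $$ (i,j), B $$ (i,j):])"

lemma poly_det_pencil:
  assumes "B \<in> carrier_mat n n" "C \<in> carrier_mat n n"
  shows "poly (det (pencil n B C)) z = det (z \<cdot>\<^sub>m B + C)"
proof -
  have "map_mat (\<lambda>p. poly p z) (pencil n B C) = z \<cdot>\<^sub>m B + C"
    using assms by (intro eq_matI) (auto simp: pencil_def)
  then show ?thesis by (simp add: poly_det)
qed

lemma conj_linear:
  assumes "U \<in> carrier_mat n n" "V \<in> carrier_mat n n" "X \<in> carrier_mat n n" "(Y :: complex mat) \<in> carrier_mat n n"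
  shows "U * (z \<cdot>\<^sub>m X + Y) * V = z \<cdot>\<^sub>m (U * X * V) + U * Y * V"
proof -
  have "U * (z \<cdot>\<^sub>m X + Y) = z \<cdot>\<^sub>m (U * X) + U * Y"
    using assms by (simp add: mult_add_distrib_mat[of _ n n _ n] mult_smult_distrib[of _ n n _ n])
  then show ?thesis
    using assms by (simp add: add_mult_distrib_mat[of _ n n _ _ n] mult_smult_assoc_mat[of _ n n _ n])
qed

text \<open>One step of the flag. The determinant vanishes at \<open>0\<close>, so \<open>C v = 0\<close> for some \<open>v \<noteq> 0\<close>. With \<open>v\<close> as first basis
vector on the right and a vector \<open>w\<close> of which \<open>B v\<close> is a multiple as first basis vector on the left, the pencil
becomes block triangular with corner \<open>\<beta> z\<close>. The point is to choose \<open>w\<close> such that the remaining block again has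
a constant multiple of the top power as its determinant.\<close>

lemma pencil_deflate:
  assumes B: "B \<in> carrier_mat (Suc n) (Suc n)" and C: "C \<in> carrier_mat (Suc n) (Suc n)"
    and d: "det (pencil (Suc n) B C) = monom c (Suc n)"
  obtains U U' V V' B2 C2 \<beta> c2 where
    "U \<in> carrier_mat (Suc n) (Suc n)" "U' \<in> carrier_mat (Suc n) (Suc n)"
    "V \<in> carrier_mat (Suc n) (Suc n)" "V' \<in> carrier_mat (Suc n) (Suc n)"
    "U * U' = 1\<^sub>m (Suc n)" "U' * U = 1\<^sub>m (Suc n)" "V * V' = 1\<^sub>m (Suc n)" "V' * V = 1\<^sub>m (Suc n)"
    "B2 \<in> carrier_mat n n" "C2 \<in> carrier_mat n n"
    "(U * B * V) $$ (0,0) = \<beta>" "(U * C * V) $$ (0,0) = 0"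
    "\<And>i. i < n \<Longrightarrow> (U * B * V) $$ (Suc i,0) = 0" "\<And>i. i < n \<Longrightarrow> (U * C * V) $$ (Suc i,0) = 0"
    "\<And>i j. i < n \<Longrightarrow> j < n \<Longrightarrow> (U * B * V) $$ (Suc i, Suc j) = B2 $$ (i,j)"
    "\<And>i j. i < n \<Longrightarrow> j < n \<Longrightarrow> (U * C * V) $$ (Suc i, Suc j) = C2 $$ (i,j)"
    "det (pencil n B2 C2) = monom c2 n"
proof -
  let ?n = "Suc n"
  have "det (0 \<cdot>\<^sub>m B + C) = 0" using poly_det_pencil[OF B C, of 0] d by (simp add: poly_monom)
  moreover have "0 \<cdot>\<^sub>m B + C = C" using B C by (intro eq_matI) auto
  ultimately have "det C = 0" by simp
  then obtain v where v: "v \<in> carrier_vec ?n" "v \<noteq> 0\<^sub>v ?n" "C *\<^sub>v v = 0\<^sub>v ?n"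
    using det_0_iff_vec_prod_zero_field[OF C] by blast
  obtain V V' where V: "V \<in> carrier_mat ?n ?n" "V' \<in> carrier_mat ?n ?n" "V * V' = 1\<^sub>m ?n" "V' * V = 1\<^sub>m ?n"
    and Vv: "\<And>i. i < ?n \<Longrightarrow> V $$ (i,0) = v $ i" by (rule invertible_with_first_column[OF v(1,2)]) (rule that)
  have XV0: "(X * V) $$ (i,0) = (X *\<^sub>v v) $ i" if "X \<in> carrier_mat ?n ?n" "i < ?n" for X i
    using mult_mat_index[OF that(1) V(1) that(2), of 0] mult_mat_vec_index[OF that(1) v(1) that(2)] Vv by simp
  define W where "W = pencil ?n (B * V) (C * V)"
  have W: "W \<in> carrier_mat ?n ?n" by (simp add: W_def pencil_def)
  have BV: "B * V \<in> carrier_mat ?n ?n" "C * V \<in> carrier_mat ?n ?n" using B C V by auto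
  \<comment> \<open>in both cases the first column of the transformed pencil can be completed as wanted\<close>
  have "\<exists>w \<beta>. w \<in> carrier_vec ?n \<and> w \<noteq> 0\<^sub>v ?n \<and> B *\<^sub>v v = \<beta> \<cdot>\<^sub>v w \<and>
    (\<exists>c'. det (replace_col W (map_vec (\<lambda>a. [:a:]) w) 0) = monom c' n)"
  proof (cases "B *\<^sub>v v = 0\<^sub>v ?n")
    case False
    \<comment> \<open>for \<open>w = B v\<close> the first column of the pencil is \<open>z w\<close>, so one factor \<open>z\<close> of the determinant comes from it\<close>
    have "W = replace_col W ([:0,1:] \<cdot>\<^sub>v map_vec (\<lambda>a. [:a:]) (B *\<^sub>v v)) 0"
    proof (rule eq_matI)
      fix i j assume "i < dim_row (replace_col W ([:0,1:] \<cdot>\<^sub>v map_vec (\<lambda>a. [:a:]) (B *\<^sub>v v)) 0)"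
        "j < dim_col (replace_col W ([:0,1:] \<cdot>\<^sub>v map_vec (\<lambda>a. [:a:]) (B *\<^sub>v v)) 0)"
      then have ij: "i < ?n" "j < ?n" using W by (auto simp: replace_col_def)
      have "(C *\<^sub>v v) $ i = 0" using v(3) ij by simp
      then have "W $$ (i,0) = [:0, (B *\<^sub>v v) $ i:]"
        using XV0[OF B ij(1)] XV0[OF C ij(1)] ij BV by (simp add: W_def pencil_def del: index_mult_mat index_mult_mat_vec)
      then show "W $$ (i,j) = replace_col W ([:0,1:] \<cdot>\<^sub>v map_vec (\<lambda>a. [:a:]) (B *\<^sub>v v)) 0 $$ (i,j)"
        using ij B by (simp add: replace_col_index[OF W] del: index_mult_mat_vec)
    qed (use W in \<open>auto simp: replace_col_def\<close>)
    then have "det W = [:0,1:] * det (replace_col W (map_vec (\<lambda>a. [:a:]) (B *\<^sub>v v)) 0)"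
      using det_replace_col_smult[OF W, of 0 "map_vec (\<lambda>a. [:a:]) (B *\<^sub>v v)" "[:0,1:]"] B
      by (metis map_carrier_vec mult_mat_vec_carrier v(1) zero_less_Suc)
    moreover have "det W = monom (c * det V) ?n"
    proof (rule poly_eq_poly_eq_iff[THEN iffD1], rule ext)
      fix z
      have "z \<cdot>\<^sub>m (B * V) + C * V = (z \<cdot>\<^sub>m B + C) * V"
        using B C V by (simp add: add_mult_distrib_mat[of _ ?n ?n _ _ ?n] mult_smult_assoc_mat[of _ ?n ?n _ ?n])
      then have "poly (det W) z = det (z \<cdot>\<^sub>m B + C) * det V"
        unfolding W_def poly_det_pencil[OF BV] using B C V by (simp add: det_mult[of _ ?n])
      then show "poly (det W) z = poly (monom (c * det V) ?n) z"
        using poly_det_pencil[OF B C, of z] d by (simp add: poly_monom)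
    qed
    ultimately have "[:0,1:] * det (replace_col W (map_vec (\<lambda>a. [:a:]) (B *\<^sub>v v)) 0) = [:0,1:] * monom (c * det V) n"
      by (simp add: monom_Suc)
    then have "det (replace_col W (map_vec (\<lambda>a. [:a:]) (B *\<^sub>v v)) 0) = monom (c * det V) n" by simp
    moreover have "B *\<^sub>v v \<in> carrier_vec ?n" using B v by simp
    moreover have "B *\<^sub>v v = 1 \<cdot>\<^sub>v (B *\<^sub>v v)" by simp
    ultimately show ?thesis using False by blast
  next
    case True
    \<comment> \<open>here \<open>w\<close> is free; the \<open>n\<close> coefficients below the top one of the determinant with first column \<open>w\<close> are linear
      in the \<open>n + 1\<close> entries of \<open>w\<close>, so they vanish for some \<open>w \<noteq> 0\<close>\<close>
    define K where "K i = cofactor W i 0" for i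
    have degK: "degree (K i) \<le> n" for i
    proof -
      have "degree (det (mat_delete W i 0)) \<le> 1 * n"
        by (rule degree_det_le) (use W in \<open>auto simp: mat_delete_def W_def pencil_def\<close>)
      then show ?thesis by (simp add: K_def cofactor_def minus_one_power_iff)
    qed
    obtain f where f: "\<forall>l\<in>{..<n}. (\<Sum>i<?n. coeff (K i) l * f i) = 0" "\<exists>i<?n. f i \<noteq> 0"
      by (rule homogeneous_system_nontrivial[of "{..<n}" ?n "\<lambda>l i. coeff (K i) l"]) (simp, simp, rule that)
    define w where "w = vec ?n f"
    have w: "w \<in> carrier_vec ?n" by (simp add: w_def)
    have w0: "w \<noteq> 0\<^sub>v ?n" using f(2) by (auto simp: w_def vec_eq_iff)
    define q where "q = det (replace_col W (map_vec (\<lambda>a. [:a:]) w) 0)"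
    have "q = (\<Sum>i<?n. [:f i:] * K i)"
    proof -
      have cof: "cofactor (replace_col W (map_vec (\<lambda>a. [:a:]) w) 0) i 0 = K i" if "i < ?n" for i
      proof -
        have "mat_delete (replace_col W (map_vec (\<lambda>a. [:a:]) w) 0) i 0 = mat_delete W i 0"
          using W by (intro eq_matI) (auto simp: mat_delete_def replace_col_def)
        then show ?thesis by (simp add: cofactor_def K_def)
      qed
      show ?thesis
        unfolding q_def laplace_expansion_column[OF replace_col_carrier[OF W] zero_less_Suc]
        by (intro sum.cong refl) (use cof W in \<open>simp add: replace_col_index w_def\<close>)
    qed
    then have coeffq: "coeff q l = (\<Sum>i<?n. coeff (K i) l * f i)" for l
      by (simp add: coeff_sum mult.commute)
    have "q = monom (coeff q n) n"
    proof (rule poly_eqI)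
      fix l
      consider "l < n" | "l = n" | "l > n" by linarith
      then show "coeff q l = coeff (monom (coeff q n) n) l"
      proof cases
        case 1
        then show ?thesis using f(1) unfolding coeffq by simp
      next
        case 3
        then have "coeff (K i) l = 0" for i using degK[of i] by (intro coeff_eq_0) simp
        then show ?thesis using 3 unfolding coeffq by simp
      qed simp
    qed
    moreover have "B *\<^sub>v v = 0 \<cdot>\<^sub>v w" using True w by (intro eq_vecI) auto
    ultimately show ?thesis using w w0 unfolding q_def by blast
  qed
  then obtain w \<beta> c' where w: "w \<in> carrier_vec ?n" "w \<noteq> 0\<^sub>v ?n" "B *\<^sub>v v = \<beta> \<cdot>\<^sub>v w"
    and dw: "det (replace_col W (map_vec (\<lambda>a. [:a:]) w) 0) = monom c' n" by blast
  obtain U' U where U: "U' \<in> carrier_mat ?n ?n" "U \<in> carrier_mat ?n ?n" "U' * U = 1\<^sub>m ?n" "U * U' = 1\<^sub>m ?n"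
    and Uw: "\<And>i. i < ?n \<Longrightarrow> U' $$ (i,0) = w $ i" by (rule invertible_with_first_column[OF w(1,2)]) (rule that)
  have Uw0: "(\<Sum>l<?n. U $$ (i,l) * w $ l) = (if i = 0 then 1 else 0)" if i: "i < ?n" for i
  proof -
    have "(\<Sum>l<?n. U $$ (i,l) * w $ l) = (U * U') $$ (i,0)"
      using mult_mat_index[OF U(2,1) i, of 0] Uw by simp
    then show ?thesis unfolding U(4) using i by simp
  qed
  have UXV: "U * X * V \<in> carrier_mat ?n ?n" if "X \<in> carrier_mat ?n ?n" for X using U V that by auto
  have UXVi: "(U * X * V) $$ (i,j) = (\<Sum>l<?n. U $$ (i,l) * (X * V) $$ (l,j))"
    if X: "X \<in> carrier_mat ?n ?n" and ij: "i < ?n" "j < ?n" for X i j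
    using assoc_mult_mat[OF U(2) X V(1)] mult_mat_index[OF U(2) mult_carrier_mat[OF X V(1)] ij] by simp
  have B0: "(U * B * V) $$ (i,0) = (if i = 0 then \<beta> else 0)" if i: "i < ?n" for i
  proof -
    have "(U * B * V) $$ (i,0) = (\<Sum>l<?n. \<beta> * (U $$ (i,l) * w $ l))"
      unfolding UXVi[OF B i zero_less_Suc]
      by (rule sum.cong) (use w in \<open>auto simp: XV0[OF B] w(3) simp del: index_mult_mat_vec\<close>)
    also have "\<dots> = \<beta> * (\<Sum>l<?n. U $$ (i,l) * w $ l)" by (simp only: sum_distrib_left)
    finally show ?thesis unfolding Uw0[OF i] by simp
  qed
  have C0: "(U * C * V) $$ (i,0) = 0" if i: "i < ?n" for i
    unfolding UXVi[OF C i zero_less_Suc]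
    by (rule sum.neutral) (use v(3) in \<open>auto simp: XV0[OF C] simp del: index_mult_mat_vec\<close>)
  define B2 where "B2 = mat n n (\<lambda>(i,j). (U * B * V) $$ (Suc i, Suc j))"
  define C2 where "C2 = mat n n (\<lambda>(i,j). (U * C * V) $$ (Suc i, Suc j))"
  have BC2: "B2 \<in> carrier_mat n n" "C2 \<in> carrier_mat n n" by (simp_all add: B2_def C2_def)
  have "det (pencil n B2 C2) = monom (det U * c') n"
  proof (rule poly_eq_poly_eq_iff[THEN iffD1], rule ext)
    fix z
    define R where "R = map_mat (\<lambda>p. poly p z) (replace_col W (map_vec (\<lambda>a. [:a:]) w) 0)"
    have R: "R \<in> carrier_mat ?n ?n" unfolding R_def using replace_col_carrier[OF W] by simp
    have Ri: "R $$ (i,j) = (if j = 0 then w $ i else z * (B * V) $$ (i,j) + (C * V) $$ (i,j))"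
      if ij: "i < ?n" "j < ?n" for i j
      using ij W w(1) replace_col_index[OF W ij] replace_col_carrier[OF W, of "map_vec (\<lambda>a. [:a:]) w" 0]
      by (auto simp: R_def W_def pencil_def simp del: index_mult_mat)
    define T where "T = mat 1 n (\<lambda>(i,j). (U * R) $$ (0, Suc j))"
    have "U * R = four_block_mat (1\<^sub>m 1) T (0\<^sub>m n 1) (z \<cdot>\<^sub>m B2 + C2)" (is "_ = ?F")
    proof (rule eq_matI)
      fix i j assume "i < dim_row ?F" "j < dim_col ?F"
      then have ij: "i < ?n" "j < ?n" using BC2 by (auto simp: T_def)
      have s: "(U * R) $$ (i,j) = (\<Sum>l<?n. U $$ (i,l) * R $$ (l,j))" by (rule mult_mat_index[OF U(2) R ij])
      show "(U * R) $$ (i,j) = ?F $$ (i,j)"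
      proof (cases "j = 0")
        case True
        have "(U * R) $$ (i,j) = (\<Sum>l<?n. U $$ (i,l) * w $ l)"
          unfolding s by (rule sum.cong) (use Ri True in auto)
        then show ?thesis using Uw0[OF ij(1)] True ij BC2 by (auto simp: T_def)
      next
        case False
        have "(U * R) $$ (i,j) = (\<Sum>l<?n. z * (U $$ (i,l) * (B * V) $$ (l,j)) + U $$ (i,l) * (C * V) $$ (l,j))"
          unfolding s by (rule sum.cong) (use Ri ij(2) False in \<open>auto simp: algebra_simps simp del: index_mult_mat\<close>)
        also have "\<dots> = z * (U * B * V) $$ (i,j) + (U * C * V) $$ (i,j)"
          unfolding UXVi[OF B ij] UXVi[OF C ij] sum.distrib sum_distrib_left ..
        finally have e: "(U * R) $$ (i,j) = z * (U * B * V) $$ (i,j) + (U * C * V) $$ (i,j)" .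
        obtain j' where j': "j = Suc j'" "j' < n" using False ij(2) by (cases j) auto
        show ?thesis
        proof (cases i)
          case 0
          then show ?thesis using j' BC2 by (simp add: T_def del: index_mult_mat)
        next
          case (Suc i')
          then show ?thesis using e j' ij(1) BC2 by (simp add: B2_def C2_def del: index_mult_mat)
        qed
      qed
    qed (use BC2 U R in \<open>auto simp: T_def\<close>)
    moreover have "det (four_block_mat (1\<^sub>m 1) T (0\<^sub>m n 1) (z \<cdot>\<^sub>m B2 + C2)) =
        det (1\<^sub>m 1 :: complex mat) * det (z \<cdot>\<^sub>m B2 + C2)"
      by (rule det_four_block_mat_lower_left_zero) (use BC2 in \<open>auto simp: T_def\<close>)
    ultimately have "det (U * R) = det (1\<^sub>m 1 :: complex mat) * det (z \<cdot>\<^sub>m B2 + C2)" by metis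
    then have "det (z \<cdot>\<^sub>m B2 + C2) = det U * det R" using det_mult[OF U(2) R] by simp
    also have "det R = poly (monom c' n) z" unfolding R_def poly_det[symmetric] dw ..
    finally show "poly (det (pencil n B2 C2)) z = poly (monom (det U * c') n) z"
      unfolding poly_det_pencil[OF BC2] by (simp add: poly_monom)
  qed
  then show ?thesis
    by (intro that[OF U(2,1) V(1,2) U(4,3) V(3,4) BC2]) (use B0 C0 in \<open>auto simp: B2_def C2_def simp del: index_mult_mat\<close>)
qed

text \<open>Along the flag the diagonal entries are \<open>\<beta>_i z\<close>, some of the \<open>\<beta>_i\<close> possibly zero. The perturbation \<open>G\<close> is the
identity with respect to the two bases of the flag, so \<open>\<beta>_i\<close> becomes \<open>\<beta>_i + s\<close>, which vanishes for finitely many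
\<open>s\<close> only.\<close>

lemma pencil_regularize:
  assumes "B \<in> carrier_mat n n" "C \<in> carrier_mat n n" "det (pencil n B C) = monom c n"
  shows "\<exists>G F. G \<in> carrier_mat n n \<and> finite F \<and>
    (\<forall>s. s \<notin> F \<longrightarrow> (\<exists>c'. c' \<noteq> 0 \<and> (\<forall>z. det (z \<cdot>\<^sub>m (B + s \<cdot>\<^sub>m G) + C) = c' * z ^ n)))"
  using assms
proof (induction n arbitrary: B C c)
  case 0
  then have "det (z \<cdot>\<^sub>m (B + s \<cdot>\<^sub>m 0\<^sub>m 0 0) + C) = 1 * z ^ 0" for z s
    by (subst det_dim_zero) auto
  then show ?case by (intro exI[of _ "0\<^sub>m 0 0"] exI[of _ "{}"]) auto
next
  case (Suc n)
  let ?n = "Suc n"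
  obtain U U' V V' B2 C2 \<beta> c2 where
    c: "U \<in> carrier_mat ?n ?n" "U' \<in> carrier_mat ?n ?n"
    "V \<in> carrier_mat ?n ?n" "V' \<in> carrier_mat ?n ?n"
    and inv: "U * U' = 1\<^sub>m ?n" "U' * U = 1\<^sub>m ?n" "V * V' = 1\<^sub>m ?n" "V' * V = 1\<^sub>m ?n"
    and c2: "B2 \<in> carrier_mat n n" "C2 \<in> carrier_mat n n"
    and e: "(U * B * V) $$ (0,0) = \<beta>" "(U * C * V) $$ (0,0) = 0"
    "\<And>i. i < n \<Longrightarrow> (U * B * V) $$ (Suc i,0) = 0" "\<And>i. i < n \<Longrightarrow> (U * C * V) $$ (Suc i,0) = 0"
    "\<And>i j. i < n \<Longrightarrow> j < n \<Longrightarrow> (U * B * V) $$ (Suc i, Suc j) = B2 $$ (i,j)"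
    "\<And>i j. i < n \<Longrightarrow> j < n \<Longrightarrow> (U * C * V) $$ (Suc i, Suc j) = C2 $$ (i,j)"
    and d2: "det (pencil n B2 C2) = monom c2 n"
    by (rule pencil_deflate[OF Suc.prems]) (rule that)
  note BC = Suc.prems(1,2)
  obtain G2 F2 where G2: "G2 \<in> carrier_mat n n" "finite F2"
    "\<And>s. s \<notin> F2 \<Longrightarrow> \<exists>c'. c' \<noteq> 0 \<and> (\<forall>z. det (z \<cdot>\<^sub>m (B2 + s \<cdot>\<^sub>m G2) + C2) = c' * z ^ n)"
    using Suc.IH[OF c2 d2] by blast
  define G0 where "G0 = four_block_mat (1\<^sub>m 1) (0\<^sub>m 1 n) (0\<^sub>m n 1) G2"
  have G0: "G0 \<in> carrier_mat ?n ?n" using G2(1) by (auto simp: G0_def)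
  define G where "G = U' * G0 * V'"
  have G: "G \<in> carrier_mat ?n ?n" using c G0 by (simp add: G_def)
  have UGV: "U * G * V = G0"
  proof -
    have "U * G * V = (U * U') * (G0 * (V' * V))"
      unfolding G_def using c G0 by (simp add: assoc_mult_mat[of _ ?n ?n _ ?n _ ?n])
    then show ?thesis using inv G0 by simp
  qed
  have dUV: "det U \<noteq> 0" "det V \<noteq> 0"
    using det_mult[OF c(1,2)] det_mult[OF c(3,4)] inv by auto
  have main: "\<exists>c'. c' \<noteq> 0 \<and> (\<forall>z. det (z \<cdot>\<^sub>m (B + s \<cdot>\<^sub>m G) + C) = c' * z ^ ?n)"
    if s: "s \<notin> insert (- \<beta>) F2" for s
  proof -
    obtain c' where c': "c' \<noteq> 0" "\<And>z. det (z \<cdot>\<^sub>m (B2 + s \<cdot>\<^sub>m G2) + C2) = c' * z ^ n"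
      using G2(3)[of s] s by blast
    have bs: "\<beta> + s \<noteq> 0" using s by (auto simp: add_eq_0_iff)
    have "det (z \<cdot>\<^sub>m (B + s \<cdot>\<^sub>m G) + C) = ((\<beta> + s) * c' / (det U * det V)) * z ^ ?n" for z
    proof -
      define Y where "Y = U * (z \<cdot>\<^sub>m (B + s \<cdot>\<^sub>m G) + C) * V"
      have comm: "B + s \<cdot>\<^sub>m G = s \<cdot>\<^sub>m G + B" using BC G by (intro comm_add_mat[of _ ?n ?n]) auto
      have Y: "Y = z \<cdot>\<^sub>m (s \<cdot>\<^sub>m G0 + U * B * V) + U * C * V"
        unfolding Y_def comm using c BC G
        by (simp add: conj_linear[of U ?n V] UGV)
      define T where "T = mat 1 n (\<lambda>(i,j). Y $$ (0, Suc j))"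
      have "Y = four_block_mat (mat 1 1 (\<lambda>_. z * (\<beta> + s))) T (0\<^sub>m n 1) (z \<cdot>\<^sub>m (B2 + s \<cdot>\<^sub>m G2) + C2)" (is "_ = ?F")
      proof (rule eq_matI)
        fix i j assume "i < dim_row ?F" "j < dim_col ?F"
        then have ij: "i < ?n" "j < ?n" using c2 by (auto simp: T_def)
        have Yij: "Y $$ (i,j) = z * (s * G0 $$ (i,j) + (U * B * V) $$ (i,j)) + (U * C * V) $$ (i,j)"
          unfolding Y using ij c BC G0 by (simp del: index_mult_mat(1))
        show "Y $$ (i,j) = ?F $$ (i,j)"
        proof (cases i; cases j)
          assume "i = 0" "j = 0"
          then show ?thesis using Yij e(1,2) c2 G2(1) by (simp add: G0_def del: index_mult_mat(1))
        next
          fix j' assume "i = 0" "j = Suc j'"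
          then show ?thesis using ij c2 by (simp add: T_def)
        next
          fix i' assume "i = Suc i'" "j = 0"
          then show ?thesis using Yij e(3,4)[of i'] ij c2 G2(1) by (simp add: G0_def del: index_mult_mat(1))
        next
          fix i' j' assume "i = Suc i'" "j = Suc j'"
          then show ?thesis using Yij e(5,6)[of i' j'] ij c2 G2(1)
            by (simp add: G0_def del: index_mult_mat(1))
        qed
      qed (use c2 c in \<open>auto simp: T_def Y_def\<close>)
      moreover have "det (four_block_mat (mat 1 1 (\<lambda>_. z * (\<beta> + s))) T (0\<^sub>m n 1)
          (z \<cdot>\<^sub>m (B2 + s \<cdot>\<^sub>m G2) + C2)) =
          det (mat 1 1 (\<lambda>_. z * (\<beta> + s))) * det (z \<cdot>\<^sub>m (B2 + s \<cdot>\<^sub>m G2) + C2)"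
        by (rule det_four_block_mat_lower_left_zero) (use c2 G2(1) in \<open>auto simp: T_def\<close>)
      ultimately have "det Y = det (mat 1 1 (\<lambda>_. z * (\<beta> + s))) * det (z \<cdot>\<^sub>m (B2 + s \<cdot>\<^sub>m G2) + C2)"
        by metis
      then have "det Y = (\<beta> + s) * c' * z ^ ?n"
        unfolding c'(2) by (simp add: det_single)
      moreover have "det Y = det U * det (z \<cdot>\<^sub>m (B + s \<cdot>\<^sub>m G) + C) * det V"
        unfolding Y_def using c BC G by (simp add: det_mult[of _ ?n])
      ultimately show ?thesis using dUV by (simp add: field_simps)
    qed
    then show ?thesis using bs c'(1) dUV
      by (intro exI[of _ "(\<beta> + s) * c' / (det U * det V)"]) simp
  qed
  then show ?case using G G2(2) by (intro exI[of _ G] exI[of _ "insert (- \<beta>) F2"]) blast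
qed

section \<open>Linear systems near an invertible one\<close>

text \<open>Compare both sides at an index where the modulus of \<open>\<eta>\<close> is largest.\<close>

lemma near_identity_bound:
  fixes X :: "nat \<Rightarrow> nat \<Rightarrow> complex"
  assumes X: "\<And>i. i < d \<Longrightarrow> (\<Sum>j<d. cmod (X i j)) \<le> 1 / 2"
    and eq: "\<And>i. i < d \<Longrightarrow> \<eta> i + (\<Sum>j<d. X i j * \<eta> j) = y i"
    and y: "\<And>i. i < d \<Longrightarrow> cmod (y i) \<le> b" and l: "l < d"
  shows "cmod (\<eta> l) \<le> 2 * b"
proof -
  define S where "S = (\<lambda>i. cmod (\<eta> i)) ` {..<d}"
  have S: "finite S" "S \<noteq> {}" using l by (auto simp: S_def)
  obtain p where p: "p < d" "cmod (\<eta> p) = Max S" using Max_in[OF S] by (auto simp: S_def)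
  have le: "cmod (\<eta> j) \<le> cmod (\<eta> p)" if "j < d" for j
    unfolding p(2) by (rule Max_ge[OF S(1)]) (use that in \<open>auto simp: S_def\<close>)
  have "cmod (\<Sum>j<d. X p j * \<eta> j) \<le> (\<Sum>j<d. cmod (X p j) * cmod (\<eta> p))"
    by (rule sum_norm_le) (use le in \<open>auto simp: norm_mult intro: mult_left_mono\<close>)
  also have "\<dots> \<le> 1 / 2 * cmod (\<eta> p)"
    unfolding sum_distrib_right[symmetric] using X[OF p(1)] by (intro mult_right_mono) auto
  finally have 1: "cmod (\<Sum>j<d. X p j * \<eta> j) \<le> 1 / 2 * cmod (\<eta> p)" .
  have "\<eta> p = y p - (\<Sum>j<d. X p j * \<eta> j)" using eq[OF p(1)] by (simp add: algebra_simps)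
  then have "cmod (\<eta> p) \<le> cmod (y p) + cmod (\<Sum>j<d. X p j * \<eta> j)" by (metis norm_triangle_ineq4)
  then have "cmod (\<eta> p) \<le> 2 * b" using 1 y[OF p(1)] by linarith
  then show ?thesis using le[OF l] by linarith
qed

text \<open>With \<open>K = M\<^sup>-\<^sup>1 G\<close> the perturbed matrix is \<open>M (1 + s K)\<close>, and \<open>1 + s K\<close> is invertible with a uniform bound
for small \<open>s\<close>.\<close>

lemma stable_solve_mat:
  assumes M: "M \<in> carrier_mat d d" "det M \<noteq> 0" and G: "G \<in> carrier_mat d d"
    and z0: "z0 \<in> carrier_vec d" and eps: "0 < \<epsilon>"
  shows "\<exists>\<delta>>0. \<forall>s::complex. cmod s < \<delta> \<longrightarrow>
    (\<exists>z\<in>carrier_vec d. (M + s \<cdot>\<^sub>m G) *\<^sub>v z = M *\<^sub>v z0 \<and> (\<forall>i<d. cmod (z $ i - z0 $ i) < \<epsilon>))"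
proof -
  obtain M' where M': "M' \<in> carrier_mat d d" "M * M' = 1\<^sub>m d" "M' * M = 1\<^sub>m d"
    by (rule invertible_of_det[OF M]) (rule that)
  define K where "K = M' * G"
  have K: "K \<in> carrier_mat d d" using M' G by (simp add: K_def)
  have MK: "M * K = G" unfolding K_def
    using M M' G by (simp add: assoc_mult_mat[of M d d M' d G d, symmetric])
  define w where "w = K *\<^sub>v z0"
  have w: "w \<in> carrier_vec d" using K z0 by (simp add: w_def)
  define \<kappa> where "\<kappa> = (\<Sum>i<d. \<Sum>j<d. cmod (K $$ (i,j))) + 1"
  define b where "b = (\<Sum>i<d. cmod (w $ i)) + 1"
  have \<kappa>: "(\<Sum>j<d. cmod (K $$ (i,j))) \<le> \<kappa>" if "i < d" for i
    using member_le_sum[of i "{..<d}" "\<lambda>i. \<Sum>j<d. cmod (K $$ (i,j))"] that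
    by (simp add: \<kappa>_def sum_nonneg)
  have b: "cmod (w $ i) \<le> b" if "i < d" for i
    using member_le_sum[of i "{..<d}" "\<lambda>i. cmod (w $ i)"] that by (simp add: b_def)
  have pos: "0 < \<kappa>" "0 < b" unfolding \<kappa>_def b_def by (intro add_nonneg_pos sum_nonneg; simp)+
  \<comment> \<open>the first bound makes \<open>s K\<close> at most \<open>1 / 2\<close> in row sum norm, the second keeps \<open>2 s b\<close> below \<open>\<epsilon>\<close>\<close>
  define \<delta> where "\<delta> = min (1 / (2 * \<kappa>)) (\<epsilon> / (2 * b))"
  have d0: "0 < \<delta>" using pos eps by (simp add: \<delta>_def)
  have "\<exists>z\<in>carrier_vec d. (M + s \<cdot>\<^sub>m G) *\<^sub>v z = M *\<^sub>v z0 \<and> (\<forall>i<d. cmod (z $ i - z0 $ i) < \<epsilon>)"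
    if s: "cmod s < \<delta>" for s
  proof -
    have sk: "cmod s * \<kappa> \<le> 1 / 2" using s pos by (simp add: \<delta>_def pos_less_divide_eq)
    have sb: "2 * (cmod s * b) < \<epsilon>" using s pos by (simp add: \<delta>_def pos_less_divide_eq)
    have X: "(\<Sum>j<d. cmod (s * K $$ (i,j))) \<le> 1 / 2" if i: "i < d" for i
    proof -
      have "(\<Sum>j<d. cmod (s * K $$ (i,j))) = cmod s * (\<Sum>j<d. cmod (K $$ (i,j)))"
        by (simp add: norm_mult sum_distrib_left)
      also have "\<dots> \<le> cmod s * \<kappa>" using \<kappa>[OF i] by (intro mult_left_mono) auto
      finally show ?thesis using sk by linarith
    qed
    define N where "N = 1\<^sub>m d + s \<cdot>\<^sub>m K"
    have N: "N \<in> carrier_mat d d" using K by (simp add: N_def)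
    have Nv: "(N *\<^sub>v v) $ i = v $ i + (\<Sum>j<d. (s * K $$ (i,j)) * v $ j)"
      if "v \<in> carrier_vec d" "i < d" for v i
    proof -
      have "N *\<^sub>v v = v + (s \<cdot>\<^sub>m K) *\<^sub>v v"
        unfolding N_def using that K by (simp add: add_mult_distrib_mat_vec[of _ d d])
      then show ?thesis using that K mult_mat_vec_index[of "s \<cdot>\<^sub>m K" d d v i] by simp
    qed
    have "det N \<noteq> 0"
    proof
      assume "det N = 0"
      then obtain c where c: "c \<in> carrier_vec d" "c \<noteq> 0\<^sub>v d" "N *\<^sub>v c = 0\<^sub>v d"
        using det_0_iff_vec_prod_zero_field[OF N] by blast
      have "cmod (c $ l) \<le> 2 * 0" if "l < d" for l
        by (rule near_identity_bound[OF X, where y = "\<lambda>_. 0"]) (use Nv[OF c(1)] c(3) that in auto)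
      then have "c = 0\<^sub>v d" using c(1) by (intro eq_vecI) auto
      then show False using c(2) by blast
    qed
    then obtain N' where N': "N' \<in> carrier_mat d d" "N * N' = 1\<^sub>m d"
      by (rule invertible_of_det[OF N]) (rule that)
    define \<eta> where "\<eta> = N' *\<^sub>v (- s \<cdot>\<^sub>v w)"
    have \<eta>: "\<eta> \<in> carrier_vec d" using N' w by (simp add: \<eta>_def)
    have N\<eta>: "N *\<^sub>v \<eta> = - s \<cdot>\<^sub>v w"
      unfolding \<eta>_def using N N' w assoc_mult_mat_vec[of N d d N' d "- s \<cdot>\<^sub>v w"] by simp
    have bound: "cmod (\<eta> $ l) \<le> 2 * (cmod s * b)" if "l < d" for l
    proof (rule near_identity_bound[OF X _ _ that, where y = "\<lambda>i. - s * w $ i"])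
      show "\<eta> $ i + (\<Sum>j<d. s * K $$ (i,j) * \<eta> $ j) = - s * w $ i" if "i < d" for i
        using Nv[OF \<eta> that] w that unfolding N\<eta> by simp
      show "cmod (- s * w $ i) \<le> cmod s * b" if "i < d" for i
        using b[OF that] by (simp add: norm_mult mult_left_mono)
    qed
    have z: "z0 + \<eta> \<in> carrier_vec d" using z0 \<eta> by simp
    have "N *\<^sub>v (z0 + \<eta>) = z0"
    proof (rule eq_vecI)
      fix i assume "i < dim_vec z0"
      then have i: "i < d" using z0 by simp
      have "(N *\<^sub>v (z0 + \<eta>)) $ i = (N *\<^sub>v z0) $ i + (N *\<^sub>v \<eta>) $ i"
        using i N z0 \<eta> by (simp add: mult_add_distrib_mat_vec[of _ d d])
      also have "(N *\<^sub>v z0) $ i = z0 $ i + s * w $ i"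
        unfolding Nv[OF z0 i] w_def mult_mat_vec_index[OF K z0 i] by (simp add: sum_distrib_left mult.assoc)
      finally show "(N *\<^sub>v (z0 + \<eta>)) $ i = z0 $ i" unfolding N\<eta> using i w by simp
    qed (use N z0 in simp)
    moreover have "M + s \<cdot>\<^sub>m G = M * N"
      unfolding N_def using M K MK by (simp add: mult_add_distrib_mat[of _ d d _ d] mult_smult_distrib[of _ d d _ d])
    ultimately have "(M + s \<cdot>\<^sub>m G) *\<^sub>v (z0 + \<eta>) = M *\<^sub>v z0"
      using M(1) N z assoc_mult_mat_vec[of M d d N d "z0 + \<eta>"] by simp
    moreover have "cmod ((z0 + \<eta>) $ i - z0 $ i) < \<epsilon>" if "i < d" for i
      using bound[OF that] sb that z0 \<eta> by simp
    ultimately show ?thesis using z by blast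
  qed
  then show ?thesis using d0 by blast
qed

text \<open>The same for equations and unknowns indexed by arbitrary finite sets of equal size, where the right-hand
side is given by a solution \<open>\<zeta>0\<close> of the unperturbed system.\<close>

lemma stable_solve:
  fixes m g :: "'i \<Rightarrow> 'j \<Rightarrow> complex"
  assumes fin: "finite I" "finite J" and card: "card I = card J"
    and inj: "\<forall>\<zeta>. (\<forall>i\<in>I. (\<Sum>j\<in>J. m i j * \<zeta> j) = 0) \<longrightarrow> (\<forall>j\<in>J. \<zeta> j = 0)"
    and eps: "0 < \<epsilon>"
  shows "\<exists>\<delta>>0. \<forall>s. cmod s < \<delta> \<longrightarrow>
    (\<exists>\<zeta>. (\<forall>i\<in>I. (\<Sum>j\<in>J. (m i j + s * g i j) * \<zeta> j) = (\<Sum>j\<in>J. m i j * \<zeta>0 j)) \<and>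
      (\<forall>j\<in>J. cmod (\<zeta> j - \<zeta>0 j) < \<epsilon>))"
proof -
  define d where "d = card J"
  obtain f where f: "bij_betw f {..<d} J"
    using ex_bij_betw_nat_finite[OF fin(2)] by (auto simp: d_def lessThan_atLeast0)
  obtain e where e: "bij_betw e {..<d} I"
    using ex_bij_betw_nat_finite[OF fin(1)] by (auto simp: d_def card lessThan_atLeast0)
  have fJ: "f l \<in> J" if "l < d" for l using bij_betwE[OF f] that by simp
  have eI: "e l \<in> I" if "l < d" for l using bij_betwE[OF e] that by simp
  obtain f' where f': "\<And>l. l < d \<Longrightarrow> f' (f l) = l" and ff': "\<And>j. j \<in> J \<Longrightarrow> f' j < d \<and> f (f' j) = j"
  proof
    show "inv_into {..<d} f (f l) = l" if "l < d" for l
      using bij_betw_inv_into_left[OF f] that by simp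
    show "inv_into {..<d} f j < d \<and> f (inv_into {..<d} f j) = j" if "j \<in> J" for j
      using bij_betw_inv_into_right[OF f that] bij_betwE[OF bij_betw_inv_into[OF f]] that by simp
  qed
  have re: "(\<Sum>j\<in>J. h j) = (\<Sum>l<d. h (f l))" for h :: "'j \<Rightarrow> complex"
    using sum.reindex_bij_betw[OF f, of h] by simp
  have eI': "\<exists>l<d. e l = i" if "i \<in> I" for i
    using bij_betw_imp_surj_on[OF e] that by (auto simp: image_iff)
  define M where "M = mat d d (\<lambda>(a,b). m (e a) (f b))"
  define G where "G = mat d d (\<lambda>(a,b). g (e a) (f b))"
  have M: "M \<in> carrier_mat d d" and G: "G \<in> carrier_mat d d" by (simp_all add: M_def G_def)
  have "det M \<noteq> 0"
  proof
    assume "det M = 0"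
    then obtain c where c: "c \<in> carrier_vec d" "c \<noteq> 0\<^sub>v d" "M *\<^sub>v c = 0\<^sub>v d"
      using det_0_iff_vec_prod_zero_field[OF M] by blast
    define \<zeta> where "\<zeta> j = c $ f' j" for j
    have "(\<Sum>j\<in>J. m i j * \<zeta> j) = 0" if i: "i \<in> I" for i
    proof -
      obtain l where l: "l < d" "e l = i" using eI'[OF i] by blast
      have "(\<Sum>j\<in>J. m i j * \<zeta> j) = (\<Sum>b<d. M $$ (l,b) * c $ b)"
        unfolding re by (rule sum.cong) (use l f' in \<open>auto simp: M_def \<zeta>_def\<close>)
      also have "\<dots> = (M *\<^sub>v c) $ l" using mult_mat_vec_index[OF M c(1) l(1)] by simp
      finally show ?thesis using c(3) l by simp
    qed
    then have "\<forall>j\<in>J. \<zeta> j = 0" using inj by blast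
    then have "\<zeta> j = 0" if "j \<in> J" for j using that by blast
    then have "c $ l = 0" if "l < d" for l using fJ[OF that] f'[OF that] unfolding \<zeta>_def by metis
    then have "c = 0\<^sub>v d" using c(1) by (intro eq_vecI) auto
    then show False using c(2) by blast
  qed
  define z0 where "z0 = vec d (\<lambda>l. \<zeta>0 (f l))"
  have z0: "z0 \<in> carrier_vec d" by (simp add: z0_def)
  obtain \<delta> where \<delta>: "0 < \<delta>" "\<And>s. cmod s < \<delta> \<Longrightarrow>
    \<exists>z\<in>carrier_vec d. (M + s \<cdot>\<^sub>m G) *\<^sub>v z = M *\<^sub>v z0 \<and> (\<forall>i<d. cmod (z $ i - z0 $ i) < \<epsilon>)"
    using stable_solve_mat[OF M \<open>det M \<noteq> 0\<close> G z0 eps] by blast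
  have "\<exists>\<zeta>. (\<forall>i\<in>I. (\<Sum>j\<in>J. (m i j + s * g i j) * \<zeta> j) = (\<Sum>j\<in>J. m i j * \<zeta>0 j)) \<and>
      (\<forall>j\<in>J. cmod (\<zeta> j - \<zeta>0 j) < \<epsilon>)" if s: "cmod s < \<delta>" for s
  proof -
    obtain z where z: "z \<in> carrier_vec d" "(M + s \<cdot>\<^sub>m G) *\<^sub>v z = M *\<^sub>v z0" "\<forall>i<d. cmod (z $ i - z0 $ i) < \<epsilon>"
      using \<delta>(2)[OF s] by blast
    define \<zeta> where "\<zeta> j = z $ f' j" for j
    have MG: "M + s \<cdot>\<^sub>m G \<in> carrier_mat d d" using M G by simp
    have "(\<Sum>j\<in>J. (m i j + s * g i j) * \<zeta> j) = (\<Sum>j\<in>J. m i j * \<zeta>0 j)" if i: "i \<in> I" for i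
    proof -
      obtain l where l: "l < d" "e l = i" using eI'[OF i] by blast
      have "(\<Sum>j\<in>J. (m i j + s * g i j) * \<zeta> j) = (\<Sum>b<d. (M + s \<cdot>\<^sub>m G) $$ (l,b) * z $ b)"
        unfolding re by (rule sum.cong) (use l f' in \<open>auto simp: M_def G_def \<zeta>_def\<close>)
      also have "\<dots> = (M *\<^sub>v z0) $ l" using mult_mat_vec_index[OF MG z(1) l(1)] z(2) by simp
      also have "\<dots> = (\<Sum>b<d. M $$ (l,b) * z0 $ b)" by (rule mult_mat_vec_index[OF M z0 l(1)])
      also have "\<dots> = (\<Sum>j\<in>J. m i j * \<zeta>0 j)"
        unfolding re by (rule sum.cong) (use l in \<open>auto simp: M_def z0_def\<close>)
      finally show ?thesis .
    qed
    moreover have "cmod (\<zeta> j - \<zeta>0 j) < \<epsilon>" if "j \<in> J" for j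
      using z(3) ff'[OF that] unfolding \<zeta>_def z0_def by force
    ultimately show ?thesis by blast
  qed
  then show ?thesis using \<delta>(1) by blast
qed

section \<open>Companion pencils and nearby regular matrix polynomials\<close>

definition eval_matpoly :: "nat \<Rightarrow> nat \<Rightarrow> (nat \<Rightarrow> complex mat) \<Rightarrow> complex \<Rightarrow> complex mat" where
  "eval_matpoly n k A z = mat n n (\<lambda>(a,b). \<Sum>i\<le>k. z ^ i * A i $$ (a,b))"

text \<open>The companion pencil \<open>z B + C\<close> maps \<open>(x_0, ..., x_(k-1))\<close> to the blocks \<open>z x_i - x_(i+1)\<close> for \<open>i < k - 1\<close>,
followed by \<open>z A_k x_(k-1) + A_0 x_0 + ... + A_(k-1) x_(k-1)\<close>. In particular it maps \<open>(u, z u, ..., z^(k-1) u)\<close>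
to \<open>(0, ..., 0, A(z) u)\<close>. Here \<open>companion_lead\<close> is \<open>B\<close> and \<open>companion_const\<close> is \<open>C\<close>.\<close>

definition companion_lead :: "nat \<Rightarrow> nat \<Rightarrow> (nat \<Rightarrow> complex mat) \<Rightarrow> complex mat" where
  "companion_lead n k A = mat (k * n) (k * n) (\<lambda>(\<rho>,c).
     if \<rho> < (k - 1) * n then (if c = \<rho> then 1 else 0)
     else if c div n = k - 1 then A k $$ (\<rho> - (k - 1) * n, c mod n) else 0)"

definition companion_const :: "nat \<Rightarrow> nat \<Rightarrow> (nat \<Rightarrow> complex mat) \<Rightarrow> complex mat" where
  "companion_const n k A = mat (k * n) (k * n) (\<lambda>(\<rho>,c).
     if \<rho> < (k - 1) * n then (if c = \<rho> + n then -1 else 0)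
     else A (c div n) $$ (\<rho> - (k - 1) * n, c mod n))"

text \<open>Entry \<open>\<rho>\<close> of the coefficient of \<open>z^j\<close> in \<open>z B + C\<close> applied to the polynomial vector with coefficients
\<open>\<zeta> 0, ..., \<zeta> (k - 1)\<close>.\<close>

definition pencil_coeff ::
  "nat \<Rightarrow> nat \<Rightarrow> complex mat \<Rightarrow> complex mat \<Rightarrow> (nat \<Rightarrow> nat \<Rightarrow> complex) \<Rightarrow> nat \<Rightarrow> nat \<Rightarrow> complex" where
  "pencil_coeff k d B C \<zeta> j \<rho> =
     (\<Sum>c<d. B $$ (\<rho>,c) * (if 1 \<le> j then \<zeta> (j - 1) c else 0) + C $$ (\<rho>,c) * (if j < k then \<zeta> j c else 0))"

lemma pencil_coeff_generating:
  assumes B: "B \<in> carrier_mat d d" and C: "C \<in> carrier_mat d d" and \<rho>: "\<rho> < d" and k: "1 \<le> k"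
  shows "(\<Sum>j\<le>k. z ^ j * pencil_coeff k d B C \<zeta> j \<rho>) =
    (\<Sum>c<d. (z \<cdot>\<^sub>m B + C) $$ (\<rho>,c) * (\<Sum>j<k. z ^ j * \<zeta> j c))"
proof -
  have 1: "(\<Sum>j\<le>k. z ^ j * (if 1 \<le> j then \<zeta> (j - 1) c else 0)) = z * (\<Sum>j<k. z ^ j * \<zeta> j c)" for c
  proof -
    obtain k' where k': "k = Suc k'" using k by (cases k) auto
    have "(\<Sum>j\<le>Suc k'. z ^ j * (if 1 \<le> j then \<zeta> (j - 1) c else 0)) = (\<Sum>j\<le>k'. z ^ Suc j * \<zeta> j c)"
      unfolding sum.atMost_Suc_shift by simp
    then show ?thesis unfolding k' by (simp add: sum_distrib_left mult.assoc lessThan_Suc_atMost)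
  qed
  have 2: "(\<Sum>j\<le>k. z ^ j * (if j < k then \<zeta> j c else 0)) = (\<Sum>j<k. z ^ j * \<zeta> j c)" for c
    by (rule sum.mono_neutral_cong_right) auto
  have "(\<Sum>j\<le>k. z ^ j * pencil_coeff k d B C \<zeta> j \<rho>) =
      (\<Sum>j\<le>k. \<Sum>c<d. B $$ (\<rho>,c) * (z ^ j * (if 1 \<le> j then \<zeta> (j - 1) c else 0)) +
        C $$ (\<rho>,c) * (z ^ j * (if j < k then \<zeta> j c else 0)))"
    unfolding pencil_coeff_def sum_distrib_left by (intro sum.cong refl) (simp only: algebra_simps)
  also have "\<dots> = (\<Sum>c<d. \<Sum>j\<le>k. B $$ (\<rho>,c) * (z ^ j * (if 1 \<le> j then \<zeta> (j - 1) c else 0)) +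
        C $$ (\<rho>,c) * (z ^ j * (if j < k then \<zeta> j c else 0)))" by (rule sum.swap)
  also have "\<dots> = (\<Sum>c<d. (z \<cdot>\<^sub>m B + C) $$ (\<rho>,c) * (\<Sum>j<k. z ^ j * \<zeta> j c))"
  proof (rule sum.cong[OF refl])
    fix c assume "c \<in> {..<d}"
    then have e: "(z \<cdot>\<^sub>m B + C) $$ (\<rho>,c) = z * B $$ (\<rho>,c) + C $$ (\<rho>,c)" using B C \<rho> by simp
    show "(\<Sum>j\<le>k. B $$ (\<rho>,c) * (z ^ j * (if 1 \<le> j then \<zeta> (j - 1) c else 0)) +
        C $$ (\<rho>,c) * (z ^ j * (if j < k then \<zeta> j c else 0))) = (z \<cdot>\<^sub>m B + C) $$ (\<rho>,c) * (\<Sum>j<k. z ^ j * \<zeta> j c)"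
      unfolding sum.distrib sum_distrib_left[symmetric] 1 2 e by (simp add: algebra_simps)
  qed
  finally show ?thesis .
qed

text \<open>\<open>det B\<close> is the value at \<open>0\<close> of the determinant of the reversed pencil \<open>w C + B\<close>, which is constant.\<close>

lemma det_lead_of_pencil:
  assumes B: "(B :: complex mat) \<in> carrier_mat d d" and C: "C \<in> carrier_mat d d"
    and dz: "\<And>z. det (z \<cdot>\<^sub>m B + C) = c * z ^ d" and c: "c \<noteq> 0"
  shows "det B \<noteq> 0"
proof -
  have "poly (det (pencil d C B)) w = c" if w: "w \<noteq> 0" for w
  proof -
    have "w \<cdot>\<^sub>m C + B = w \<cdot>\<^sub>m ((1 / w) \<cdot>\<^sub>m B + C)"
      using B C w by (intro eq_matI) (auto simp: algebra_simps)
    moreover have "dim_col ((1 / w) \<cdot>\<^sub>m B + C) = d" using B C by simp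
    ultimately have "det (w \<cdot>\<^sub>m C + B) = w ^ d * (c * (1 / w) ^ d)"
      unfolding dz[symmetric] by simp
    then show ?thesis unfolding poly_det_pencil[OF C B] using w by (simp add: field_simps power_divide)
  qed
  then have sub: "{w. w \<noteq> 0} \<subseteq> {w. poly (det (pencil d C B) - [:c:]) w = 0}" by auto
  have "infinite {w :: complex. w \<noteq> 0}"
    using infinite_remove[OF infinite_UNIV_char_0[where 'a = complex], of 0]
    by (simp add: set_diff_eq)
  then have "infinite {w. poly (det (pencil d C B) - [:c:]) w = 0}" using sub finite_subset by blast
  then have "det (pencil d C B) - [:c:] = 0" using poly_roots_finite by blast
  then have "poly (det (pencil d C B)) 0 = c" by simp
  then have "det (0 \<cdot>\<^sub>m C + B) = c" unfolding poly_det_pencil[OF C B] .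
  moreover have "0 \<cdot>\<^sub>m C + B = B" using B C by (intro eq_matI) auto
  ultimately show ?thesis using c by simp
qed

text \<open>Turns a row of the linear system for the coefficients of a polynomial vector, with unknowns indexed by power and
entry, into the form of \<open>pencil_coeff\<close>.\<close>

lemma sum_shifted_pairs:
  fixes \<zeta> :: "nat \<times> nat \<Rightarrow> complex"
  assumes j: "j \<le> k"
  shows "(\<Sum>p\<in>{..<k} \<times> {..<d}. ((if Suc (fst p) = j then b (snd p) else 0) +
      (if fst p = j then c (snd p) else 0)) * \<zeta> p) =
    (\<Sum>x<d. b x * (if 1 \<le> j then \<zeta> (j - 1, x) else 0) + c x * (if j < k then \<zeta> (j, x) else 0))"
proof -
  have "(\<Sum>p\<in>{..<k} \<times> {..<d}. ((if Suc (fst p) = j then b (snd p) else 0) +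
      (if fst p = j then c (snd p) else 0)) * \<zeta> p) =
    (\<Sum>i<k. \<Sum>x<d. ((if Suc i = j then b x else 0) + (if i = j then c x else 0)) * \<zeta> (i,x))"
    by (simp add: sum.cartesian_product case_prod_beta)
  also have "\<dots> = (\<Sum>x<d. \<Sum>i<k. ((if Suc i = j then b x else 0) + (if i = j then c x else 0)) * \<zeta> (i,x))"
    by (rule sum.swap)
  also have "\<dots> = (\<Sum>x<d. b x * (if 1 \<le> j then \<zeta> (j - 1, x) else 0) + c x * (if j < k then \<zeta> (j, x) else 0))"
  proof (rule sum.cong[OF refl])
    fix x
    have "(\<Sum>i<k. ((if Suc i = j then b x else 0) + (if i = j then c x else 0)) * \<zeta> (i,x)) =
        (\<Sum>i<k. (if i = j - 1 then (if 1 \<le> j then b x * \<zeta> (i,x) else 0) else 0) + (if i = j then c x * \<zeta> (i,x) else 0))"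
      by (rule sum.cong[OF refl]) (cases j, auto)
    also have "\<dots> = b x * (if 1 \<le> j then \<zeta> (j - 1, x) else 0) + c x * (if j < k then \<zeta> (j, x) else 0)"
      unfolding sum.distrib using j by (cases j) (auto simp: sum.delta)
    finally show "(\<Sum>i<k. ((if Suc i = j then b x else 0) + (if i = j then c x else 0)) * \<zeta> (i,x)) =
        b x * (if 1 \<le> j then \<zeta> (j - 1, x) else 0) + c x * (if j < k then \<zeta> (j, x) else 0)" .
  qed
  finally show ?thesis .
qed

lemma small_scalar_avoiding:
  assumes "finite F" "0 < \<delta>"
  obtains s :: complex where "cmod s < \<delta>" "s \<notin> F"
proof -
  have "infinite (complex_of_real ` {0<..<\<delta>})"
    using assms(2) finite_imageD[of complex_of_real "{0<..<\<delta>}"] infinite_Ioo[of 0 \<delta>] inj_of_real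
    by (meson inj_on_subset subset_UNIV)
  then obtain s where "s \<in> complex_of_real ` {0<..<\<delta>}" "s \<notin> F"
    using assms(1) by (meson finite_subset subsetI)
  then show ?thesis by (intro that[of s]) auto
qed

context
  fixes n k :: nat and A :: "nat \<Rightarrow> complex mat"
  assumes k: "1 \<le> k" and n: "1 \<le> n"
begin

abbreviation (input) "cB \<equiv> companion_lead n k A"
abbreviation (input) "cC \<equiv> companion_const n k A"

lemma companion_carrier: "cB \<in> carrier_mat (k * n) (k * n)" "cC \<in> carrier_mat (k * n) (k * n)"
  by (simp_all add: companion_lead_def companion_const_def)

lemma low_row_less: "i < k - 1 \<Longrightarrow> a < n \<Longrightarrow> i * n + a < (k - 1) * n"
  by (rule block_index_less)

lemma low_less: "\<rho> < (k - 1) * n \<Longrightarrow> \<rho> + n < k * n"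
  using k by (cases k) auto

lemma companion_low:
  assumes "\<rho> < (k - 1) * n"
  shows "pencil_coeff k (k * n) cB cC \<zeta> j \<rho> =
    (if 1 \<le> j then \<zeta> (j - 1) \<rho> else 0) - (if j < k then \<zeta> j (\<rho> + n) else 0)"
proof -
  have r: "\<rho> < k * n" "\<rho> + n < k * n" using low_less[OF assms] by auto
  have "pencil_coeff k (k * n) cB cC \<zeta> j \<rho> =
      (\<Sum>c<k * n. (if c = \<rho> then (if 1 \<le> j then \<zeta> (j - 1) c else 0) else 0) +
        (if c = \<rho> + n then - (if j < k then \<zeta> j c else 0) else 0))"
    unfolding pencil_coeff_def
    by (rule sum.cong[OF refl]) (use r assms in \<open>auto simp: companion_lead_def companion_const_def\<close>)
  then show ?thesis unfolding sum.distrib using r by simp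
qed

lemma companion_top:
  assumes a: "a < n"
  shows "pencil_coeff k (k * n) cB cC \<zeta> j ((k - 1) * n + a) =
    (\<Sum>b<n. A k $$ (a,b) * (if 1 \<le> j then \<zeta> (j - 1) ((k - 1) * n + b) else 0)) +
    (\<Sum>i<k. \<Sum>b<n. A i $$ (a,b) * (if j < k then \<zeta> j (i * n + b) else 0))"
proof -
  have t: "(k - 1) * n + a < k * n" by (rule block_index_less) (use k a in auto)
  have sd: "(\<Sum>i<k. if i = k - 1 then h i else 0) = h (k - 1)" for h :: "nat \<Rightarrow> complex"
    using k by (simp add: sum.delta)
  have "pencil_coeff k (k * n) cB cC \<zeta> j ((k - 1) * n + a) =
      (\<Sum>i<k. \<Sum>b<n. (if i = k - 1 then A k $$ (a,b) * (if 1 \<le> j then \<zeta> (j - 1) (i * n + b) else 0) else 0) +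
         A i $$ (a,b) * (if j < k then \<zeta> j (i * n + b) else 0))"
    unfolding pencil_coeff_def sum_blocks
  proof (intro sum.cong refl)
    fix i b assume ib: "i \<in> {..<k}" "b \<in> {..<n}"
    then have c: "i * n + b < k * n" by (intro block_index_less) auto
    have d: "(i * n + b) div n = i" "(i * n + b) mod n = b" using ib by auto
    show "cB $$ ((k - 1) * n + a, i * n + b) * (if 1 \<le> j then \<zeta> (j - 1) (i * n + b) else 0) +
        cC $$ ((k - 1) * n + a, i * n + b) * (if j < k then \<zeta> j (i * n + b) else 0) =
      (if i = k - 1 then A k $$ (a,b) * (if 1 \<le> j then \<zeta> (j - 1) (i * n + b) else 0) else 0) +
         A i $$ (a,b) * (if j < k then \<zeta> j (i * n + b) else 0)"
      using t c d unfolding companion_lead_def companion_const_def by simp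
  qed
  also have "\<dots> = (\<Sum>i<k. if i = k - 1 then \<Sum>b<n. A k $$ (a,b) * (if 1 \<le> j then \<zeta> (j - 1) (i * n + b) else 0) else 0) +
      (\<Sum>i<k. \<Sum>b<n. A i $$ (a,b) * (if j < k then \<zeta> j (i * n + b) else 0))"
    unfolding sum.distrib by (intro arg_cong2[of _ _ _ _ "(+)"] sum.cong refl) simp
  finally show ?thesis unfolding sd .
qed

text \<open>The upper block rows identify block \<open>i\<close> of the coefficient \<open>j - 1\<close> with block \<open>i + 1\<close> of the coefficient \<open>j\<close>.
Following such a diagonal leads either to block \<open>0\<close> of the coefficient \<open>0\<close>, which is normalized to zero, or to an
index out of range, where the coefficients are zero.\<close>

lemma companion_low_injective:
  assumes low: "\<And>j \<rho>. j \<le> k \<Longrightarrow> \<rho> < (k - 1) * n \<Longrightarrow> pencil_coeff k (k * n) cB cC \<zeta> j \<rho> = 0"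
    and norm: "\<And>a. a < n \<Longrightarrow> \<zeta> 0 a = 0" and j: "j < k" and c: "c < k * n"
  shows "\<zeta> j c = 0"
proof -
  have step: "(if 1 \<le> j then \<zeta> (j - 1) (i * n + a) else 0) = (if j < k then \<zeta> j (Suc i * n + a) else 0)"
    if "j \<le> k" "i < k - 1" "a < n" for i j a
    using low[OF that(1) low_row_less[OF that(2,3)]]
    unfolding companion_low[OF low_row_less[OF that(2,3)]] by (simp add: algebra_simps)
  have up: "\<zeta> j (i * n + a) = 0" if "i < j" "j < k" "a < n" for i j a
    using that
  proof (induction "k - j" arbitrary: i j)
    case 0
    then show ?case by simp
  next
    case (Suc l)
    show ?case
    proof (cases "Suc j = k")
      case True
      then have j: "j = k - 1" "i < k - 1" using Suc.prems(1) by auto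
      show ?thesis using step[OF order_refl j(2) Suc.prems(3)] k unfolding j(1) by simp
    next
      case False
      then have "\<zeta> j (i * n + a) = \<zeta> (Suc j) (Suc i * n + a)" using step[of "Suc j" i a] Suc.prems by simp
      also have "\<dots> = 0" by (rule Suc.hyps(1)) (use Suc.hyps(2) Suc.prems False in auto)
      finally show ?thesis .
    qed
  qed
  have down: "\<zeta> j (i * n + a) = 0" if "j \<le> i" "i < k" "a < n" for i j a
    using that
  proof (induction j arbitrary: i)
    case 0
    show ?case
    proof (cases i)
      case 0
      then show ?thesis using norm that(3) by simp
    next
      case (Suc i')
      then show ?thesis using step[of 0 i' a] 0 by simp
    qed
  next
    case (Suc j)
    then obtain i' where i': "i = Suc i'" by (cases i) auto
    then have "\<zeta> (Suc j) (i * n + a) = \<zeta> j (i' * n + a)" using step[of "Suc j" i' a] Suc.prems by simp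
    also have "\<dots> = 0" by (rule Suc.IH) (use Suc.prems i' in auto)
    finally show ?case .
  qed
  obtain i a where ia: "i < k" "a < n" "c = i * n + a" using c by (rule block_index_cases)
  show ?thesis using up[of i j a] down[of j i a] ia j by (cases "i < j") auto
qed

text \<open>The coefficient of \<open>z^j\<close> in column \<open>b\<close> of the stacked blocks \<open>(I, z I, ..., z^(k-1) I)\<close>.\<close>

definition lambda_block :: "nat \<Rightarrow> nat \<Rightarrow> nat \<Rightarrow> complex" where
  "lambda_block b j c = (if c = j * n + b then 1 else 0)"

lemma lambda_block_index:
  assumes "a < n" "b < n"
  shows "lambda_block b j (i * n + a) = (if i = j \<and> a = b then 1 else 0)"
proof -
  have "i = j \<and> a = b" if e: "i * n + a = j * n + b"
  proof -
    have "(i * n + a) div n = i" "(j * n + b) div n = j" using assms by auto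
    then show "i = j \<and> a = b" using e by simp
  qed
  then show ?thesis by (auto simp: lambda_block_def)
qed

lemma lambda_block_low:
  assumes b: "b < n" and j: "j \<le> k" and \<rho>: "\<rho> < (k - 1) * n"
  shows "pencil_coeff k (k * n) cB cC (lambda_block b) j \<rho> = 0"
proof -
  obtain i a where ia: "i < k - 1" "a < n" "\<rho> = i * n + a" using \<rho> by (rule block_index_cases)
  have "\<rho> + n = Suc i * n + a" using ia by simp
  then show ?thesis
    unfolding companion_low[OF \<rho>] using lambda_block_index[OF ia(2) b] ia(1) j
    by (simp only: ia(3)) (cases j; auto)
qed

lemma lambda_block_top:
  assumes a: "a < n" and b: "b < n" and j: "j \<le> k"
  shows "pencil_coeff k (k * n) cB cC (lambda_block b) j ((k - 1) * n + a) = A j $$ (a,b)"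
proof -
  have 1: "(\<Sum>b'<n. A k $$ (a,b') * (if 1 \<le> j then lambda_block b (j - 1) ((k - 1) * n + b') else 0)) =
      (\<Sum>b'<n. if b' = b then (if j = k then A k $$ (a,b') else 0) else 0)"
    by (rule sum.cong[OF refl]) (use k j b in \<open>auto simp: lambda_block_index\<close>)
  have 2: "(\<Sum>i<k. \<Sum>b'<n. A i $$ (a,b') * (if j < k then lambda_block b j (i * n + b') else 0)) =
      (\<Sum>i<k. if i = j then A i $$ (a,b) else 0)"
  proof (rule sum.cong[OF refl])
    fix i assume i: "i \<in> {..<k}"
    have "(\<Sum>b'<n. A i $$ (a,b') * (if j < k then lambda_block b j (i * n + b') else 0)) =
        (\<Sum>b'<n. if b' = b then (if i = j then A i $$ (a,b') else 0) else 0)"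
      by (rule sum.cong[OF refl]) (use i b in \<open>auto simp: lambda_block_index\<close>)
    then show "(\<Sum>b'<n. A i $$ (a,b') * (if j < k then lambda_block b j (i * n + b') else 0)) =
        (if i = j then A i $$ (a,b) else 0)" using b by (simp add: sum.delta)
  qed
  show ?thesis unfolding companion_top[OF a] 1 2 using b j by (simp add: sum.delta)
qed

lemma pencil_coeff_linear:
  "pencil_coeff k d B C (\<lambda>j c. \<Sum>b<n. \<zeta> b j c * u b) j \<rho> = (\<Sum>b<n. pencil_coeff k d B C (\<zeta> b) j \<rho> * u b)"
proof -
  have "(\<Sum>b<n. pencil_coeff k d B C (\<zeta> b) j \<rho> * u b) =
      (\<Sum>c<d. \<Sum>b<n. (B $$ (\<rho>,c) * (if 1 \<le> j then \<zeta> b (j - 1) c else 0) +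
        C $$ (\<rho>,c) * (if j < k then \<zeta> b j c else 0)) * u b)"
    unfolding pencil_coeff_def sum_distrib_right by (rule sum.swap)
  also have "\<dots> = pencil_coeff k d B C (\<lambda>j c. \<Sum>b<n. \<zeta> b j c * u b) j \<rho>"
    unfolding pencil_coeff_def
    by (rule sum.cong[OF refl], cases "1 \<le> j"; cases "j < k")
      (simp_all add: sum_distrib_left sum.distrib algebra_simps)
  finally show ?thesis by simp
qed

text \<open>A vector \<open>u\<close> in the kernel of the matrix polynomial at \<open>z\<close> gives the vector \<open>(u, z u, ..., z^(k-1) u)\<close> in the
kernel of the companion pencil at \<open>z\<close>.\<close>

lemma companion_singular:
  assumes sing: "\<And>z. det (eval_matpoly n k A z) = 0"
  shows "det (pencil (k * n) cB cC) = monom 0 (k * n)"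
proof -
  have "poly (det (pencil (k * n) cB cC)) z = 0" for z
  proof -
    let ?Q = "eval_matpoly n k A z"
    have Q: "?Q \<in> carrier_mat n n" by (simp add: eval_matpoly_def)
    obtain u where u: "u \<in> carrier_vec n" "u \<noteq> 0\<^sub>v n" "?Q *\<^sub>v u = 0\<^sub>v n"
      using sing[of z] det_0_iff_vec_prod_zero_field[OF Q] by blast
    let ?S = "z \<cdot>\<^sub>m cB + cC"
    have S: "?S \<in> carrier_mat (k * n) (k * n)" using companion_carrier by simp
    define \<zeta> where "\<zeta> j c = (\<Sum>b<n. lambda_block b j c * u $ b)" for j c
    define X where "X = vec (k * n) (\<lambda>c. \<Sum>j<k. z ^ j * \<zeta> j c)"
    have X: "X \<in> carrier_vec (k * n)" by (simp add: X_def)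
    have lin: "pencil_coeff k (k * n) cB cC \<zeta> j \<rho> =
        (\<Sum>b<n. pencil_coeff k (k * n) cB cC (lambda_block b) j \<rho> * u $ b)" for j \<rho>
      unfolding \<zeta>_def by (rule pencil_coeff_linear)
    have "(?S *\<^sub>v X) $ \<rho> = 0" if r: "\<rho> < k * n" for \<rho>
    proof -
      have "(?S *\<^sub>v X) $ \<rho> = (\<Sum>c<k * n. ?S $$ (\<rho>,c) * (\<Sum>j<k. z ^ j * \<zeta> j c))"
        unfolding mult_mat_vec_index[OF S X r] by (rule sum.cong) (auto simp: X_def)
      also have "\<dots> = (\<Sum>j\<le>k. z ^ j * pencil_coeff k (k * n) cB cC \<zeta> j \<rho>)"
        by (rule pencil_coeff_generating[OF companion_carrier r k, symmetric])
      also have "\<dots> = 0"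
      proof (cases "\<rho> < (k - 1) * n")
        case True
        then show ?thesis unfolding lin by (simp add: lambda_block_low)
      next
        case False
        define a where "a = \<rho> - (k - 1) * n"
        have kn: "k * n = (k - 1) * n + n" using k by (cases k) auto
        have a: "a < n" "\<rho> = (k - 1) * n + a" using False r kn by (auto simp: a_def)
        have "(\<Sum>j\<le>k. z ^ j * pencil_coeff k (k * n) cB cC \<zeta> j \<rho>) =
            (\<Sum>j\<le>k. \<Sum>b<n. z ^ j * A j $$ (a,b) * u $ b)"
          unfolding lin a(2) sum_distrib_left
          by (intro sum.cong refl) (simp add: lambda_block_top[OF a(1)] del: One_nat_def)
        also have "\<dots> = (\<Sum>b<n. ?Q $$ (a,b) * u $ b)"
          by (subst sum.swap) (auto intro!: sum.cong simp: eval_matpoly_def a(1) sum_distrib_right)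
        also have "\<dots> = 0" using mult_mat_vec_index[OF Q u(1) a(1)] u(3) a(1) by simp
        finally show ?thesis .
      qed
      finally show ?thesis .
    qed
    then have S0: "?S *\<^sub>v X = 0\<^sub>v (k * n)" using S by (intro eq_vecI) auto
    have "X \<noteq> 0\<^sub>v (k * n)"
    proof
      assume X0: "X = 0\<^sub>v (k * n)"
      have "u $ b = 0" if b: "b < n" for b
      proof -
        have bk: "b < k * n" using block_index_less[of 0 k b n] k b by simp
        have "X $ b = (\<Sum>j<k. if j = 0 then u $ b else 0)"
        proof -
          have "z ^ j * \<zeta> j b = (if j = 0 then u $ b else 0)" if "j < k" for j
          proof -
            have "\<zeta> j b = (\<Sum>b'<n. if b' = b then (if j = 0 then u $ b' else 0) else 0)"
              unfolding \<zeta>_def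
              by (rule sum.cong) (use b lambda_block_index[OF b, where i = 0] in auto)
            then show ?thesis using b by (simp add: sum.delta)
          qed
          then show ?thesis unfolding X_def using bk by (auto intro!: sum.cong)
        qed
        then show ?thesis using X0 bk k by simp
      qed
      then show False using u(1,2) by (metis carrier_vecD eq_vecI index_zero_vec)
    qed
    then have "det ?S = 0" using det_0_iff_vec_prod_zero_field[OF S] X S0 by blast
    then show ?thesis using poly_det_pencil[OF companion_carrier] by simp
  qed
  then have "det (pencil (k * n) cB cC) = 0" using poly_all_0_iff_0 by blast
  then show ?thesis by simp
qed

text \<open>That a polynomial vector of degree below \<open>k\<close> lies in the kernel of the upper \<open>k - 1\<close> block rows is expressed by
\<open>(k + 1) (k - 1) n\<close> linear equations for its \<open>k k n\<close> coefficients. Together with \<open>n\<close> equations that fix the first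
block of the constant coefficient the system is square, and by \<open>companion_low_injective\<close> it is injective at
\<open>s = 0\<close>. Hence its solution \<open>lambda_block\<close> persists under small perturbations of the leading matrix.\<close>

lemma companion_kernel_stable:
  assumes G: "G \<in> carrier_mat (k * n) (k * n)" and eps: "0 < \<epsilon>" and b: "b < n"
  shows "\<exists>\<delta>>0. \<forall>s. cmod s < \<delta> \<longrightarrow> (\<exists>Z.
    (\<forall>j\<le>k. \<forall>\<rho><(k - 1) * n. pencil_coeff k (k * n) (cB + s \<cdot>\<^sub>m G) (cC) Z j \<rho> = 0) \<and>
    (\<forall>j<k. \<forall>c<k * n. cmod (Z j c - lambda_block b j c) < \<epsilon>))"
proof -
  \<comment> \<open>the tag \<open>Suc k\<close> marks the normalizing equations; the other equations are pairs of power and row\<close>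
  define I where "I = {..k} \<times> {..<(k - 1) * n} \<union> {Suc k} \<times> {..<n}"
  define J where "J = {..<k} \<times> {..<k * n}"
  define m where "m i p = (if fst i = Suc k then (if fst p = 0 \<and> snd p = snd i then 1 else 0)
    else (if Suc (fst p) = fst i then cB $$ (snd i, snd p) else 0) +
      (if fst p = fst i then cC $$ (snd i, snd p) else 0))" for i p :: "nat \<times> nat"
  define g where "g i p = (if fst i = Suc k then 0 else if Suc (fst p) = fst i then G $$ (snd i, snd p) else 0)"
    for i p :: "nat \<times> nat"
  have lowk: "\<rho> < k * n" if "\<rho> < (k - 1) * n" for \<rho>
    using low_less[OF that] by simp
  have sum_s: "(\<Sum>p\<in>J. (m (j,\<rho>) p + s * g (j,\<rho>) p) * \<zeta> p) =
      pencil_coeff k (k * n) (cB + s \<cdot>\<^sub>m G) (cC) (\<lambda>j c. \<zeta> (j,c)) j \<rho>"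
    if j: "j \<le> k" and r: "\<rho> < (k - 1) * n" for j \<rho> s \<zeta>
  proof -
    have "(\<Sum>p\<in>J. (m (j,\<rho>) p + s * g (j,\<rho>) p) * \<zeta> p) =
      (\<Sum>p\<in>J. ((if Suc (fst p) = j then cB $$ (\<rho>, snd p) + s * G $$ (\<rho>, snd p) else 0) +
        (if fst p = j then cC $$ (\<rho>, snd p) else 0)) * \<zeta> p)"
      by (rule sum.cong[OF refl]) (use j in \<open>auto simp: m_def g_def\<close>)
    also have "\<dots> = (\<Sum>x<k * n. (cB $$ (\<rho>, x) + s * G $$ (\<rho>, x)) * (if 1 \<le> j then \<zeta> (j - 1, x) else 0) +
        cC $$ (\<rho>, x) * (if j < k then \<zeta> (j, x) else 0))"
      unfolding J_def by (rule sum_shifted_pairs[OF j, where d = "k * n" and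
        b = "\<lambda>x. cB $$ (\<rho>, x) + s * G $$ (\<rho>, x)"])
    also have "\<dots> = pencil_coeff k (k * n) (cB + s \<cdot>\<^sub>m G) (cC) (\<lambda>j c. \<zeta> (j,c)) j \<rho>"
      unfolding pencil_coeff_def
      by (rule sum.cong[OF refl]) (use lowk[OF r] G companion_carrier in auto)
    finally show ?thesis .
  qed
  have cB0: "cB + 0 \<cdot>\<^sub>m G = cB" using G companion_carrier by (intro eq_matI) auto
  have sum_0: "(\<Sum>p\<in>J. m (j,\<rho>) p * \<zeta> p) = pencil_coeff k (k * n) (cB) (cC) (\<lambda>j c. \<zeta> (j,c)) j \<rho>"
    if "j \<le> k" "\<rho> < (k - 1) * n" for j \<rho> \<zeta>
    using sum_s[OF that, of 0 \<zeta>] unfolding cB0 by simp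
  have sum_n: "(\<Sum>p\<in>J. m (Suc k,a) p * \<zeta> p) = \<zeta> (0,a)" if a: "a < n" for a \<zeta>
  proof -
    have ak: "a < k * n" using block_index_less[of 0 k a n] k a by simp
    have "(\<Sum>p\<in>J. m (Suc k,a) p * \<zeta> p) = (\<Sum>p\<in>J. if p = (0,a) then \<zeta> p else 0)"
      by (rule sum.cong[OF refl]) (auto simp: m_def prod_eq_iff)
    then show ?thesis using ak k by (simp add: J_def)
  qed
  have fin: "finite I" "finite J" by (auto simp: I_def J_def)
  have card: "card I = card J"
  proof -
    obtain k' where k': "k = Suc k'" using k by (cases k) auto
    have "card I = card ({..k} \<times> {..<(k - 1) * n}) + card ({Suc k} \<times> {..<n})"
      unfolding I_def by (rule card_Un_disjoint) auto
    then show ?thesis by (simp add: J_def card_cartesian_product k' algebra_simps)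
  qed
  have inj: "\<zeta> p = 0" if z: "\<And>i. i \<in> I \<Longrightarrow> (\<Sum>p\<in>J. m i p * \<zeta> p) = 0" and p: "p \<in> J" for \<zeta> p
  proof -
    have "\<zeta> (fst p, snd p) = 0"
    proof (rule companion_low_injective[of "\<lambda>j c. \<zeta> (j,c)"])
      show "pencil_coeff k (k * n) (cB) (cC) (\<lambda>j c. \<zeta> (j,c)) j \<rho> = 0" if "j \<le> k" "\<rho> < (k - 1) * n" for j \<rho>
        unfolding sum_0[OF that, symmetric] by (rule z) (use that in \<open>auto simp: I_def\<close>)
      show "\<zeta> (0,a) = 0" if "a < n" for a
        unfolding sum_n[OF that, of \<zeta>, symmetric] by (rule z) (use that in \<open>auto simp: I_def\<close>)
    qed (use p in \<open>auto simp: J_def\<close>)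
    then show ?thesis by simp
  qed
  have inj': "\<forall>\<zeta>. (\<forall>i\<in>I. (\<Sum>p\<in>J. m i p * \<zeta> p) = 0) \<longrightarrow> (\<forall>p\<in>J. \<zeta> p = 0)"
    by (intro allI impI ballI, rule inj) auto
  obtain \<delta> where \<delta>: "0 < \<delta>" "\<And>s. cmod s < \<delta> \<Longrightarrow>
    \<exists>\<zeta>. (\<forall>i\<in>I. (\<Sum>p\<in>J. (m i p + s * g i p) * \<zeta> p) = (\<Sum>p\<in>J. m i p * lambda_block b (fst p) (snd p))) \<and>
      (\<forall>p\<in>J. cmod (\<zeta> p - lambda_block b (fst p) (snd p)) < \<epsilon>)"
    using stable_solve[where m = m and g = g and ?\<zeta>0.0 = "\<lambda>p. lambda_block b (fst p) (snd p)", OF fin card inj' eps]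
    by blast
  have "\<exists>Z. (\<forall>j\<le>k. \<forall>\<rho><(k - 1) * n. pencil_coeff k (k * n) (cB + s \<cdot>\<^sub>m G) (cC) Z j \<rho> = 0) \<and>
    (\<forall>j<k. \<forall>c<k * n. cmod (Z j c - lambda_block b j c) < \<epsilon>)" if s: "cmod s < \<delta>" for s
  proof -
    obtain \<zeta> where \<zeta>: "\<And>i. i \<in> I \<Longrightarrow> (\<Sum>p\<in>J. (m i p + s * g i p) * \<zeta> p) = (\<Sum>p\<in>J. m i p * lambda_block b (fst p) (snd p))"
      "\<And>p. p \<in> J \<Longrightarrow> cmod (\<zeta> p - lambda_block b (fst p) (snd p)) < \<epsilon>"
      using \<delta>(2)[OF s] by blast
    have "pencil_coeff k (k * n) (cB + s \<cdot>\<^sub>m G) (cC) (\<lambda>j c. \<zeta> (j,c)) j \<rho> = 0"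
      if jr: "j \<le> k" "\<rho> < (k - 1) * n" for j \<rho>
    proof -
      have "(j,\<rho>) \<in> I" using jr by (simp add: I_def)
      from \<zeta>(1)[OF this] show ?thesis
        unfolding sum_s[OF jr] sum_0[OF jr] by (simp add: lambda_block_low[OF b jr])
    qed
    moreover have "cmod (\<zeta> (j,c) - lambda_block b j c) < \<epsilon>" if "j < k" "c < k * n" for j c
      using \<zeta>(2)[of "(j,c)"] that by (simp add: J_def)
    ultimately show ?thesis by (intro exI[of _ "\<lambda>j c. \<zeta> (j,c)"]) blast
  qed
  then show ?thesis using \<delta>(1) by blast
qed

text \<open>Perturb the companion pencil to \<open>z B + C\<close> with determinant \<open>c z^(k n)\<close>, \<open>c \<noteq> 0\<close>, and let the columns of \<open>Z(z)\<close>
be polynomial kernel vectors of its upper block rows near \<open>(I, z I, ..., z^(k-1) I)\<close>. The new matrix polynomial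
\<open>A'(z)\<close> is the last block row applied to \<open>Z(z)\<close>; it is near \<open>A(z)\<close>, as \<open>A(z)\<close> arises in the same way before the
perturbation. If \<open>A'(z) u = 0\<close>, then \<open>Z(z) u\<close> is in the kernel of \<open>z B + C\<close>, so it is zero for \<open>z \<noteq> 0\<close>, and then
\<open>u = 0\<close>, since the coefficient vectors of \<open>Z\<close> form a matrix near the identity. Likewise a kernel vector of the
leading coefficient of \<open>A'\<close> leads to one of \<open>B\<close>, which is invertible.\<close>

theorem singular_matpoly_approx:
  assumes sing: "\<And>z. det (eval_matpoly n k A z) = 0" and eps: "0 < \<epsilon>"
  shows "\<exists>A'. (\<forall>i\<le>k. \<forall>a<n. \<forall>b<n. cmod (A' i $$ (a,b) - A i $$ (a,b)) < \<epsilon>) \<and>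
    (\<forall>i. A' i \<in> carrier_mat n n) \<and> det (A' k) \<noteq> 0 \<and> (\<forall>z. z \<noteq> 0 \<longrightarrow> det (eval_matpoly n k A' z) \<noteq> 0)"
proof -
  define d where "d = k * n"
  note car = companion_carrier[folded d_def]
  have d0: "0 < d" using k n by (simp add: d_def)
  have topd: "(k - 1) * n + a < d" if "a < n" for a
    unfolding d_def by (rule block_index_less) (use k that in auto)
  obtain G F where G: "G \<in> carrier_mat d d" and F: "finite F"
    and reg: "\<And>s. s \<notin> F \<Longrightarrow> \<exists>c'. c' \<noteq> 0 \<and> (\<forall>z. det (z \<cdot>\<^sub>m (cB + s \<cdot>\<^sub>m G) + cC) = c' * z ^ d)"
    using pencil_regularize[OF car companion_singular[OF sing, folded d_def]] by blast
  define M where "M = (\<Sum>\<rho><d. \<Sum>c<d. cmod (cB $$ (\<rho>,c)) + cmod (G $$ (\<rho>,c)) + cmod (cC $$ (\<rho>,c))) + 1"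
  have M1: "(\<Sum>c<d. cmod (cB $$ (\<rho>,c)) + cmod (G $$ (\<rho>,c)) + cmod (cC $$ (\<rho>,c))) \<le> M - 1" if "\<rho> < d" for \<rho>
    unfolding M_def
    using member_le_sum[of \<rho> "{..<d}" "\<lambda>\<rho>. \<Sum>c<d. cmod (cB $$ (\<rho>,c)) + cmod (G $$ (\<rho>,c)) + cmod (cC $$ (\<rho>,c))"] that
    by (simp add: sum_nonneg)
  have Mpos: "0 < M" unfolding M_def by (intro add_nonneg_pos sum_nonneg) auto
  define e where "e = min (1 / (2 * real d)) (\<epsilon> / M)"
  have e: "0 < e" "real d * e \<le> 1 / 2" "M * e \<le> \<epsilon>" "e \<le> 1"
  proof -
    show "0 < e" using d0 eps Mpos by (simp add: e_def)
    have "e \<le> 1 / (2 * real d)" "e \<le> \<epsilon> / M" by (auto simp: e_def)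
    then show 1: "real d * e \<le> 1 / 2" and "M * e \<le> \<epsilon>" using d0 Mpos by (auto simp: field_simps)
    have "1 * e \<le> real d * e" using d0 \<open>0 < e\<close> by (intro mult_right_mono) auto
    then show "e \<le> 1" using 1 by simp
  qed
  have "\<forall>b. \<exists>\<delta>. b < n \<longrightarrow> 0 < \<delta> \<and> (\<forall>s. cmod s < \<delta> \<longrightarrow> (\<exists>Z.
    (\<forall>j\<le>k. \<forall>\<rho><(k - 1) * n. pencil_coeff k d (cB + s \<cdot>\<^sub>m G) (cC) Z j \<rho> = 0) \<and>
    (\<forall>j<k. \<forall>c<d. cmod (Z j c - lambda_block b j c) < e)))"
    using companion_kernel_stable[OF G[unfolded d_def] e(1), folded d_def] by blast
  then obtain \<delta> where \<delta>: "\<And>b. b < n \<Longrightarrow> 0 < \<delta> b" "\<And>b s. b < n \<Longrightarrow> cmod s < \<delta> b \<Longrightarrow> \<exists>Z.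
    (\<forall>j\<le>k. \<forall>\<rho><(k - 1) * n. pencil_coeff k d (cB + s \<cdot>\<^sub>m G) (cC) Z j \<rho> = 0) \<and>
    (\<forall>j<k. \<forall>c<d. cmod (Z j c - lambda_block b j c) < e)"
    by metis
  define \<delta>0 where "\<delta>0 = Min (insert (e / 2) (\<delta> ` {..<n}))"
  have "0 < \<delta>0" unfolding \<delta>0_def using \<delta>(1) e(1) by (subst Min_gr_iff) auto
  then obtain s where s: "cmod s < \<delta>0" "s \<notin> F" by (rule small_scalar_avoiding[OF F]) (rule that)
  have se: "cmod s < e / 2"
    using s(1) Min_le[of "insert (e / 2) (\<delta> ` {..<n})" "e / 2"] by (simp add: \<delta>0_def)
  have s\<delta>: "cmod s < \<delta> b" if "b < n" for b
    using s(1) Min_le[of "insert (e / 2) (\<delta> ` {..<n})" "\<delta> b"] that by (simp add: \<delta>0_def)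
  define B where "B = cB + s \<cdot>\<^sub>m G"
  have B: "B \<in> carrier_mat d d" using car G by (simp add: B_def)
  have Bi: "B $$ (\<rho>,c) = cB $$ (\<rho>,c) + s * G $$ (\<rho>,c)" if "\<rho> < d" "c < d" for \<rho> c
    unfolding B_def using car G that by simp
  obtain c' where c': "c' \<noteq> 0" "\<And>z. det (z \<cdot>\<^sub>m B + cC) = c' * z ^ d"
    using reg[OF s(2)] unfolding B_def by blast
  have detB: "det B \<noteq> 0" by (rule det_lead_of_pencil[OF B car(2) c'(2,1)])
  have "\<forall>b. \<exists>Z. b < n \<longrightarrow> (\<forall>j\<le>k. \<forall>\<rho><(k - 1) * n. pencil_coeff k d B (cC) Z j \<rho> = 0) \<and>
    (\<forall>j<k. \<forall>c<d. cmod (Z j c - lambda_block b j c) < e)"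
    using \<delta>(2)[OF _ s\<delta>] unfolding B_def by blast
  then obtain Z where Zlow: "\<And>b j \<rho>. b < n \<Longrightarrow> j \<le> k \<Longrightarrow> \<rho> < (k - 1) * n \<Longrightarrow> pencil_coeff k d B (cC) (Z b) j \<rho> = 0"
    and Zn: "\<And>b j c. b < n \<Longrightarrow> j < k \<Longrightarrow> c < d \<Longrightarrow> cmod (Z b j c - lambda_block b j c) < e"
    by metis
  define A' where "A' j = mat n n (\<lambda>(a,b). pencil_coeff k d B (cC) (Z b) j ((k - 1) * n + a))" for j
  have A'c: "A' j \<in> carrier_mat n n" for j by (simp add: A'_def)
  have rows: "(\<Sum>b<n. pencil_coeff k d B (cC) (Z b) j \<rho> * u b) =
      (if \<rho> < (k - 1) * n then 0 else (\<Sum>b<n. A' j $$ (\<rho> - (k - 1) * n,b) * u b))"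
    if j: "j \<le> k" and r: "\<rho> < d" for j \<rho> u
  proof (cases "\<rho> < (k - 1) * n")
    case True
    then show ?thesis using Zlow j by simp
  next
    case False
    have kn: "d = (k - 1) * n + n" using k by (cases k) (auto simp: d_def)
    have "\<rho> - (k - 1) * n < n" "\<rho> = (k - 1) * n + (\<rho> - (k - 1) * n)" using False r kn by auto
    then show ?thesis using False by (simp add: A'_def)
  qed
  \<comment> \<open>the coefficient vectors of the kernel form a matrix close to the identity\<close>
  have V: "\<eta> l = 0" if v: "\<And>c. c < d \<Longrightarrow> (\<Sum>c'<d. Z (c' mod n) (c' div n) c * \<eta> c') = 0" and l: "l < d" for \<eta> l
  proof -
    define X where "X c c' = Z (c' mod n) (c' div n) c - (if c = c' then 1 else 0)" for c c'
    have "cmod (\<eta> l) \<le> 2 * 0"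
    proof (rule near_identity_bound[of d X \<eta> "\<lambda>_. 0"])
      fix c assume c: "c < d"
      have "(\<Sum>c'<d. cmod (X c c')) \<le> (\<Sum>c'<d. e)"
      proof (rule sum_mono)
        fix c' assume "c' \<in> {..<d}"
        then have "c' < k * n" by (simp add: d_def)
        then obtain i a where ia: "i < k" "a < n" "c' = i * n + a" by (rule block_index_cases)
        then have "lambda_block (c' mod n) (c' div n) c = (if c = c' then 1 else 0)"
          by (simp add: lambda_block_def)
        then show "cmod (X c c') \<le> e" using Zn[of "c' mod n" "c' div n" c] ia c by (simp add: X_def)
      qed
      then show "(\<Sum>c'<d. cmod (X c c')) \<le> 1 / 2" using e(2) by simp
      have "(\<Sum>c'<d. X c c' * \<eta> c') = (\<Sum>c'<d. Z (c' mod n) (c' div n) c * \<eta> c' - (if c' = c then \<eta> c' else 0))"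
        by (rule sum.cong) (auto simp: X_def algebra_simps)
      also have "\<dots> = - \<eta> c" unfolding sum_subtractf v[OF c] using c by simp
      finally show "\<eta> c + (\<Sum>c'<d. X c c' * \<eta> c') = 0" by simp
    qed (use l in auto)
    then show ?thesis by simp
  qed
  have near: "cmod (A' j $$ (a,b) - A j $$ (a,b)) < \<epsilon>" if j: "j \<le> k" and ab: "a < n" "b < n" for j a b
  proof -
    let ?\<rho> = "(k - 1) * n + a"
    define x where "x c = (if 1 \<le> j then Z b (j - 1) c else 0)" for c
    define y where "y c = (if j < k then Z b j c else 0)" for c
    define x0 where "x0 c = (if 1 \<le> j then lambda_block b (j - 1) c else 0)" for c
    define y0 where "y0 c = (if j < k then lambda_block b j c else 0)" for c
    have x: "cmod (x c - x0 c) \<le> e" and y: "cmod (y c - y0 c) \<le> e" if "c < d" for c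
      using Zn[OF ab(2) _ that, of "j - 1"] Zn[OF ab(2) _ that, of j] j k e(1) that
      by (auto simp: x_def y_def x0_def y0_def intro: less_imp_le)
    have x0: "cmod (x0 c) \<le> 1" for c by (simp add: x0_def lambda_block_def)
    have "A' j $$ (a,b) - A j $$ (a,b) = pencil_coeff k d B (cC) (Z b) j ?\<rho> - pencil_coeff k d (cB) (cC) (lambda_block b) j ?\<rho>"
      using lambda_block_top[OF ab j, folded d_def] ab by (simp add: A'_def)
    also have "\<dots> = (\<Sum>c<d. cB $$ (?\<rho>,c) * (x c - x0 c) + s * G $$ (?\<rho>,c) * x c + cC $$ (?\<rho>,c) * (y c - y0 c))"
      unfolding pencil_coeff_def sum_subtractf[symmetric]
    proof (rule sum.cong[OF refl])
      fix c assume "c \<in> {..<d}"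
      then have "B $$ (?\<rho>,c) = cB $$ (?\<rho>,c) + s * G $$ (?\<rho>,c)" using Bi[OF topd[OF ab(1)]] by simp
      then show "B $$ (?\<rho>,c) * (if 1 \<le> j then Z b (j - 1) c else 0) + cC $$ (?\<rho>,c) * (if j < k then Z b j c else 0) -
          (cB $$ (?\<rho>,c) * (if 1 \<le> j then lambda_block b (j - 1) c else 0) + cC $$ (?\<rho>,c) * (if j < k then lambda_block b j c else 0)) =
          cB $$ (?\<rho>,c) * (x c - x0 c) + s * G $$ (?\<rho>,c) * x c + cC $$ (?\<rho>,c) * (y c - y0 c)"
        unfolding x_def[symmetric] y_def[symmetric] x0_def[symmetric] y0_def[symmetric] by (simp add: algebra_simps)
    qed
    finally have diff: "A' j $$ (a,b) - A j $$ (a,b) = (\<Sum>c<d. cB $$ (?\<rho>,c) * (x c - x0 c) +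
        s * G $$ (?\<rho>,c) * x c + cC $$ (?\<rho>,c) * (y c - y0 c))" .
    have "cmod (A' j $$ (a,b) - A j $$ (a,b)) \<le> (\<Sum>c<d. (cmod (cB $$ (?\<rho>,c)) + cmod (G $$ (?\<rho>,c)) + cmod (cC $$ (?\<rho>,c))) * e)"
      unfolding diff
    proof (rule sum_norm_le)
      fix c assume "c \<in> {..<d}"
      then have c: "c < d" by simp
      have "cmod (x c) \<le> cmod (x c - x0 c) + cmod (x0 c)" using norm_triangle_ineq[of "x c - x0 c" "x0 c"] by simp
      then have xc: "cmod (x c) \<le> 2" using x[OF c] x0[of c] e(4) by linarith
      have "cmod s * cmod (x c) \<le> e / 2 * 2" using se xc e(1) by (intro mult_mono) auto
      then have sx: "cmod (s * x c) \<le> e" by (simp add: norm_mult)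
      have tri: "cmod (p + q + r) \<le> cmod p + cmod q + cmod r" for p q r :: complex
        using norm_triangle_ineq[of "p + q" r] norm_triangle_ineq[of p q] by linarith
      have sG: "s * G $$ (?\<rho>,c) * x c = G $$ (?\<rho>,c) * (s * x c)" by simp
      have "cmod (cB $$ (?\<rho>,c) * (x c - x0 c) + s * G $$ (?\<rho>,c) * x c + cC $$ (?\<rho>,c) * (y c - y0 c)) \<le>
          cmod (cB $$ (?\<rho>,c) * (x c - x0 c)) + cmod (G $$ (?\<rho>,c) * (s * x c)) + cmod (cC $$ (?\<rho>,c) * (y c - y0 c))"
        unfolding sG by (rule tri)
      also have "\<dots> \<le> cmod (cB $$ (?\<rho>,c)) * e + cmod (G $$ (?\<rho>,c)) * e + cmod (cC $$ (?\<rho>,c)) * e"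
        unfolding norm_mult[of "cB $$ (?\<rho>,c)"] norm_mult[of "G $$ (?\<rho>,c)"] norm_mult[of "cC $$ (?\<rho>,c)"]
        by (intro add_mono mult_left_mono x[OF c] y[OF c] sx norm_ge_zero)
      finally show "cmod (cB $$ (?\<rho>,c) * (x c - x0 c) + s * G $$ (?\<rho>,c) * x c + cC $$ (?\<rho>,c) * (y c - y0 c)) \<le>
          (cmod (cB $$ (?\<rho>,c)) + cmod (G $$ (?\<rho>,c)) + cmod (cC $$ (?\<rho>,c))) * e" by (simp add: algebra_simps)
    qed
    also have "\<dots> \<le> (M - 1) * e"
      unfolding sum_distrib_right[symmetric] by (rule mult_right_mono[OF M1[OF topd[OF ab(1)]] less_imp_le[OF e(1)]])
    also have "\<dots> < \<epsilon>" using e(1,3) unfolding left_diff_distrib by linarith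
    finally show ?thesis .
  qed
  have ker0: "u = 0\<^sub>v n" if u: "u \<in> carrier_vec n" and \<eta>: "\<And>b. b < n \<Longrightarrow> \<exists>l<d. \<eta> l = u $ b"
    and v: "\<And>c. c < d \<Longrightarrow> (\<Sum>c'<d. Z (c' mod n) (c' div n) c * \<eta> c') = 0" for u \<eta>
  proof (rule eq_vecI)
    fix b assume "b < dim_vec (0\<^sub>v n)"
    then have "b < n" by simp
    then obtain l where "l < d" "\<eta> l = u $ b" using \<eta> by blast
    then show "u $ b = 0\<^sub>v n $ b" using V[OF v] \<open>b < n\<close> by simp
  qed (use u in simp)
  have zero_of: "y c = 0" if S: "S \<in> carrier_mat d d" "det S \<noteq> 0"
    and Sy: "\<And>\<rho>. \<rho> < d \<Longrightarrow> (\<Sum>c<d. S $$ (\<rho>,c) * y c) = 0" and c: "c < d" for S :: "complex mat" and y :: "nat \<Rightarrow> complex" and c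
  proof -
    have yv: "vec d y \<in> carrier_vec d" by simp
    have "S *\<^sub>v vec d y = 0\<^sub>v d"
    proof (rule eq_vecI)
      fix i assume "i < dim_vec (0\<^sub>v d)"
      then have i: "i < d" by simp
      show "(S *\<^sub>v vec d y) $ i = 0\<^sub>v d $ i"
        unfolding mult_mat_vec_index[OF S(1) yv i] using Sy[OF i] i by simp
    qed (use S in simp)
    then have "vec d y = 0\<^sub>v d" using det_0_iff_vec_prod_zero_field[OF S(1)] S(2) yv by blast
    then show ?thesis using c by (metis index_vec index_zero_vec(1))
  qed
  have det_ev: "det (eval_matpoly n k A' z) \<noteq> 0" if z: "z \<noteq> 0" for z
  proof
    let ?Q = "eval_matpoly n k A' z"
    have Q: "?Q \<in> carrier_mat n n" by (simp add: eval_matpoly_def)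
    assume "det ?Q = 0"
    then obtain u where u: "u \<in> carrier_vec n" "u \<noteq> 0\<^sub>v n" "?Q *\<^sub>v u = 0\<^sub>v n"
      using det_0_iff_vec_prod_zero_field[OF Q] by blast
    define y where "y c = (\<Sum>j<k. z ^ j * (\<Sum>b<n. Z b j c * u $ b))" for c
    have S: "z \<cdot>\<^sub>m B + cC \<in> carrier_mat d d" using B car by simp
    have "(\<Sum>c<d. (z \<cdot>\<^sub>m B + cC) $$ (\<rho>,c) * y c) = 0" if r: "\<rho> < d" for \<rho>
    proof -
      have "(\<Sum>c<d. (z \<cdot>\<^sub>m B + cC) $$ (\<rho>,c) * y c) =
          (\<Sum>j\<le>k. z ^ j * pencil_coeff k d B (cC) (\<lambda>j c. \<Sum>b<n. Z b j c * u $ b) j \<rho>)"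
        unfolding y_def by (rule pencil_coeff_generating[OF B car(2) r k, symmetric])
      also have "\<dots> = (\<Sum>j\<le>k. z ^ j * (if \<rho> < (k - 1) * n then 0
          else \<Sum>b<n. A' j $$ (\<rho> - (k - 1) * n,b) * u $ b))"
        unfolding pencil_coeff_linear by (intro sum.cong refl) (use rows r in simp)
      also have "\<dots> = 0"
      proof (cases "\<rho> < (k - 1) * n")
        case False
        define a where "a = \<rho> - (k - 1) * n"
        have kn: "d = (k - 1) * n + n" using k by (cases k) (auto simp: d_def)
        have a: "a < n" using False r kn by (auto simp: a_def)
        have "(\<Sum>j\<le>k. z ^ j * (\<Sum>b<n. A' j $$ (a,b) * u $ b)) = (\<Sum>b<n. ?Q $$ (a,b) * u $ b)"
          unfolding sum_distrib_left
          by (subst sum.swap) (auto intro!: sum.cong simp: eval_matpoly_def a sum_distrib_right mult.assoc)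
        also have "\<dots> = 0" using mult_mat_vec_index[OF Q u(1) a] u(3) a by simp
        finally show ?thesis using False by (simp add: a_def)
      qed simp
      finally show ?thesis .
    qed
    then have y0: "y c = 0" if "c < d" for c
      using zero_of[OF S _ _ that] c' z by simp
    have "u = 0\<^sub>v n"
    proof (rule ker0[OF u(1), where \<eta> = "\<lambda>l. z ^ (l div n) * u $ (l mod n)"])
      show "\<exists>l<d. z ^ (l div n) * u $ (l mod n) = u $ b" if b: "b < n" for b
        using block_index_less[of 0 k b n] k b by (intro exI[of _ b]) (simp add: d_def)
      show "(\<Sum>c'<d. Z (c' mod n) (c' div n) c * (z ^ (c' div n) * u $ (c' mod n))) = 0" if c: "c < d" for c
      proof -
        have "(\<Sum>c'<d. Z (c' mod n) (c' div n) c * (z ^ (c' div n) * u $ (c' mod n))) =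
            (\<Sum>j<k. \<Sum>b<n. z ^ j * (Z b j c * u $ b))"
          unfolding d_def sum_blocks by (intro sum.cong refl) simp
        then show ?thesis using y0[OF c] by (simp add: y_def sum_distrib_left)
      qed
    qed
    then show False using u(2) by blast
  qed
  have det_lead: "det (A' k) \<noteq> 0"
  proof
    assume "det (A' k) = 0"
    then obtain u where u: "u \<in> carrier_vec n" "u \<noteq> 0\<^sub>v n" "A' k *\<^sub>v u = 0\<^sub>v n"
      using det_0_iff_vec_prod_zero_field[OF A'c] by blast
    define y where "y c = (\<Sum>b<n. Z b (k - 1) c * u $ b)" for c
    have "(\<Sum>c<d. B $$ (\<rho>,c) * y c) = 0" if r: "\<rho> < d" for \<rho>
    proof -
      have "(\<Sum>c<d. B $$ (\<rho>,c) * y c) = pencil_coeff k d B (cC) (\<lambda>j c. \<Sum>b<n. Z b j c * u $ b) k \<rho>"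
        unfolding pencil_coeff_def y_def using k by (intro sum.cong refl) simp
      also have "\<dots> = (if \<rho> < (k - 1) * n then 0 else \<Sum>b<n. A' k $$ (\<rho> - (k - 1) * n,b) * u $ b)"
        unfolding pencil_coeff_linear by (rule rows[OF order_refl r])
      also have "\<dots> = 0"
      proof (cases "\<rho> < (k - 1) * n")
        case False
        have kn: "d = (k - 1) * n + n" using k by (cases k) (auto simp: d_def)
        have a: "\<rho> - (k - 1) * n < n" using False r kn by auto
        have "(\<Sum>b<n. A' k $$ (\<rho> - (k - 1) * n,b) * u $ b) = 0"
          unfolding mult_mat_vec_index[OF A'c u(1) a, symmetric] u(3) using a by simp
        then show ?thesis using False by simp
      qed simp
      finally show ?thesis .
    qed
    then have y0: "y c = 0" if "c < d" for c
      using zero_of[OF B detB _ that] by simp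
    have "u = 0\<^sub>v n"
    proof (rule ker0[OF u(1), where \<eta> = "\<lambda>l. if l div n = k - 1 then u $ (l mod n) else 0"])
      show "\<exists>l<d. (if l div n = k - 1 then u $ (l mod n) else 0) = u $ b" if b: "b < n" for b
        using topd[OF b] b by (intro exI[of _ "(k - 1) * n + b"]) simp
      show "(\<Sum>c'<d. Z (c' mod n) (c' div n) c * (if c' div n = k - 1 then u $ (c' mod n) else 0)) = 0" if c: "c < d" for c
      proof -
        have "(\<Sum>c'<d. Z (c' mod n) (c' div n) c * (if c' div n = k - 1 then u $ (c' mod n) else 0)) =
            (\<Sum>j<k. if j = k - 1 then \<Sum>b<n. Z b j c * u $ b else 0)"
          unfolding d_def sum_blocks by (intro sum.cong refl) auto
        also have "\<dots> = y c" using k by (simp add: y_def sum.delta)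
        finally show ?thesis using y0[OF c] by simp
      qed
    qed
    then show False using u(2) by blast
  qed
  show ?thesis using near A'c det_lead det_ev by blast
qed

end

section \<open>Approximation by matrix polynomials with a root vector of high order\<close>

lemma coeff_prod_degree_bound:
  assumes "finite S" "\<And>i. i \<in> S \<Longrightarrow> degree (f i) \<le> k"
  shows "coeff (\<Prod>i\<in>S. f i :: complex poly) (card S * k) = (\<Prod>i\<in>S. coeff (f i) k) \<and>
    degree (\<Prod>i\<in>S. f i) \<le> card S * k"
  using assms
proof (induction S rule: finite_induct)
  case (insert x S)
  let ?p = "\<Prod>i\<in>S. f i"
  have IH: "coeff ?p (card S * k) = (\<Prod>i\<in>S. coeff (f i) k)" "degree ?p \<le> card S * k"
    using insert by auto
  have dx: "degree (f x) \<le> k" using insert by simp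
  have "coeff (f x * ?p) (k + card S * k) = coeff (f x) k * coeff ?p (card S * k)"
  proof -
    have "coeff (f x * ?p) (k + card S * k) =
        (\<Sum>i\<le>k + card S * k. coeff (f x) i * coeff ?p (k + card S * k - i))" by (rule coeff_mult)
    also have "\<dots> = (\<Sum>i\<le>k + card S * k. if i = k then coeff (f x) i * coeff ?p (card S * k) else 0)"
    proof (rule sum.cong[OF refl])
      fix i
      consider "i = k" | "i < k" | "i > k" by linarith
      then show "coeff (f x) i * coeff ?p (k + card S * k - i) =
          (if i = k then coeff (f x) i * coeff ?p (card S * k) else 0)"
      proof cases
        case 2
        then have "coeff ?p (k + card S * k - i) = 0" using IH(2) by (intro coeff_eq_0) simp
        then show ?thesis using 2 by simp
      next
        case 3
        then have "coeff (f x) i = 0" using dx by (intro coeff_eq_0) simp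
        then show ?thesis using 3 by simp
      qed simp
    qed
    also have "\<dots> = coeff (f x) k * coeff ?p (card S * k)" by simp
    finally show ?thesis .
  qed
  moreover have "degree (f x * ?p) \<le> k + card S * k"
    using degree_mult_le[of "f x" ?p] dx IH(2) by linarith
  ultimately show ?case using insert(1,2) IH(1) by simp
qed simp

lemma coeff_det_top:
  assumes P: "(P :: complex poly mat) \<in> carrier_mat n n"
    and deg: "\<And>a b. a < n \<Longrightarrow> b < n \<Longrightarrow> degree (P $$ (a,b)) \<le> k"
  shows "coeff (det P) (n * k) = det (map_mat (\<lambda>p. coeff p k) P)"
proof -
  have Pk: "map_mat (\<lambda>p. coeff p k) P \<in> carrier_mat n n" using P by simp
  have "coeff (signof p * (\<Prod>i = 0..<n. P $$ (i, p i))) (n * k) =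
      signof p * (\<Prod>i = 0..<n. map_mat (\<lambda>p. coeff p k) P $$ (i, p i))"
    if p: "p permutes {0..<n}" for p
  proof -
    have pi: "p i < n" if "i < n" for i using permutes_in_image[OF p, of i] that by simp
    have "coeff (\<Prod>i = 0..<n. P $$ (i, p i)) (card {0..<n} * k) = (\<Prod>i = 0..<n. coeff (P $$ (i, p i)) k)"
      using coeff_prod_degree_bound[of "{0..<n}" "\<lambda>i. P $$ (i, p i)" k] deg pi by simp
    also have "\<dots> = (\<Prod>i = 0..<n. map_mat (\<lambda>p. coeff p k) P $$ (i, p i))"
      by (rule prod.cong) (use P pi in auto)
    finally show ?thesis by (simp add: sign_def)
  qed
  then show ?thesis
    unfolding det_def'[OF P] det_def'[OF Pk] coeff_sum by (intro sum.cong refl) simp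
qed

lemma taylor_expansion:
  assumes "degree p \<le> k"
  shows "p = (\<Sum>i\<le>k. Polynomial.smult (taylor_coeff z0 p i) ([:-z0, 1:] ^ i))"
proof -
  define q where "q = p \<circ>\<^sub>p [:z0, 1:]"
  have "degree q \<le> k" using assms by (simp add: q_def degree_pcompose)
  then have q: "q = (\<Sum>i\<le>k. monom (coeff q i) i)" by (rule poly_as_sum_of_monoms'[symmetric])
  have m: "monom c i \<circ>\<^sub>p [:-z0, 1:] = Polynomial.smult c ([:-z0, 1:] ^ i)" for c i
    by (simp add: monom_altdef pcompose_smult power_pcompose pcompose_pCons)
  have "p = q \<circ>\<^sub>p [:-z0, 1:]" unfolding q_def by (rule shift_unshift[symmetric])
  also have "\<dots> = (\<Sum>i\<le>k. Polynomial.smult (coeff q i) ([:-z0, 1:] ^ i))"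
    by (subst q) (simp add: pcompose_sum m)
  finally show ?thesis by (simp add: q_def taylor_coeff_eq_coeff_pcompose)
qed

lemma linear_power_dvd_if_single_root:
  assumes nz: "coeff D m \<noteq> 0" and root: "\<And>w. w \<noteq> z0 \<Longrightarrow> poly D w \<noteq> 0"
  shows "[:-z0, 1:] ^ m dvd (D :: complex poly)"
proof -
  have D0: "D \<noteq> 0" using nz by auto
  have "{z. poly D z = 0} \<subseteq> {z0}" using root by auto
  then have prod: "(\<Prod>z | poly D z = 0. [:-z, 1:] ^ order z D) = [:-z0, 1:] ^ order z0 D"
  proof (cases "poly D z0 = 0")
    case True
    then have "{z. poly D z = 0} = {z0}" using \<open>{z. poly D z = 0} \<subseteq> {z0}\<close> by auto
    then show ?thesis by simp
  next
    case False
    then have "{z. poly D z = 0} = {}" using \<open>{z. poly D z = 0} \<subseteq> {z0}\<close> by auto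
    then show ?thesis using order_0I[OF False] by simp
  qed
  have "m \<le> degree D" using nz by (rule le_degree)
  also have "D = Polynomial.smult (lead_coeff D) ([:-z0, 1:] ^ order z0 D)"
    using complex_poly_decompose[of D] unfolding prod by simp
  then have "degree D = order z0 D"
    using D0 by (metis degree_linear_power degree_smult_eq leading_coeff_0_iff)
  finally show ?thesis unfolding order_divides by simp
qed

text \<open>Expansion in powers of \<open>L\<close> moves \<open>z0\<close> to \<open>0\<close>. The determinant of the approximating polynomial has degree \<open>k n\<close>,
because its leading coefficient is invertible, and all its roots are at \<open>z0\<close>.\<close>

lemma singular_regular_approx:
  assumes grade: "has_grade n k Q" and sing: "det Q = 0" and n: "1 \<le> n" and k: "1 \<le> k" and eps: "0 < \<epsilon>"
  shows "\<exists>Q'. has_grade n k Q' \<and> coeffs_near n \<epsilon> Q Q' \<and> det Q' \<noteq> 0 \<and> [:-z0, 1:] ^ (k * n) dvd det Q'"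
proof -
  define L where "L = [:-z0, 1:]"
  have Q: "Q \<in> carrier_mat n n" and deg: "\<And>a b. a < n \<Longrightarrow> b < n \<Longrightarrow> degree (Q $$ (a,b)) \<le> k"
    using grade by (auto simp: has_grade_def)
  have degL: "degree (L ^ i) = i" for i by (simp add: L_def degree_linear_power)
  define A where "A i = mat n n (\<lambda>(a,b). taylor_coeff z0 (Q $$ (a,b)) i)" for i
  define mk where "mk A = mat n n (\<lambda>(a,b). \<Sum>i\<le>k. Polynomial.smult (A i $$ (a,b)) (L ^ i))" for A :: "nat \<Rightarrow> complex mat"
  have mkc: "mk A \<in> carrier_mat n n" for A by (simp add: mk_def)
  have mki: "mk A $$ (a,b) = (\<Sum>i\<le>k. Polynomial.smult (A i $$ (a,b)) (L ^ i))" if "a < n" "b < n" for A a b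
    using that by (simp add: mk_def)
  have QA: "Q = mk A"
  proof (rule eq_matI)
    fix a b assume "a < dim_row (mk A)" "b < dim_col (mk A)"
    then have ab: "a < n" "b < n" by (auto simp: mk_def)
    show "Q $$ (a,b) = mk A $$ (a,b)"
      using taylor_expansion[OF deg[OF ab], of z0] ab unfolding mki[OF ab] by (simp add: A_def L_def)
  qed (use Q in \<open>auto simp: mk_def\<close>)
  have ev: "poly (det (mk A)) w = det (eval_matpoly n k A (w - z0))" for A w
  proof -
    have "map_mat (\<lambda>p. poly p w) (mk A) = eval_matpoly n k A (w - z0)"
      by (intro eq_matI) (auto simp: mk_def eval_matpoly_def poly_sum L_def mult.commute)
    then show ?thesis by (simp add: poly_det)
  qed
  have "det (eval_matpoly n k A z) = 0" for z
    using ev[of A "z + z0"] sing by (simp flip: QA)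
  note ap = singular_matpoly_approx[OF k n this]
  define W where "W = (\<Sum>i\<le>k. \<Sum>l\<le>k. cmod (coeff (L ^ i) l)) + 1"
  have W: "(\<Sum>i\<le>k. cmod (coeff (L ^ i) l)) < W" for l
  proof (cases "l \<le> k")
    case True
    have "(\<Sum>i\<le>k. cmod (coeff (L ^ i) l)) \<le> (\<Sum>i\<le>k. \<Sum>l\<le>k. cmod (coeff (L ^ i) l))"
      by (rule sum_mono, rule member_le_sum) (use True in auto)
    then show ?thesis by (simp add: W_def)
  next
    case False
    then have "coeff (L ^ i) l = 0" if "i \<le> k" for i using that degL by (intro coeff_eq_0) simp
    then have "(\<Sum>i\<le>k. cmod (coeff (L ^ i) l)) = 0" by (intro sum.neutral) simp
    moreover have "0 < W" unfolding W_def by (intro add_nonneg_pos sum_nonneg) auto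
    ultimately show ?thesis by simp
  qed
  have Wpos: "0 < W" unfolding W_def by (intro add_nonneg_pos sum_nonneg) auto
  obtain A' where A': "\<forall>i\<le>k. \<forall>a<n. \<forall>b<n. cmod (A' i $$ (a,b) - A i $$ (a,b)) < \<epsilon> / W"
    "\<forall>i. A' i \<in> carrier_mat n n" "det (A' k) \<noteq> 0" "\<forall>z. z \<noteq> 0 \<longrightarrow> det (eval_matpoly n k A' z) \<noteq> 0"
    using ap[of "\<epsilon> / W"] eps Wpos by auto
  have degmk: "degree (mk A' $$ (a,b)) \<le> k" if "a < n" "b < n" for a b
    unfolding mki[OF that] by (intro degree_sum_le order_trans[OF degree_smult_le]) (auto simp: degL)
  have grade': "has_grade n k (mk A')" using mkc degmk by (simp add: has_grade_def)
  have near: "coeffs_near n \<epsilon> Q (mk A')"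
    unfolding coeffs_near_def
  proof (intro allI impI)
    fix a b l assume ab: "a < n" "b < n"
    have "coeff (mk A' $$ (a,b)) l - coeff (Q $$ (a,b)) l =
        (\<Sum>i\<le>k. (A' i $$ (a,b) - A i $$ (a,b)) * coeff (L ^ i) l)"
      unfolding QA mki[OF ab] by (simp add: coeff_sum sum_subtractf left_diff_distrib)
    then have "cmod (coeff (mk A' $$ (a,b)) l - coeff (Q $$ (a,b)) l) \<le>
        (\<Sum>i\<le>k. cmod (A' i $$ (a,b) - A i $$ (a,b)) * cmod (coeff (L ^ i) l))"
      using norm_sum[of "\<lambda>i. (A' i $$ (a,b) - A i $$ (a,b)) * coeff (L ^ i) l" "{..k}"] by (simp add: norm_mult)
    also have "\<dots> \<le> (\<Sum>i\<le>k. \<epsilon> / W * cmod (coeff (L ^ i) l))"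
      by (intro sum_mono mult_right_mono) (use A'(1) ab in \<open>auto intro: less_imp_le\<close>)
    also have "\<dots> < \<epsilon> / W * W"
      unfolding sum_distrib_left[symmetric] using W eps Wpos by (intro mult_strict_left_mono) auto
    finally show "cmod (coeff (mk A' $$ (a,b)) l - coeff (Q $$ (a,b)) l) < \<epsilon>" using Wpos by simp
  qed
  have "map_mat (\<lambda>p. coeff p k) (mk A') = A' k"
  proof (rule eq_matI)
    fix a b assume "a < dim_row (A' k)" "b < dim_col (A' k)"
    then have ab: "a < n" "b < n" using A'(2) by auto
    have "coeff (L ^ i) k = (if i = k then 1 else 0)" if "i \<le> k" for i
    proof (cases "i = k")
      case True
      then show ?thesis unfolding L_def True coeff_linear_power by simp
    next
      case False
      then show ?thesis using that degL by (simp add: coeff_eq_0)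
    qed
    then have "coeff (mk A' $$ (a,b)) k = (\<Sum>i\<le>k. if i = k then A' i $$ (a,b) else 0)"
      unfolding mki[OF ab] coeff_sum coeff_smult by (intro sum.cong refl) simp
    then show "map_mat (\<lambda>p. coeff p k) (mk A') $$ (a,b) = A' k $$ (a,b)" using ab mkc[of A'] by simp
  qed (use carrier_matD[OF mkc[of A']] carrier_matD[OF spec[OF A'(2), of k]] in simp_all)
  then have co: "coeff (det (mk A')) (k * n) \<noteq> 0"
    using coeff_det_top[OF mkc degmk] A'(3) by (metis mult.commute)
  have "poly (det (mk A')) w \<noteq> 0" if "w \<noteq> z0" for w
    unfolding ev using A'(4) that by simp
  then have "[:-z0, 1:] ^ (k * n) dvd det (mk A')"
    by (rule linear_power_dvd_if_single_root[OF co])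
  moreover have "det (mk A') \<noteq> 0" using co by auto
  ultimately show ?thesis using grade' near by blast
qed

text \<open>In the singular case the bound \<open>R \<le> k n\<close> guarantees that the power \<open>L^(k n)\<close> produced by the regularization is
high enough to continue as in the regular case.\<close>

theorem root_vector_approx:
  assumes grade: "has_grade n k Q" and dv: "[:-z0, 1:] ^ R dvd det Q" and R: "1 \<le> R" "R \<le> k * n"
    and eps: "0 < \<epsilon>"
  shows "\<exists>Q' x'. has_grade n k Q' \<and> coeffs_near n \<epsilon> Q Q' \<and> det Q' \<noteq> 0 \<and> root_vector z0 R Q' x'"
proof -
  have nk: "1 \<le> n" "1 \<le> k" using R by (cases n; cases k; simp)+
  show ?thesis
  proof (cases "det Q = 0")
    case False
    then show ?thesis using regular_root_vector_approx[OF grade _ dv _ eps] nk by simp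
  next
    case True
    obtain Q1 where 1: "has_grade n k Q1" "coeffs_near n (\<epsilon> / 2) Q Q1" "det Q1 \<noteq> 0"
      "[:-z0, 1:] ^ (k * n) dvd det Q1"
      using singular_regular_approx[OF grade True nk, of "\<epsilon> / 2" z0] eps by auto
    have "[:-z0, 1:] ^ R dvd det Q1" using 1(4) R(2) by (meson dvd_trans le_imp_power_dvd)
    then obtain Q2 x2 where 2: "has_grade n k Q2" "coeffs_near n (\<epsilon> / 2) Q1 Q2" "det Q2 \<noteq> 0" "root_vector z0 R Q2 x2"
      using regular_root_vector_approx[OF 1(1,3), of z0 R "\<epsilon> / 2"] nk eps by auto
    then show ?thesis using coeffs_near_trans[OF 1(2) 2(2)] by auto
  qed
qed

section \<open>Norms of structured perturbations\<close>

lemma vec_norm2_eq_L2_set: "vec_norm2 v = L2_set (\<lambda>i. cmod (v $ i)) {..<dim_vec v}"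
  by (simp add: vec_norm2_def L2_set_def)

lemma frob_norm_eq_L2_set:
  "frob_norm A = L2_set (\<lambda>p. cmod (A $$ p)) ({..<dim_row A} \<times> {..<dim_col A})"
  by (simp add: frob_norm_def L2_set_def sum.cartesian_product case_prod_beta)

lemma vec_norm2_nonneg: "0 \<le> vec_norm2 v"
  by (simp add: vec_norm2_eq_L2_set)

lemma frob_norm_nonneg: "0 \<le> frob_norm A"
  by (simp add: frob_norm_eq_L2_set)

lemma vec_norm2_squared: "(vec_norm2 v)\<^sup>2 = (\<Sum>i<dim_vec v. (cmod (v $ i))\<^sup>2)"
  by (simp add: vec_norm2_def sum_nonneg)

lemma frob_norm_squared: "(frob_norm A)\<^sup>2 = (\<Sum>i<dim_row A. \<Sum>j<dim_col A. (cmod (A $$ (i,j)))\<^sup>2)"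
  by (simp add: frob_norm_def sum_nonneg)

lemma vec_norm2_smult: "vec_norm2 (c \<cdot>\<^sub>v v) = cmod c * vec_norm2 v"
proof -
  have "(vec_norm2 (c \<cdot>\<^sub>v v))\<^sup>2 = (cmod c * vec_norm2 v)\<^sup>2"
    unfolding power_mult_distrib vec_norm2_squared
    by (simp add: norm_mult power_mult_distrib sum_distrib_left)
  then show ?thesis using vec_norm2_nonneg[of v] vec_norm2_nonneg[of "c \<cdot>\<^sub>v v"] by (simp add: power2_eq_iff_nonneg)
qed

lemma vec_norm2_triangle:
  assumes "x \<in> carrier_vec n" "y \<in> carrier_vec n"
  shows "vec_norm2 (x + y) \<le> vec_norm2 x + vec_norm2 y"
proof -
  have "vec_norm2 (x + y) \<le> L2_set (\<lambda>i. cmod (x $ i) + cmod (y $ i)) {..<n}"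
    unfolding vec_norm2_eq_L2_set using assms
    by (simp, intro L2_set_mono) (auto intro: norm_triangle_ineq)
  also have "\<dots> \<le> vec_norm2 x + vec_norm2 y"
    unfolding vec_norm2_eq_L2_set using assms L2_set_triangle_ineq by auto
  finally show ?thesis .
qed

lemma vec_norm2_mult_le_frob:
  assumes A: "A \<in> carrier_mat m n" and v: "v \<in> carrier_vec n"
  shows "vec_norm2 (A *\<^sub>v v) \<le> frob_norm A * vec_norm2 v"
proof (rule power2_le_imp_le)
  have "(cmod ((A *\<^sub>v v) $ i))\<^sup>2 \<le> (\<Sum>j<n. (cmod (A $$ (i,j)))\<^sup>2) * (vec_norm2 v)\<^sup>2" if i: "i < m" for i
  proof -
    have "(A *\<^sub>v v) $ i = (\<Sum>j<n. A $$ (i,j) * v $ j)"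
      using A v i by (simp add: scalar_prod_def lessThan_atLeast0)
    then have "cmod ((A *\<^sub>v v) $ i) \<le> (\<Sum>j<n. \<bar>cmod (A $$ (i,j))\<bar> * \<bar>cmod (v $ j)\<bar>)"
      using norm_sum[of "\<lambda>j. A $$ (i,j) * v $ j" "{..<n}"] by (simp add: norm_mult)
    also have "\<dots> \<le> L2_set (\<lambda>j. cmod (A $$ (i,j))) {..<n} * L2_set (\<lambda>j. cmod (v $ j)) {..<n}"
      by (rule L2_set_mult_ineq)
    finally have "(cmod ((A *\<^sub>v v) $ i))\<^sup>2 \<le> (L2_set (\<lambda>j. cmod (A $$ (i,j))) {..<n} * vec_norm2 v)\<^sup>2"
      unfolding vec_norm2_eq_L2_set using v by (intro power_mono) auto
    then show ?thesis by (simp add: power_mult_distrib L2_set_def sum_nonneg)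
  qed
  then have "(\<Sum>i<m. (cmod ((A *\<^sub>v v) $ i))\<^sup>2) \<le> (\<Sum>i<m. (\<Sum>j<n. (cmod (A $$ (i,j)))\<^sup>2) * (vec_norm2 v)\<^sup>2)"
    by (intro sum_mono) simp
  then show "(vec_norm2 (A *\<^sub>v v))\<^sup>2 \<le> (frob_norm A * vec_norm2 v)\<^sup>2"
    unfolding power_mult_distrib vec_norm2_squared[of "A *\<^sub>v v"] frob_norm_squared sum_distrib_right[symmetric]
    using A by simp
qed (simp add: vec_norm2_nonneg frob_norm_nonneg)

lemma vec_norm2_le_spec_norm:
  assumes A: "A \<in> carrier_mat m n" and v: "v \<in> carrier_vec n" "vec_norm2 v \<le> 1"
  shows "vec_norm2 (A *\<^sub>v v) \<le> spec_norm A"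
  unfolding spec_norm_def
proof (rule cSUP_upper)
  show "v \<in> {v \<in> carrier_vec (dim_col A). vec_norm2 v \<le> 1}" using A v by simp
  show "bdd_above ((\<lambda>v. vec_norm2 (A *\<^sub>v v)) ` {v \<in> carrier_vec (dim_col A). vec_norm2 v \<le> 1})"
  proof (rule bdd_aboveI2)
    fix u assume u: "u \<in> {v \<in> carrier_vec (dim_col A). vec_norm2 v \<le> 1}"
    have "vec_norm2 (A *\<^sub>v u) \<le> frob_norm A * vec_norm2 u"
      by (rule vec_norm2_mult_le_frob[of _ m n]) (use A u in auto)
    also have "\<dots> \<le> frob_norm A * 1" using u frob_norm_nonneg by (intro mult_left_mono) auto
    finally show "vec_norm2 (A *\<^sub>v u) \<le> frob_norm A" by simp
  qed
qed

lemma vec_norm2_zero: "vec_norm2 (0\<^sub>v n) = 0"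
  by (simp add: vec_norm2_def)

lemma spec_norm_le:
  assumes A: "A \<in> carrier_mat m n"
    and le: "\<And>v. v \<in> carrier_vec n \<Longrightarrow> vec_norm2 v \<le> 1 \<Longrightarrow> vec_norm2 (A *\<^sub>v v) \<le> c"
  shows "spec_norm A \<le> c"
  unfolding spec_norm_def
proof (rule cSUP_least)
  have "0\<^sub>v n \<in> {v \<in> carrier_vec (dim_col A). vec_norm2 v \<le> 1}" using A by (simp add: vec_norm2_zero)
  then show "{v \<in> carrier_vec (dim_col A). vec_norm2 v \<le> 1} \<noteq> {}" by blast
qed (use A le in auto)

lemma spec_norm_nonneg:
  assumes A: "A \<in> carrier_mat m n"
  shows "0 \<le> spec_norm A"
proof -
  have "vec_norm2 (A *\<^sub>v 0\<^sub>v n) \<le> spec_norm A"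
    by (rule vec_norm2_le_spec_norm[OF A]) (simp_all add: vec_norm2_zero)
  then show ?thesis using vec_norm2_nonneg order_trans by blast
qed

lemma vec_norm2_mult_le_spec:
  assumes A: "A \<in> carrier_mat m n" and v: "v \<in> carrier_vec n"
  shows "vec_norm2 (A *\<^sub>v v) \<le> spec_norm A * vec_norm2 v"
proof (cases "vec_norm2 v = 0")
  case True
  then show ?thesis using vec_norm2_mult_le_frob[OF A v] by simp
next
  case False
  then have pos: "0 < vec_norm2 v" using vec_norm2_nonneg[of v] by simp
  define c where "c = complex_of_real (1 / vec_norm2 v)"
  have c: "cmod c = 1 / vec_norm2 v" unfolding c_def norm_of_real using pos by simp
  have "vec_norm2 (A *\<^sub>v (c \<cdot>\<^sub>v v)) \<le> spec_norm A"
    by (rule vec_norm2_le_spec_norm[OF A]) (use v pos in \<open>auto simp: vec_norm2_smult c\<close>)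
  also have "A *\<^sub>v (c \<cdot>\<^sub>v v) = c \<cdot>\<^sub>v (A *\<^sub>v v)" by (rule mult_mat_vec[OF A v])
  finally show ?thesis using pos by (simp add: vec_norm2_smult c field_simps)
qed

text \<open>Measuring the error in the Frobenius norm for both norms lets the distance formula be proved for the two at
once.\<close>

lemma spec_norm_perturb:
  assumes X: "X \<in> carrier_mat m n" and Y: "Y \<in> carrier_mat m n"
  shows "spec_norm X \<le> spec_norm Y + frob_norm (X - Y)"
proof (rule spec_norm_le[OF X])
  fix v assume v: "v \<in> carrier_vec n" "vec_norm2 v \<le> 1"
  have XY: "X - Y \<in> carrier_mat m n" using X Y by (intro minus_carrier_mat)
  have "X *\<^sub>v v = Y *\<^sub>v v + (X - Y) *\<^sub>v v"
    using X Y v by (simp add: minus_mult_distrib_mat_vec[of _ m n]) (intro eq_vecI, auto)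
  then have "vec_norm2 (X *\<^sub>v v) \<le> vec_norm2 (Y *\<^sub>v v) + vec_norm2 ((X - Y) *\<^sub>v v)"
    using vec_norm2_triangle[of "Y *\<^sub>v v" m "(X - Y) *\<^sub>v v"] X Y v XY by simp
  also have "\<dots> \<le> spec_norm Y + frob_norm (X - Y) * 1"
    using vec_norm2_le_spec_norm[OF Y v] vec_norm2_mult_le_frob[OF XY v(1)]
      mult_left_mono[OF v(2) frob_norm_nonneg[of "X - Y"]] by linarith
  finally show "vec_norm2 (X *\<^sub>v v) \<le> spec_norm Y + frob_norm (X - Y)" by simp
qed

lemma frob_norm_perturb:
  assumes X: "X \<in> carrier_mat m n" and Y: "Y \<in> carrier_mat m n"
  shows "frob_norm X \<le> frob_norm Y + frob_norm (X - Y)"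
proof -
  let ?I = "{..<m} \<times> {..<n}"
  have "frob_norm X \<le> L2_set (\<lambda>p. cmod (Y $$ p) + cmod ((X - Y) $$ p)) ?I"
    unfolding frob_norm_eq_L2_set carrier_matD[OF X]
  proof (rule L2_set_mono)
    fix p assume "p \<in> ?I"
    then have "X $$ p = Y $$ p + (X - Y) $$ p" using X Y by auto
    then show "cmod (X $$ p) \<le> cmod (Y $$ p) + cmod ((X - Y) $$ p)"
      by (metis norm_triangle_ineq)
  qed auto
  also have "\<dots> \<le> L2_set (\<lambda>p. cmod (Y $$ p)) ?I + L2_set (\<lambda>p. cmod ((X - Y) $$ p)) ?I"
    by (rule L2_set_triangle_ineq)
  finally show ?thesis unfolding frob_norm_eq_L2_set using X Y by simp
qed

lemma frob_norm_entry_bound: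
  assumes X: "X \<in> carrier_mat m n" and e: "0 \<le> e" "\<And>i j. i < m \<Longrightarrow> j < n \<Longrightarrow> cmod (X $$ (i,j)) \<le> e"
  shows "frob_norm X \<le> real (m * n) * e"
proof -
  have "frob_norm X \<le> (\<Sum>p\<in>{..<m} \<times> {..<n}. cmod (X $$ p))"
    unfolding frob_norm_eq_L2_set carrier_matD[OF X] by (rule L2_set_le_sum) auto
  also have "\<dots> \<le> (\<Sum>p\<in>{..<m} \<times> {..<n}. e)" by (rule sum_mono) (use e in auto)
  finally show ?thesis by simp
qed

lemma block_row_carrier: "block_row n m B \<in> carrier_mat n ((m + 1) * n)"
  by (simp add: block_row_def)

lemma block_row_index:
  "a < n \<Longrightarrow> i \<le> m \<Longrightarrow> b < n \<Longrightarrow> block_row n m B $$ (a, i * n + b) = B i $$ (a,b)"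
  using block_index_less[of i "m + 1" b n] by (simp add: block_row_def)

lemma kron_one_index:
  assumes X: "(X :: complex mat) \<in> carrier_mat n w" and i: "i < R" "a < n" and j: "j < R" "c < w"
  shows "kron (1\<^sub>m R) X $$ (i * n + a, j * w + c) = (if i = j then X $$ (a,c) else 0)"
  using X i j block_index_less[OF i] block_index_less[OF j] by (simp add: kron_def)

lemma kron_one_carrier:
  assumes "(X :: complex mat) \<in> carrier_mat n w"
  shows "kron (1\<^sub>m R) X \<in> carrier_mat (R * n) (R * w)"
  unfolding kron_def carrier_matD[OF assms] index_one_mat by (rule mat_carrier)

lemma frob_norm_kron_one:
  assumes X: "X \<in> carrier_mat n w"
  shows "frob_norm (kron (1\<^sub>m R) X) = sqrt (real R) * frob_norm X"
proof -
  let ?K = "kron (1\<^sub>m R) X"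
  note K = kron_one_carrier[OF X, of R]
  have "(frob_norm ?K)\<^sup>2 = (\<Sum>i<R. \<Sum>a<n. \<Sum>j<R. \<Sum>c<w. (cmod (?K $$ (i * n + a, j * w + c)))\<^sup>2)"
    unfolding frob_norm_squared carrier_matD[OF K] sum_blocks ..
  also have "\<dots> = (\<Sum>i<R. \<Sum>a<n. \<Sum>j<R. if j = i then (\<Sum>c<w. (cmod (X $$ (a,c)))\<^sup>2) else 0)"
    by (intro sum.cong refl) (auto simp: kron_one_index[OF X])
  also have "\<dots> = real R * (frob_norm X)\<^sup>2"
    unfolding frob_norm_squared using X by simp
  finally have "(frob_norm ?K)\<^sup>2 = (sqrt (real R) * frob_norm X)\<^sup>2" by (simp add: power_mult_distrib)
  then show ?thesis using frob_norm_nonneg[of X] frob_norm_nonneg[of ?K] by (simp add: power2_eq_iff_nonneg)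
qed

lemma kron_one_mult_vec:
  assumes X: "(X :: complex mat) \<in> carrier_mat n w" and v: "v \<in> carrier_vec (R * w)" and i: "i < R" "a < n"
  shows "(kron (1\<^sub>m R) X *\<^sub>v v) $ (i * n + a) = (X *\<^sub>v vec w (\<lambda>c. v $ (i * w + c))) $ a"
proof -
  note K = kron_one_carrier[OF X, of R]
  have "(kron (1\<^sub>m R) X *\<^sub>v v) $ (i * n + a) = (\<Sum>p<R * w. kron (1\<^sub>m R) X $$ (i * n + a, p) * v $ p)"
    using K v block_index_less[OF i] by (simp add: scalar_prod_def lessThan_atLeast0)
  also have "\<dots> = (\<Sum>j<R. if j = i then (\<Sum>c<w. X $$ (a,c) * v $ (j * w + c)) else 0)"
    unfolding sum_blocks by (intro sum.cong refl) (use i in \<open>auto simp: kron_one_index[OF X]\<close>)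
  also have "\<dots> = (X *\<^sub>v vec w (\<lambda>c. v $ (i * w + c))) $ a"
    using X i by (simp add: scalar_prod_def lessThan_atLeast0)
  finally show ?thesis .
qed

lemma vec_norm2_blocks:
  assumes v: "v \<in> carrier_vec (R * w)"
  shows "(vec_norm2 v)\<^sup>2 = (\<Sum>i<R. (vec_norm2 (vec w (\<lambda>c. v $ (i * w + c))))\<^sup>2)"
  unfolding vec_norm2_squared using v by (simp add: sum_blocks)

text \<open>The matrix is block diagonal with equal blocks: squared norms add up over the blocks of a vector, and vectors
supported in the first block show that the norm of a single block is attained.\<close>

lemma spec_norm_kron_one:
  assumes X: "X \<in> carrier_mat n w" and R: "0 < R"
  shows "spec_norm (kron (1\<^sub>m R) X) = spec_norm X"
proof (rule antisym)
  let ?K = "kron (1\<^sub>m R) X"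
  note K = kron_one_carrier[OF X, of R]
  have sq: "(vec_norm2 (?K *\<^sub>v v))\<^sup>2 = (\<Sum>i<R. (vec_norm2 (X *\<^sub>v vec w (\<lambda>c. v $ (i * w + c))))\<^sup>2)"
    if v: "v \<in> carrier_vec (R * w)" for v
  proof -
    have Kv: "?K *\<^sub>v v \<in> carrier_vec (R * n)" by (rule mult_mat_vec_carrier[OF K v])
    have "vec n (\<lambda>a. (?K *\<^sub>v v) $ (i * n + a)) = X *\<^sub>v vec w (\<lambda>c. v $ (i * w + c))" if i: "i < R" for i
    proof (rule eq_vecI)
      fix a assume "a < dim_vec (X *\<^sub>v vec w (\<lambda>c. v $ (i * w + c)))"
      then have a: "a < n" using X by simp
      then show "vec n (\<lambda>a. (?K *\<^sub>v v) $ (i * n + a)) $ a = (X *\<^sub>v vec w (\<lambda>c. v $ (i * w + c))) $ a"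
        unfolding index_vec[OF a] by (intro kron_one_mult_vec[OF X v i])
    qed (use X in simp)
    then show ?thesis
      unfolding vec_norm2_blocks[OF Kv] by (intro sum.cong refl) (metis lessThan_iff)
  qed
  show "spec_norm ?K \<le> spec_norm X"
  proof (rule spec_norm_le[OF K])
    fix v assume v: "v \<in> carrier_vec (R * w)" "vec_norm2 v \<le> 1"
    have "(vec_norm2 (?K *\<^sub>v v))\<^sup>2 \<le> (\<Sum>i<R. (spec_norm X * vec_norm2 (vec w (\<lambda>c. v $ (i * w + c))))\<^sup>2)"
      unfolding sq[OF v(1)]
      by (intro sum_mono power_mono vec_norm2_mult_le_spec[OF X] vec_norm2_nonneg) simp
    also have "\<dots> = (spec_norm X * vec_norm2 v)\<^sup>2"
      unfolding power_mult_distrib vec_norm2_blocks[OF v(1)] by (simp add: sum_distrib_left)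
    finally have "vec_norm2 (?K *\<^sub>v v) \<le> spec_norm X * vec_norm2 v"
      by (rule power2_le_imp_le[OF _ mult_nonneg_nonneg[OF spec_norm_nonneg[OF X] vec_norm2_nonneg]])
    also have "\<dots> \<le> spec_norm X * 1" using v spec_norm_nonneg[OF X] by (intro mult_left_mono)
    finally show "vec_norm2 (?K *\<^sub>v v) \<le> spec_norm X" by simp
  qed
  show "spec_norm X \<le> spec_norm ?K"
  proof (rule spec_norm_le[OF X])
    fix u assume u: "u \<in> carrier_vec w" "vec_norm2 u \<le> 1"
    define v where "v = vec (R * w) (\<lambda>p. if p < w then u $ p else 0)"
    have v: "v \<in> carrier_vec (R * w)" by (simp add: v_def)
    have vi: "vec w (\<lambda>c. v $ (i * w + c)) = (if i = 0 then u else 0\<^sub>v w)" if i: "i < R" for i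
    proof (rule eq_vecI)
      fix c assume "c < dim_vec (if i = 0 then u else 0\<^sub>v w)"
      then have c: "c < w" using u by (cases "i = 0") auto
      have "\<not> i * w + c < w" if "i \<noteq> 0" using that by (cases i) auto
      then show "vec w (\<lambda>c. v $ (i * w + c)) $ c = (if i = 0 then u else 0\<^sub>v w) $ c"
        using block_index_less[OF i c] c by (simp add: v_def)
    qed (use u in auto)
    have "(vec_norm2 v)\<^sup>2 = (\<Sum>i<R. if i = 0 then (vec_norm2 u)\<^sup>2 else 0)"
      unfolding vec_norm2_blocks[OF v] by (rule sum.cong) (auto simp: vi vec_norm2_zero)
    then have "(vec_norm2 v)\<^sup>2 = (vec_norm2 u)\<^sup>2" using R by simp
    then have "vec_norm2 v = vec_norm2 u"
      unfolding power2_eq_iff_nonneg[OF vec_norm2_nonneg vec_norm2_nonneg] .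
    then have nv: "vec_norm2 v \<le> 1" using u(2) by simp
    have X0: "X *\<^sub>v 0\<^sub>v w = 0\<^sub>v n" using X by (intro eq_vecI) auto
    have "(vec_norm2 (?K *\<^sub>v v))\<^sup>2 = (\<Sum>i<R. if i = 0 then (vec_norm2 (X *\<^sub>v u))\<^sup>2 else 0)"
      unfolding sq[OF v] by (rule sum.cong) (auto simp: vi vec_norm2_zero X0)
    then have "(vec_norm2 (?K *\<^sub>v v))\<^sup>2 = (vec_norm2 (X *\<^sub>v u))\<^sup>2" using R by simp
    then have "vec_norm2 (X *\<^sub>v u) = vec_norm2 (?K *\<^sub>v v)"
      using vec_norm2_nonneg[of "?K *\<^sub>v v"] vec_norm2_nonneg[of "X *\<^sub>v u"] by (simp add: power2_eq_iff_nonneg)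
    then show "vec_norm2 (X *\<^sub>v u) \<le> spec_norm ?K" using vec_norm2_le_spec_norm[OF K v nv] by simp
  qed
qed

lemma frob_norm_block_row:
  assumes "\<forall>i\<le>m. B i \<in> carrier_mat n n"
  shows "frob_norm (block_row n m B) = triple_norm_F m B"
proof -
  have "(\<Sum>a<n. \<Sum>c<(m + 1) * n. (cmod (block_row n m B $$ (a,c)))\<^sup>2) =
      (\<Sum>a<n. \<Sum>i<m + 1. \<Sum>b<n. (cmod (B i $$ (a,b)))\<^sup>2)"
    unfolding sum_blocks by (intro sum.cong refl) (simp add: block_row_index less_Suc_eq_le)
  also have "\<dots> = (\<Sum>i<m + 1. \<Sum>a<n. \<Sum>b<n. (cmod (B i $$ (a,b)))\<^sup>2)" by (rule sum.swap)
  also have "\<dots> = (\<Sum>i\<le>m. (frob_norm (B i))\<^sup>2)"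
    by (rule sum.cong) (use assms in \<open>auto simp: frob_norm_squared\<close>)
  finally show ?thesis
    unfolding triple_norm_F_def frob_norm_def[of "block_row n m B"] carrier_matD[OF block_row_carrier] by simp
qed

definition zero_beyond :: "nat \<Rightarrow> nat \<Rightarrow> (nat \<Rightarrow> complex mat) \<Rightarrow> nat \<Rightarrow> complex mat" where
  "zero_beyond n m B i = (if i \<le> m then B i else 0\<^sub>m n n)"

lemma pad_vec_mult:
  assumes X: "(X :: complex mat) \<in> carrier_mat n w" and Y: "Y \<in> carrier_mat n w'" and ww: "w \<le> w'"
    and eq: "\<And>a c. a < n \<Longrightarrow> c < w \<Longrightarrow> Y $$ (a,c) = X $$ (a,c)" and u: "u \<in> carrier_vec w"
  shows "Y *\<^sub>v vec w' (\<lambda>c. if c < w then u $ c else 0) = X *\<^sub>v u"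
    "vec_norm2 (vec w' (\<lambda>c. if c < w then u $ c else 0)) = vec_norm2 u"
proof -
  let ?v = "vec w' (\<lambda>c. if c < w then u $ c else 0)"
  show "Y *\<^sub>v ?v = X *\<^sub>v u"
  proof (rule eq_vecI)
    fix a assume "a < dim_vec (X *\<^sub>v u)"
    then have a: "a < n" using X by simp
    have "(Y *\<^sub>v ?v) $ a = (\<Sum>c<w'. Y $$ (a,c) * ?v $ c)"
      using a Y by (simp add: scalar_prod_def lessThan_atLeast0)
    also have "\<dots> = (\<Sum>c<w. X $$ (a,c) * u $ c)"
      by (rule sum.mono_neutral_cong_right) (use ww eq[OF a] in auto)
    also have "\<dots> = (X *\<^sub>v u) $ a"
      using a u X by (simp add: scalar_prod_def lessThan_atLeast0)
    finally show "(Y *\<^sub>v ?v) $ a = (X *\<^sub>v u) $ a" .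
  qed (use X Y in simp)
  have "(\<Sum>c<w'. (cmod (?v $ c))\<^sup>2) = (\<Sum>c<w. (cmod (u $ c))\<^sup>2)"
    by (rule sum.mono_neutral_cong_right) (use ww in auto)
  then show "vec_norm2 ?v = vec_norm2 u" using u by (simp add: vec_norm2_def)
qed

lemma norms_mono_columns:
  assumes X: "(X :: complex mat) \<in> carrier_mat n w" and Y: "Y \<in> carrier_mat n w'" and ww: "w \<le> w'"
    and eq: "\<And>a c. a < n \<Longrightarrow> c < w \<Longrightarrow> Y $$ (a,c) = X $$ (a,c)"
  shows "spec_norm X \<le> spec_norm Y" "frob_norm X \<le> frob_norm Y"
proof -
  show "spec_norm X \<le> spec_norm Y"
  proof (rule spec_norm_le[OF X])
    fix u assume u: "u \<in> carrier_vec w" "vec_norm2 u \<le> 1"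
    define v where "v = vec w' (\<lambda>c. if c < w then u $ c else 0)"
    have v: "v \<in> carrier_vec w'" by (simp add: v_def)
    have "Y *\<^sub>v v = X *\<^sub>v u" "vec_norm2 v = vec_norm2 u"
      unfolding v_def by (rule pad_vec_mult[OF X Y ww _ u(1)], rule eq, assumption+)+
    then show "vec_norm2 (X *\<^sub>v u) \<le> spec_norm Y"
      using vec_norm2_le_spec_norm[OF Y v] u(2) by simp
  qed
  show "frob_norm X \<le> frob_norm Y"
  proof (rule power2_le_imp_le)
    have "(\<Sum>c<w. (cmod (X $$ (a,c)))\<^sup>2) \<le> (\<Sum>c<w'. (cmod (Y $$ (a,c)))\<^sup>2)" if a: "a < n" for a
    proof -
      have "(\<Sum>c<w. (cmod (X $$ (a,c)))\<^sup>2) = (\<Sum>c<w. (cmod (Y $$ (a,c)))\<^sup>2)"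
        by (rule sum.cong) (use eq[OF a] in auto)
      also have "\<dots> \<le> (\<Sum>c<w'. (cmod (Y $$ (a,c)))\<^sup>2)" by (rule sum_mono2) (use ww in auto)
      finally show ?thesis .
    qed
    then show "(frob_norm X)\<^sup>2 \<le> (frob_norm Y)\<^sup>2"
      unfolding frob_norm_squared carrier_matD[OF X] carrier_matD[OF Y] by (intro sum_mono) simp
  qed (rule frob_norm_nonneg)
qed

text \<open>A vector is shortened to the coordinates of the nonzero columns, which does not increase its norm.\<close>

lemma norms_drop_zero_columns:
  assumes X: "(X :: complex mat) \<in> carrier_mat n w" and Y: "Y \<in> carrier_mat n w'" and ww: "w \<le> w'"
    and eq: "\<And>a c. a < n \<Longrightarrow> c < w \<Longrightarrow> Y $$ (a,c) = X $$ (a,c)"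
    and z: "\<And>a c. a < n \<Longrightarrow> c < w' \<Longrightarrow> w \<le> c \<Longrightarrow> Y $$ (a,c) = 0"
  shows "spec_norm Y \<le> spec_norm X" "frob_norm Y \<le> frob_norm X"
proof -
  show "spec_norm Y \<le> spec_norm X"
  proof (rule spec_norm_le[OF Y])
    fix u assume u: "u \<in> carrier_vec w'" "vec_norm2 u \<le> 1"
    define v where "v = vec w (\<lambda>c. u $ c)"
    have v: "v \<in> carrier_vec w" by (simp add: v_def)
    have "(vec_norm2 v)\<^sup>2 = (\<Sum>c<w. (cmod (u $ c))\<^sup>2)" by (simp add: vec_norm2_squared v_def)
    also have "\<dots> \<le> (\<Sum>c<w'. (cmod (u $ c))\<^sup>2)" by (rule sum_mono2) (use ww in auto)
    also have "\<dots> = (vec_norm2 u)\<^sup>2" using u by (simp add: vec_norm2_squared)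
    finally have "vec_norm2 v \<le> vec_norm2 u" by (rule power2_le_imp_le[OF _ vec_norm2_nonneg])
    then have v1: "vec_norm2 v \<le> 1" using u(2) by linarith
    have "Y *\<^sub>v u = X *\<^sub>v v"
    proof (rule eq_vecI)
      fix a assume "a < dim_vec (X *\<^sub>v v)"
      then have a: "a < n" using X by simp
      have "(Y *\<^sub>v u) $ a = (\<Sum>c<w'. Y $$ (a,c) * u $ c)"
        using a u Y by (simp add: scalar_prod_def lessThan_atLeast0)
      also have "\<dots> = (\<Sum>c<w. X $$ (a,c) * v $ c)"
        by (rule sum.mono_neutral_cong_right) (use ww eq[OF a] z[OF a] in \<open>auto simp: v_def\<close>)
      also have "\<dots> = (X *\<^sub>v v) $ a"
        using a v X by (simp add: scalar_prod_def lessThan_atLeast0)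
      finally show "(Y *\<^sub>v u) $ a = (X *\<^sub>v v) $ a" .
    qed (use X Y in simp)
    then show "vec_norm2 (Y *\<^sub>v u) \<le> spec_norm X" using vec_norm2_le_spec_norm[OF X v v1] by simp
  qed
  show "frob_norm Y \<le> frob_norm X"
  proof (rule power2_le_imp_le)
    have "(\<Sum>c<w'. (cmod (Y $$ (a,c)))\<^sup>2) = (\<Sum>c<w. (cmod (X $$ (a,c)))\<^sup>2)" if a: "a < n" for a
      by (rule sum.mono_neutral_cong_right) (use ww eq[OF a] z[OF a] in auto)
    then show "(frob_norm Y)\<^sup>2 \<le> (frob_norm X)\<^sup>2"
      unfolding frob_norm_squared carrier_matD[OF X] carrier_matD[OF Y] by simp
  qed (rule frob_norm_nonneg)
qed

lemma block_row_width_mono: "m \<le> k \<Longrightarrow> (m + 1) * n \<le> (k + 1) * (n::nat)"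
  by (intro mult_le_mono1) simp

lemma block_row_truncate_index:
  assumes "m \<le> k" "a < n" "c < (m + 1) * n"
  shows "block_row n k B $$ (a,c) = block_row n m B $$ (a,c)"
proof -
  have "c < (k + 1) * n" by (rule less_le_trans[OF assms(3) block_row_width_mono[OF assms(1)]])
  then show ?thesis using assms(2,3) unfolding block_row_def by simp
qed

lemma block_row_zero_beyond_index:
  assumes mk: "m \<le> k" and a: "a < n" and c: "c < (k + 1) * n"
  shows "block_row n k (zero_beyond n m B) $$ (a,c) = (if c < (m + 1) * n then block_row n m B $$ (a,c) else 0)"
proof -
  obtain i b where ib: "i < k + 1" "b < n" "c = i * n + b" using c by (rule block_index_cases)
  have "block_row n k (zero_beyond n m B) $$ (a,c) = zero_beyond n m B i $$ (a,b)"
    unfolding ib(3) by (rule block_row_index) (use a ib in auto)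
  moreover have "i < m + 1 \<Longrightarrow> c < (m + 1) * n" unfolding ib(3) by (rule block_index_less[OF _ ib(2)])
  moreover have "c < (m + 1) * n \<Longrightarrow> i < m + 1"
    using less_mult_imp_div_less[of c "m + 1" n] ib by simp
  moreover have "i < m + 1 \<Longrightarrow> block_row n m B $$ (a,c) = B i $$ (a,b)"
    unfolding ib(3) by (rule block_row_index) (use a ib in auto)
  ultimately show ?thesis using a ib(2) by (auto simp: zero_beyond_def simp del: mult_Suc)
qed

text \<open>Cutting off the last blocks does not increase either norm, and filling up with zero blocks does not either.\<close>

lemma block_row_truncate_norms:
  assumes mk: "m \<le> k"
  shows "spec_norm (block_row n m B) \<le> spec_norm (block_row n k B)"
    "frob_norm (block_row n m B) \<le> frob_norm (block_row n k B)"
    "spec_norm (block_row n k (zero_beyond n m B)) \<le> spec_norm (block_row n m B)"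
    "frob_norm (block_row n k (zero_beyond n m B)) \<le> frob_norm (block_row n m B)"
proof -
  note w = block_row_width_mono[OF mk, of n]
  note t = norms_mono_columns[OF block_row_carrier[of n m B] block_row_carrier[of n k B] w]
  show "spec_norm (block_row n m B) \<le> spec_norm (block_row n k B)"
    by (rule t(1)) (rule block_row_truncate_index[OF mk])
  show "frob_norm (block_row n m B) \<le> frob_norm (block_row n k B)"
    by (rule t(2)) (rule block_row_truncate_index[OF mk])
  have z: "block_row n k (zero_beyond n m B) $$ (a,c) = block_row n m B $$ (a,c)"
    if "a < n" "c < (m + 1) * n" for a c
    unfolding block_row_zero_beyond_index[OF mk that(1) less_le_trans[OF that(2) w]] using that(2) by (rule if_P)
  have z0: "block_row n k (zero_beyond n m B) $$ (a,c) = 0"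
    if "a < n" "c < (k + 1) * n" "(m + 1) * n \<le> c" for a c
    unfolding block_row_zero_beyond_index[OF mk that(1,2)] using leD[OF that(3)] by (rule if_not_P)
  note d = norms_drop_zero_columns[OF block_row_carrier[of n m B] block_row_carrier[of n k "zero_beyond n m B"] w]
  show "spec_norm (block_row n k (zero_beyond n m B)) \<le> spec_norm (block_row n m B)"
    by (rule d(1)) (rule z z0; assumption)+
  show "frob_norm (block_row n k (zero_beyond n m B)) \<le> frob_norm (block_row n m B)"
    by (rule d(2)) (rule z z0; assumption)+
qed

section \<open>Structured perturbations of the block Toeplitz matrix\<close>

lemma kron_one_mult_index:
  assumes X: "(X :: complex mat) \<in> carrier_mat n w" and Y: "Y \<in> carrier_mat (R * w) q"
    and s: "s < R" "a < n" and c: "c < q"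
  shows "(kron (1\<^sub>m R) X * Y) $$ (s * n + a, c) = (\<Sum>l<w. X $$ (a,l) * Y $$ (s * w + l, c))"
proof -
  have "(kron (1\<^sub>m R) X * Y) $$ (s * n + a, c) = (\<Sum>p<R * w. kron (1\<^sub>m R) X $$ (s * n + a, p) * Y $$ (p, c))"
    by (rule mult_mat_index[OF kron_one_carrier[OF X] Y block_index_less[OF s] c])
  also have "\<dots> = (\<Sum>j<R. if j = s then (\<Sum>l<w. X $$ (a,l) * Y $$ (j * w + l, c)) else 0)"
    unfolding sum_blocks by (intro sum.cong refl) (use s in \<open>auto simp: kron_one_index[OF X]\<close>)
  also have "\<dots> = (\<Sum>l<w. X $$ (a,l) * Y $$ (s * w + l, c))" using s by simp
  finally show ?thesis .
qed

lemma kron_one_right_index: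
  assumes X: "(X :: complex mat) \<in> carrier_mat h w" and i: "i < h" "a < n" and j: "j < w" "b < n"
  shows "kron X (1\<^sub>m n) $$ (i * n + a, j * n + b) = (if a = b then X $$ (i,j) else 0)"
  using X i j block_index_less[OF i] block_index_less[OF j] by (simp add: kron_def)

lemma kron_one_right_carrier:
  assumes "(X :: complex mat) \<in> carrier_mat h w"
  shows "kron X (1\<^sub>m n) \<in> carrier_mat (h * n) (w * n)"
  unfolding kron_def carrier_matD[OF assms] index_one_mat by (rule mat_carrier)

lemma M_mat_carrier: "M_mat n k r z0 \<in> carrier_mat ((k + 1) * n) ((min r k + 1) * n)"
  unfolding M_mat_def by (rule kron_one_right_carrier) (simp add: H_mat_def)

lemma M_mat_index:
  assumes "i < k + 1" "a < n" "t < min r k + 1" "b < n"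
  shows "M_mat n k r z0 $$ (i * n + a, t * n + b) = (if a = b then taylor_coeff z0 (monom 1 i) t else 0)"
proof -
  have H: "H_mat k r z0 \<in> carrier_mat (k + 1) (min r k + 1)" by (simp add: H_mat_def)
  show ?thesis
    unfolding M_mat_def kron_one_right_index[OF H assms]
    using assms by (simp add: H_mat_def taylor_coeff_def)
qed

lemma E_mat_carrier: "E_mat n k r \<in> carrier_mat ((r + 1) * ((min r k + 1) * n)) ((r + 1) * n)"
proof -
  have "E_mat n k r \<in> carrier_mat (((r + 1) * (min r k + 1)) * n) ((r + 1) * n)"
    unfolding E_mat_def by (rule kron_one_right_carrier) simp
  then show ?thesis by (simp only: mult.assoc)
qed

lemma E_mat_index:
  assumes s: "s < r + 1" and t: "t < min r k + 1" and a: "a < n" and j: "j < r + 1" and b: "b < n"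
  shows "E_mat n k r $$ (s * ((min r k + 1) * n) + (t * n + a), j * n + b) =
    (if a = b \<and> t + j = s then 1 else 0)"
proof -
  define p where "p = min r k + 1"
  define X where "X = mat ((r + 1) * p) (r + 1) (\<lambda>(a,b). E_block k r (a div p) $$ (a mod p, b))"
  have X: "X \<in> carrier_mat ((r + 1) * p) (r + 1)" by (simp add: X_def)
  have st: "s * p + t < (r + 1) * p" by (rule block_index_less[OF s t[folded p_def]])
  have "X $$ (s * p + t, j) = E_block k r ((s * p + t) div p) $$ ((s * p + t) mod p, j)"
    unfolding X_def using st j by (subst index_mat) auto
  also have "\<dots> = E_block k r s $$ (t, j)" using t[folded p_def] by simp
  also have "\<dots> = (if t + j = s then 1 else 0)" using t j by (simp add: E_block_def)
  finally have Xe: "X $$ (s * p + t, j) = (if t + j = s then 1 else 0)" .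
  have idx: "s * (p * n) + (t * n + a) = (s * p + t) * n + a" by (simp add: algebra_simps)
  have "E_mat n k r = kron X (1\<^sub>m n)" unfolding E_mat_def X_def p_def ..
  then show ?thesis
    unfolding p_def[symmetric] idx by (simp only: kron_one_right_index[OF X st a j b] Xe) simp
qed

lemma taylor_coeff_eq_0_of_degree: "degree p < m \<Longrightarrow> taylor_coeff z0 p m = 0"
  unfolding taylor_coeff_eq_coeff_pcompose by (rule coeff_eq_0) (simp add: degree_pcompose)

lemma matpoly_carrier [simp]: "matpoly n k B \<in> carrier_mat n n"
  by (simp add: matpoly_def)

lemma matpoly_index: "a < n \<Longrightarrow> b < n \<Longrightarrow> matpoly n k B $$ (a,b) = (\<Sum>i\<le>k. monom (B i $$ (a,b)) i)"
  by (simp add: matpoly_def)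

lemma degree_matpoly: "a < n \<Longrightarrow> b < n \<Longrightarrow> degree (matpoly n k B $$ (a,b)) \<le> k"
  unfolding matpoly_index by (intro degree_sum_le order_trans[OF degree_monom_le]) auto

lemma coeff_matpoly: "a < n \<Longrightarrow> b < n \<Longrightarrow> coeff (matpoly n k B $$ (a,b)) j = (if j \<le> k then B j $$ (a,b) else 0)"
  by (simp add: matpoly_index coeff_sum)

lemma taylor_coeff_matpoly:
  assumes "a < n" "b < n"
  shows "taylor_coeff z0 (matpoly n k B $$ (a,b)) j = (\<Sum>i<k + 1. B i $$ (a,b) * taylor_coeff z0 (monom 1 i) j)"
proof -
  have mt: "taylor_coeff z0 (monom c i) j = c * taylor_coeff z0 (monom 1 i) j" for c i
    using taylor_coeff_smult[of z0 c "monom 1 i" j] by (simp add: smult_monom)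
  show ?thesis
    unfolding matpoly_index[OF assms] taylor_coeff_sum by (rule sum.cong[OF _ mt]) auto
qed

text \<open>Block column \<open>j\<close> of block \<open>i\<close> of \<open>E\<close> selects from \<open>M\<close> the column with the Taylor coefficients of order \<open>i - j\<close> of
\<open>1, \<lambda>, ..., \<lambda>^k\<close>; multiplied by \<open>[B_0 ... B_k]\<close> this is the Taylor coefficient of that order of the perturbation.
Orders above \<open>k\<close> contribute zero, which is why \<open>min r k + 1\<close> columns of \<open>M\<close> are enough.\<close>

lemma perturbation_product:
  "kron (1\<^sub>m (r + 1)) (block_row n k B) * (kron (1\<^sub>m (r + 1)) (M_mat n k r z0) * E_mat n k r) =
    T_mat n r (matpoly n k B) z0"
proof -
  define R where "R = r + 1"
  define p where "p = min r k"
  define F where "F = kron (1\<^sub>m R) (M_mat n k r z0) * E_mat n k r"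
  have M: "M_mat n k r z0 \<in> carrier_mat ((k + 1) * n) ((p + 1) * n)" unfolding p_def by (rule M_mat_carrier)
  have E: "E_mat n k r \<in> carrier_mat (R * ((p + 1) * n)) (R * n)" unfolding p_def R_def by (rule E_mat_carrier)
  have F: "F \<in> carrier_mat (R * ((k + 1) * n)) (R * n)"
    unfolding F_def by (rule mult_carrier_mat[OF kron_one_carrier[OF M] E])
  have Fi: "F $$ (s * ((k + 1) * n) + (i * n + a), j * n + b) =
      (if a = b \<and> j \<le> s \<and> s - j \<le> p then taylor_coeff z0 (monom 1 i) (s - j) else 0)"
    if h: "s < R" "i < k + 1" "a < n" "j < R" "b < n" for s i a j b
  proof -
    have "F $$ (s * ((k + 1) * n) + (i * n + a), j * n + b) =
        (\<Sum>l<(p + 1) * n. M_mat n k r z0 $$ (i * n + a, l) * E_mat n k r $$ (s * ((p + 1) * n) + l, j * n + b))"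
      unfolding F_def
      by (rule kron_one_mult_index[OF M E h(1) block_index_less[OF h(2,3)] block_index_less[OF h(4,5)]])
    also have "\<dots> = (\<Sum>t<p + 1. \<Sum>a'<n. if a' = a then (if a = b \<and> t + j = s then taylor_coeff z0 (monom 1 i) t else 0) else 0)"
      unfolding sum_blocks
    proof (intro sum.cong refl)
      fix t a' assume ta: "t \<in> {..<p + 1}" "a' \<in> {..<n}"
      have "M_mat n k r z0 $$ (i * n + a, t * n + a') = (if a = a' then taylor_coeff z0 (monom 1 i) t else 0)"
        by (rule M_mat_index) (use ta h in \<open>auto simp: p_def\<close>)
      moreover have "E_mat n k r $$ (s * ((p + 1) * n) + (t * n + a'), j * n + b) = (if a' = b \<and> t + j = s then 1 else 0)"
        unfolding p_def by (rule E_mat_index) (use ta h in \<open>auto simp: p_def R_def\<close>)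
      ultimately show "M_mat n k r z0 $$ (i * n + a, t * n + a') * E_mat n k r $$ (s * ((p + 1) * n) + (t * n + a'), j * n + b) =
          (if a' = a then (if a = b \<and> t + j = s then taylor_coeff z0 (monom 1 i) t else 0) else 0)" by auto
    qed
    also have "\<dots> = (\<Sum>t<p + 1. if t = s - j then (if a = b \<and> j \<le> s then taylor_coeff z0 (monom 1 i) t else 0) else 0)"
      by (rule sum.cong[OF refl]) (use h(3) in auto)
    also have "\<dots> = (if a = b \<and> j \<le> s \<and> s - j \<le> p then taylor_coeff z0 (monom 1 i) (s - j) else 0)"
      by (subst sum.delta) (auto simp: less_Suc_eq_le)
    finally show ?thesis .
  qed
  have "kron (1\<^sub>m R) (block_row n k B) * F = T_mat n r (matpoly n k B) z0"
  proof (rule eq_matI)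
    fix x y assume "x < dim_row (T_mat n r (matpoly n k B) z0)" "y < dim_col (T_mat n r (matpoly n k B) z0)"
    then have xy: "x < R * n" "y < R * n" by (simp_all add: T_mat_def R_def)
    obtain s a where sa: "s < R" "a < n" "x = s * n + a" by (rule block_index_cases[OF xy(1)])
    obtain j b where jb: "j < R" "b < n" "y = j * n + b" by (rule block_index_cases[OF xy(2)])
    let ?c = "j \<le> s \<and> s - j \<le> p"
    have "(kron (1\<^sub>m R) (block_row n k B) * F) $$ (x,y) =
        (\<Sum>l<(k + 1) * n. block_row n k B $$ (a,l) * F $$ (s * ((k + 1) * n) + l, j * n + b))"
      unfolding sa(3) jb(3) by (rule kron_one_mult_index[OF block_row_carrier F sa(1,2) block_index_less[OF jb(1,2)]])
    also have "\<dots> = (\<Sum>i<k + 1. \<Sum>a'<n. if a' = b then (if ?c then B i $$ (a,a') * taylor_coeff z0 (monom 1 i) (s - j) else 0) else 0)"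
      unfolding sum_blocks
    proof (intro sum.cong refl)
      fix i a' assume ia: "i \<in> {..<k + 1}" "a' \<in> {..<n}"
      have "block_row n k B $$ (a, i * n + a') = B i $$ (a,a')" by (rule block_row_index) (use ia sa in auto)
      then show "block_row n k B $$ (a, i * n + a') * F $$ (s * ((k + 1) * n) + (i * n + a'), j * n + b) =
          (if a' = b then (if ?c then B i $$ (a,a') * taylor_coeff z0 (monom 1 i) (s - j) else 0) else 0)"
        using Fi[OF sa(1) _ _ jb(1,2), of i a'] ia by auto
    qed
    also have "\<dots> = (\<Sum>i<k + 1. if ?c then B i $$ (a,b) * taylor_coeff z0 (monom 1 i) (s - j) else 0)"
      by (rule sum.cong[OF refl]) (use jb(2) in auto)
    also have "\<dots> = (if ?c then taylor_coeff z0 (matpoly n k B $$ (a,b)) (s - j) else 0)"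
      unfolding taylor_coeff_matpoly[OF sa(2) jb(2)]
      by (cases "?c") (simp_all only: if_True if_False simp_thms sum.neutral_const)
    also have "\<dots> = (if j \<le> s then taylor_coeff z0 (matpoly n k B $$ (a,b)) (s - j) else 0)"
    proof (cases "s - j \<le> p")
      case False
      then have "k < s - j" using sa(1) by (auto simp: p_def R_def min_def split: if_splits)
      then have "taylor_coeff z0 (matpoly n k B $$ (a,b)) (s - j) = 0"
        using degree_matpoly[OF sa(2) jb(2), of k B] by (intro taylor_coeff_eq_0_of_degree) simp
      then show ?thesis by simp
    qed simp
    also have "\<dots> = T_mat n r (matpoly n k B) z0 $$ (x,y)"
      unfolding sa(3) jb(3) by (rule T_mat_index[symmetric]) (use sa jb in \<open>auto simp: R_def\<close>)
    finally show "(kron (1\<^sub>m R) (block_row n k B) * F) $$ (x,y) = T_mat n r (matpoly n k B) z0 $$ (x,y)" .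
  next
    show "dim_row (kron (1\<^sub>m R) (block_row n k B) * F) = dim_row (T_mat n r (matpoly n k B) z0)"
      using carrier_matD[OF kron_one_carrier[OF block_row_carrier, of R n k B]] by (simp add: T_mat_def R_def)
    show "dim_col (kron (1\<^sub>m R) (block_row n k B) * F) = dim_col (T_mat n r (matpoly n k B) z0)"
      using carrier_matD[OF F] by (simp add: T_mat_def R_def)
  qed
  then show ?thesis unfolding F_def R_def .
qed

lemma taylor_coeff_at_0: "taylor_coeff 0 p m = coeff p m"
  unfolding taylor_coeff_eq_coeff_pcompose by simp

text \<open>At \<open>0\<close> the Taylor coefficients are the matrices \<open>B_i\<close> themselves, and \<open>E\<close> alone distributes them.\<close>

lemma perturbation_product_at_0:
  "kron (1\<^sub>m (r + 1)) (block_row n (min r k) B) * E_mat n k r = T_mat n r (matpoly n (min r k) B) 0"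
proof -
  define R where "R = r + 1"
  define p where "p = min r k"
  have E: "E_mat n k r \<in> carrier_mat (R * ((p + 1) * n)) (R * n)" unfolding p_def R_def by (rule E_mat_carrier)
  have "kron (1\<^sub>m R) (block_row n p B) * E_mat n k r = T_mat n r (matpoly n p B) 0"
  proof (rule eq_matI)
    fix x y assume "x < dim_row (T_mat n r (matpoly n p B) 0)" "y < dim_col (T_mat n r (matpoly n p B) 0)"
    then have xy: "x < R * n" "y < R * n" by (simp_all add: T_mat_def R_def)
    obtain s a where sa: "s < R" "a < n" "x = s * n + a" by (rule block_index_cases[OF xy(1)])
    obtain j b where jb: "j < R" "b < n" "y = j * n + b" by (rule block_index_cases[OF xy(2)])
    have "(kron (1\<^sub>m R) (block_row n p B) * E_mat n k r) $$ (x,y) =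
        (\<Sum>l<(p + 1) * n. block_row n p B $$ (a,l) * E_mat n k r $$ (s * ((p + 1) * n) + l, j * n + b))"
      unfolding sa(3) jb(3) by (rule kron_one_mult_index[OF block_row_carrier E sa(1,2) block_index_less[OF jb(1,2)]])
    also have "\<dots> = (\<Sum>t<p + 1. \<Sum>a'<n. if a' = b then (if t + j = s then B t $$ (a,a') else 0) else 0)"
      unfolding sum_blocks
    proof (intro sum.cong refl)
      fix t a' assume ta: "t \<in> {..<p + 1}" "a' \<in> {..<n}"
      have "block_row n p B $$ (a, t * n + a') = B t $$ (a,a')" by (rule block_row_index) (use ta sa in auto)
      moreover have "E_mat n k r $$ (s * ((p + 1) * n) + (t * n + a'), j * n + b) = (if a' = b \<and> t + j = s then 1 else 0)"
        unfolding p_def by (rule E_mat_index) (use ta sa jb in \<open>auto simp: p_def R_def\<close>)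
      ultimately show "block_row n p B $$ (a, t * n + a') * E_mat n k r $$ (s * ((p + 1) * n) + (t * n + a'), j * n + b) =
          (if a' = b then (if t + j = s then B t $$ (a,a') else 0) else 0)" by auto
    qed
    also have "\<dots> = (\<Sum>t<p + 1. if t = s - j then (if j \<le> s then B t $$ (a,b) else 0) else 0)"
      by (rule sum.cong[OF refl]) (use jb(2) in auto)
    also have "\<dots> = (if j \<le> s then taylor_coeff 0 (matpoly n p B $$ (a,b)) (s - j) else 0)"
      unfolding taylor_coeff_at_0 coeff_matpoly[OF sa(2) jb(2)] by (subst sum.delta) (auto simp: less_Suc_eq_le)
    also have "\<dots> = T_mat n r (matpoly n p B) 0 $$ (x,y)"
      unfolding sa(3) jb(3) by (rule T_mat_index[symmetric]) (use sa jb in \<open>auto simp: R_def\<close>)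
    finally show "(kron (1\<^sub>m R) (block_row n p B) * E_mat n k r) $$ (x,y) = T_mat n r (matpoly n p B) 0 $$ (x,y)" .
  next
    show "dim_row (kron (1\<^sub>m R) (block_row n p B) * E_mat n k r) = dim_row (T_mat n r (matpoly n p B) 0)"
      using carrier_matD[OF kron_one_carrier[OF block_row_carrier, of R n p B]] by (simp add: T_mat_def R_def)
    show "dim_col (kron (1\<^sub>m R) (block_row n p B) * E_mat n k r) = dim_col (T_mat n r (matpoly n p B) 0)"
      using carrier_matD[OF E] by (simp add: T_mat_def R_def)
  qed
  then show ?thesis unfolding p_def R_def .
qed

lemma T_mat_cong:
  assumes "\<And>a b j. a < n \<Longrightarrow> b < n \<Longrightarrow> j \<le> r \<Longrightarrow> taylor_coeff z0 (X $$ (a,b)) j = taylor_coeff z0 (Y $$ (a,b)) j"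
  shows "T_mat n r X z0 = T_mat n r Y z0"
proof (rule eq_matI)
  fix x y assume "x < dim_row (T_mat n r Y z0)" "y < dim_col (T_mat n r Y z0)"
  then have xy: "x < (r + 1) * n" "y < (r + 1) * n" by (simp_all add: T_mat_def)
  obtain s a where sa: "s < r + 1" "a < n" "x = s * n + a" by (rule block_index_cases[OF xy(1)])
  obtain j b where jb: "j < r + 1" "b < n" "y = j * n + b" by (rule block_index_cases[OF xy(2)])
  show "T_mat n r X z0 $$ (x,y) = T_mat n r Y z0 $$ (x,y)"
    unfolding sa(3) jb(3) T_mat_index[OF sa(1,2) jb(1,2)]
    using assms[OF sa(2) jb(2), of "s - j"] sa(1) by simp
qed (simp_all add: T_mat_def)

lemma taylor_coeff_diff: "taylor_coeff z0 (p - q) m = taylor_coeff z0 p m - taylor_coeff z0 q m"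
  unfolding taylor_coeff_eq_coeff_pcompose by (simp add: pcompose_diff)

lemma T_mat_diff:
  assumes "X \<in> carrier_mat n n" "Y \<in> carrier_mat n n"
  shows "T_mat n r (X - Y) z0 = T_mat n r X z0 - T_mat n r Y z0"
proof (rule eq_matI)
  fix x y assume "x < dim_row (T_mat n r X z0 - T_mat n r Y z0)" "y < dim_col (T_mat n r X z0 - T_mat n r Y z0)"
  then have xy: "x < (r + 1) * n" "y < (r + 1) * n" by (simp_all add: T_mat_def)
  obtain s a where sa: "s < r + 1" "a < n" "x = s * n + a" by (rule block_index_cases[OF xy(1)])
  obtain j b where jb: "j < r + 1" "b < n" "y = j * n + b" by (rule block_index_cases[OF xy(2)])
  have "(T_mat n r X z0 - T_mat n r Y z0) $$ (x,y) = T_mat n r X z0 $$ (x,y) - T_mat n r Y z0 $$ (x,y)"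
    using xy by (intro index_minus_mat) (simp_all add: T_mat_def)
  moreover have "(X - Y) $$ (a,b) = X $$ (a,b) - Y $$ (a,b)" using assms sa jb by simp
  ultimately show "T_mat n r (X - Y) z0 $$ (x,y) = (T_mat n r X z0 - T_mat n r Y z0) $$ (x,y)"
    unfolding sa(3) jb(3) T_mat_index[OF sa(1,2) jb(1,2)] by (simp add: taylor_coeff_diff)
qed (simp_all add: T_mat_def)

lemma indep_kernel_family_mult:
  assumes A: "A \<in> carrier_mat N N" and S: "S \<in> carrier_mat N N" "S' \<in> carrier_mat N N" "S' * S = 1\<^sub>m N"
    and x: "indep_kernel_family A R x"
  shows "indep_kernel_family (A * S') R (\<lambda>l. S *\<^sub>v x l)"
proof -
  note x = x[unfolded indep_kernel_family_def carrier_matD[OF A]]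
  have AS: "A * S' \<in> carrier_mat N N" using A S by simp
  have xc: "x l \<in> carrier_vec N" "A *\<^sub>v x l = 0\<^sub>v N" if "l < R" for l using x that by blast+
  have SS: "S' *\<^sub>v (S *\<^sub>v v) = v" if "v \<in> carrier_vec N" for v
    using assoc_mult_mat_vec[OF S(2,1) that] S(3) that by simp
  show ?thesis
    unfolding indep_kernel_family_def carrier_matD[OF AS]
  proof (intro conjI allI impI)
    fix l assume l: "l < R"
    show "S *\<^sub>v x l \<in> carrier_vec N" using S xc[OF l] by simp
    have "(A * S') *\<^sub>v (S *\<^sub>v x l) = A *\<^sub>v (S' *\<^sub>v (S *\<^sub>v x l))"
      using A S xc[OF l] by (intro assoc_mult_mat_vec[of _ N N _ N]) auto
    then show "(A * S') *\<^sub>v (S *\<^sub>v x l) = 0\<^sub>v N" unfolding SS[OF xc(1)[OF l]] xc(2)[OF l] .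
  next
    fix c l assume c: "\<forall>i<N. (\<Sum>l<R. c l * (S *\<^sub>v x l) $ i) = 0" and l: "l < R"
    define y where "y = vec N (\<lambda>i. \<Sum>l<R. c l * x l $ i)"
    have y: "y \<in> carrier_vec N" by (simp add: y_def)
    have "S *\<^sub>v y = 0\<^sub>v N"
    proof (rule eq_vecI)
      fix i assume "i < dim_vec (0\<^sub>v N)"
      then have i: "i < N" by simp
      have "(S *\<^sub>v y) $ i = (\<Sum>j<N. S $$ (i,j) * (\<Sum>l<R. c l * x l $ j))"
        unfolding mult_mat_vec_index[OF S(1) y i] by (simp add: y_def)
      also have "\<dots> = (\<Sum>l<R. \<Sum>j<N. c l * (S $$ (i,j) * x l $ j))"
        unfolding sum_distrib_left by (subst sum.swap) (simp add: algebra_simps)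
      also have "\<dots> = (\<Sum>l<R. c l * (S *\<^sub>v x l) $ i)"
        by (rule sum.cong) (simp_all add: mult_mat_vec_index[OF S(1) xc(1) i] sum_distrib_left del: index_mult_mat_vec)
      finally show "(S *\<^sub>v y) $ i = 0\<^sub>v N $ i" using c i by simp
    qed (use S in simp)
    then have "y = S' *\<^sub>v 0\<^sub>v N" using SS[OF y] by simp
    also have "\<dots> = 0\<^sub>v N" using S(2) by (intro eq_vecI) auto
    finally have y0: "y = 0\<^sub>v N" .
    have "\<forall>i<N. (\<Sum>l<R. c l * x l $ i) = 0"
    proof (intro allI impI)
      fix i assume i: "i < N"
      have "(\<Sum>l<R. c l * x l $ i) = y $ i" unfolding y_def index_vec[OF i] ..
      then show "(\<Sum>l<R. c l * x l $ i) = 0" unfolding y0 using i by simp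
    qed
    then have "\<forall>l<R. c l = 0" by (rule mp[OF spec[OF conjunct2[OF x], of c]])
    then show "c l = 0" using l by blast
  qed
qed

section \<open>The distance as an infimum over kernel conditions\<close>

lemma norms_uminus:
  assumes X: "X \<in> carrier_mat m n"
  shows "spec_norm (- X) \<le> spec_norm X" "frob_norm (- X) \<le> frob_norm X"
proof -
  have mX: "- X \<in> carrier_mat m n" using X by simp
  show "spec_norm (- X) \<le> spec_norm X"
  proof (rule spec_norm_le[OF mX])
    fix v assume v: "v \<in> carrier_vec n" "vec_norm2 v \<le> 1"
    have "- X *\<^sub>v v = - (X *\<^sub>v v)" using X v(1) by (intro eq_vecI) auto
    also have "vec_norm2 \<dots> = vec_norm2 (X *\<^sub>v v)" by (simp add: vec_norm2_def)
    also have "\<dots> \<le> spec_norm X" by (rule vec_norm2_le_spec_norm[OF X v])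
    finally show "vec_norm2 (- X *\<^sub>v v) \<le> spec_norm X" .
  qed
  show "frob_norm (- X) \<le> frob_norm X" using X by (simp add: frob_norm_def)
qed

text \<open>Since \<open>D F = T(Y)\<close>, the matrix \<open>I - D F T(P)\<^sup>-\<^sup>1\<close> equals \<open>T(P - Y) T(P)\<^sup>-\<^sup>1\<close>.\<close>

lemma rank_drop_iff_indep_kernel_family:
  assumes P: "P \<in> carrier_mat n n" and Y: "Y \<in> carrier_mat n n" and nz: "poly (det P) z0 \<noteq> 0"
    and D: "D \<in> carrier_mat ((r + 1) * n) q" and F: "F \<in> carrier_mat q ((r + 1) * n)"
    and DF: "D * F = T_mat n r Y z0"
  defines "M \<equiv> F * the (mat_inverse (T_mat n r P z0))"
  shows "dim_col M = (r + 1) * n"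
    and "vec_space.rank (dim_col M) (1\<^sub>m (dim_col M) - D * M) + R \<le> dim_col M \<longleftrightarrow>
      (\<exists>x. indep_kernel_family (T_mat n r (P - Y) z0) R x)"
proof -
  define N where "N = (r + 1) * n"
  define T where "T = T_mat n r P z0"
  define S where "S = the (mat_inverse T)"
  have T: "T \<in> carrier_mat N N" unfolding T_def N_def by (rule T_mat_carrier)
  have "det T \<noteq> 0" unfolding T_def by (rule T_mat_invertible[OF P nz])
  then have "T \<in> Units (ring_mat TYPE(complex) N ())" by (rule det_non_zero_imp_unit[OF T])
  then obtain S0 where S0: "mat_inverse T = Some S0" using mat_inverse(1)[OF T] by fastforce
  have S: "S \<in> carrier_mat N N" "T * S = 1\<^sub>m N" "S * T = 1\<^sub>m N"
    using mat_inverse(2)[OF T S0] S0 by (simp_all add: S_def)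
  have D': "D \<in> carrier_mat N q" and F': "F \<in> carrier_mat q N" using D F by (simp_all only: N_def)
  have M: "M = F * S" unfolding M_def S_def T_def ..
  have dM: "dim_col M = N" unfolding M using S(1) by simp
  then show "dim_col M = (r + 1) * n" unfolding N_def .
  have TY: "T_mat n r Y z0 \<in> carrier_mat N N" unfolding N_def by (rule T_mat_carrier)
  have W: "T_mat n r (P - Y) z0 \<in> carrier_mat N N" unfolding N_def by (rule T_mat_carrier)
  have "D * M = T_mat n r Y z0 * S" unfolding M DF[symmetric] by (rule assoc_mult_mat[symmetric, OF D' F' S(1)])
  then have "1\<^sub>m N - D * M = T * S - T_mat n r Y z0 * S" by (simp only: S(2))
  also have "\<dots> = (T - T_mat n r Y z0) * S" by (rule minus_mult_distrib_mat[symmetric, OF T TY S(1)])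
  also have "\<dots> = T_mat n r (P - Y) z0 * S" unfolding T_def T_mat_diff[OF P Y] ..
  finally have e: "1\<^sub>m N - D * M = T_mat n r (P - Y) z0 * S" .
  have WS: "T_mat n r (P - Y) z0 * S \<in> carrier_mat N N" using W S(1) by simp
  have cancel: "T_mat n r (P - Y) z0 * S * T = T_mat n r (P - Y) z0"
    using assoc_mult_mat[OF W S(1) T] S(3) W by simp
  have "(\<exists>x. indep_kernel_family (T_mat n r (P - Y) z0 * S) R x) \<longleftrightarrow>
      (\<exists>x. indep_kernel_family (T_mat n r (P - Y) z0) R x)"
  proof
    assume "\<exists>x. indep_kernel_family (T_mat n r (P - Y) z0 * S) R x"
    then obtain x where "indep_kernel_family (T_mat n r (P - Y) z0 * S) R x" by blast
    from indep_kernel_family_mult[OF WS S(1) T S(2) this]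
    show "\<exists>x. indep_kernel_family (T_mat n r (P - Y) z0) R x" unfolding cancel by blast
  next
    assume "\<exists>x. indep_kernel_family (T_mat n r (P - Y) z0) R x"
    then obtain x where "indep_kernel_family (T_mat n r (P - Y) z0) R x" by blast
    from indep_kernel_family_mult[OF W T S(1) S(3) this]
    show "\<exists>x. indep_kernel_family (T_mat n r (P - Y) z0 * S) R x" by blast
  qed
  then show "vec_space.rank (dim_col M) (1\<^sub>m (dim_col M) - D * M) + R \<le> dim_col M \<longleftrightarrow>
      (\<exists>x. indep_kernel_family (T_mat n r (P - Y) z0) R x)"
    unfolding dM e rank_le_iff_indep_kernel_family[OF WS] .
qed

lemma matpoly_of_coeffs:
  assumes "has_grade n k X"
  shows "matpoly n k (\<lambda>i. mat n n (\<lambda>(a,b). coeff (X $$ (a,b)) i)) = X"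
proof (rule eq_matI)
  fix a b assume "a < dim_row X" "b < dim_col X"
  then have ab: "a < n" "b < n" using assms by (auto simp: has_grade_def)
  then have "degree (X $$ (a,b)) \<le> k" using assms by (simp add: has_grade_def)
  from poly_as_sum_of_monoms'[OF this]
  show "matpoly n k (\<lambda>i. mat n n (\<lambda>(a,b). coeff (X $$ (a,b)) i)) $$ (a,b) = X $$ (a,b)"
    unfolding matpoly_index[OF ab] using ab by simp
qed (use assms in \<open>auto simp: has_grade_def matpoly_def\<close>)

text \<open>The norm \<open>\<nu>\<close> stands for the spectral and the Frobenius norm, and \<open>m\<close> bounds the indices of the
coefficients that matter: at \<open>z0 = 0\<close> these are the ones up to \<open>r\<close>. Up to the sign of the perturbation, every perturbation that creates the elementary divisor satisfies the kernel
condition. Conversely, if \<open>B\<close> satisfies it, then arbitrarily close to \<open>P - B\<close> there is a \<open>P + C\<close> with the elementary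
divisor, so that the norm of \<open>C\<close> exceeds that of \<open>B\<close> by less than any given bound.\<close>

lemma el_div_distance_eq_INF_kernel:
  fixes \<nu> :: "complex mat \<Rightarrow> real"
  assumes P: "has_grade n k P" and rn: "r < k * n" and mk: "m \<le> k"
    and trunc: "m = k \<or> z0 = 0 \<and> r \<le> m"
    and perturb: "\<And>X Y w. X \<in> carrier_mat n w \<Longrightarrow> Y \<in> carrier_mat n w \<Longrightarrow> \<nu> X \<le> \<nu> Y + frob_norm (X - Y)"
    and neg: "\<And>X w. X \<in> carrier_mat n w \<Longrightarrow> \<nu> (- X) \<le> \<nu> X"
    and nonneg: "\<And>X w. X \<in> carrier_mat n w \<Longrightarrow> 0 \<le> \<nu> X"
    and cut: "\<And>B. \<nu> (block_row n m B) \<le> \<nu> (block_row n k B)"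
      "\<And>B. \<nu> (block_row n k (zero_beyond n m B)) \<le> \<nu> (block_row n m B)"
  shows "el_div_distance (\<lambda>B. \<nu> (block_row n k B)) n k P z0 (r + 1) =
    (INF B \<in> {B. (\<forall>i\<le>m. B i \<in> carrier_mat n n) \<and>
        (\<exists>x. indep_kernel_family (T_mat n r (P - matpoly n m B) z0) (r + 1) x)}.
      ennreal (\<nu> (block_row n m B)))" (is "?lhs = ?rhs")
proof (rule antisym)
  have Pc: "P \<in> carrier_mat n n" using P by (simp add: has_grade_def)
  have neg_row: "block_row n l (\<lambda>i. - B i) = - block_row n l B" if "\<forall>i\<le>l. B i \<in> carrier_mat n n" for l B
  proof (rule eq_matI)
    fix a c assume "a < dim_row (- block_row n l B)" "c < dim_col (- block_row n l B)"
    then have ac: "a < n" "c < (l + 1) * n" by (simp_all add: block_row_def)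
    obtain i b where ib: "i < l + 1" "b < n" "c = i * n + b" using ac(2) by (rule block_index_cases)
    show "block_row n l (\<lambda>i. - B i) $$ (a,c) = (- block_row n l B) $$ (a,c)"
    proof -
      have "B i \<in> carrier_mat n n" using that ib(1) by simp
      then have "(- B i) $$ (a,b) = - (B i $$ (a,b))" using ac ib by simp
      then show ?thesis using ac ib by (simp add: block_row_def)
    qed
  qed (simp_all add: block_row_def)
  show "?rhs \<le> ?lhs"
    unfolding el_div_distance_def
  proof (rule INF_greatest)
    fix B assume "B \<in> {B. (\<forall>i\<le>k. B i \<in> carrier_mat n n) \<and>
      (\<exists>j\<ge>r + 1. [:-z0, 1:] ^ j \<in> elementary_divisors n (P + matpoly n k B))}"
    then obtain j where B: "\<forall>i\<le>k. B i \<in> carrier_mat n n" and j: "r + 1 \<le> j"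
      and el: "[:-z0, 1:] ^ j \<in> elementary_divisors n (P + matpoly n k B)" by blast
    define C where "C i = - B i" for i
    have C: "\<forall>i\<le>m. C i \<in> carrier_mat n n" using B mk by (simp add: C_def)
    obtain x where "indep_kernel_family (T_mat n r (P + matpoly n k B) z0) (r + 1) x"
      by (rule indep_kernel_family_of_elementary_divisor[OF _ j el]) (use Pc in simp, rule that)
    moreover have "T_mat n r (P + matpoly n k B) z0 = T_mat n r (P - matpoly n m C) z0"
    proof (rule T_mat_cong)
      fix a b l assume ab: "a < n" "b < n" and l: "l \<le> r"
      have ent: "(P + matpoly n k B) $$ (a,b) = P $$ (a,b) + matpoly n k B $$ (a,b)"
        "(P - matpoly n m C) $$ (a,b) = P $$ (a,b) - matpoly n m C $$ (a,b)"
        using Pc ab by (simp_all add: matpoly_def)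
      have Ci: "i \<le> k \<Longrightarrow> C i $$ (a,b) = - (B i $$ (a,b))" for i
      proof -
        assume "i \<le> k"
        then have "B i \<in> carrier_mat n n" using B by blast
        then show ?thesis unfolding C_def using ab by simp
      qed
      from trunc show "taylor_coeff z0 ((P + matpoly n k B) $$ (a,b)) l = taylor_coeff z0 ((P - matpoly n m C) $$ (a,b)) l"
      proof
        assume mk: "m = k"
        have "P $$ (a,b) + matpoly n k B $$ (a,b) = P $$ (a,b) - matpoly n m C $$ (a,b)"
          by (rule poly_eqI) (simp add: coeff_matpoly[OF ab] mk Ci)
        then show ?thesis unfolding ent by simp
      next
        assume z: "z0 = 0 \<and> r \<le> m"
        then have "l \<le> m" using l by simp
        then show ?thesis
          unfolding ent conjunct1[OF z] taylor_coeff_at_0 using mk by (simp add: coeff_matpoly[OF ab] Ci)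
      qed
    qed
    ultimately have "\<exists>x. indep_kernel_family (T_mat n r (P - matpoly n m C) z0) (r + 1) x" by auto
    then have "?rhs \<le> ennreal (\<nu> (block_row n m C))" using C by (intro INF_lower) blast
    also have "\<nu> (block_row n m C) \<le> \<nu> (block_row n k B)"
    proof -
      have "\<nu> (block_row n m C) = \<nu> (- block_row n m B)"
        unfolding C_def using neg_row[of m B] B mk by simp
      also have "\<dots> \<le> \<nu> (block_row n m B)" by (rule neg[OF block_row_carrier])
      also have "\<dots> \<le> \<nu> (block_row n k B)" by (rule cut(1))
      finally show ?thesis .
    qed
    then have "ennreal (\<nu> (block_row n m C)) \<le> ennreal (\<nu> (block_row n k B))" by (rule ennreal_leI)
    finally show "?rhs \<le> ennreal (\<nu> (block_row n k B))" .
  qed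
  show "?lhs \<le> ?rhs"
  proof (rule INF_greatest)
    fix B assume "B \<in> {B. (\<forall>i\<le>m. B i \<in> carrier_mat n n) \<and>
        (\<exists>x. indep_kernel_family (T_mat n r (P - matpoly n m B) z0) (r + 1) x)}"
    then obtain \<xi> where B: "\<forall>i\<le>m. B i \<in> carrier_mat n n"
      and \<xi>: "indep_kernel_family (T_mat n r (P - matpoly n m B) z0) (r + 1) \<xi>" by blast
    define Q where "Q = P - matpoly n m B"
    have Qc: "Q \<in> carrier_mat n n" unfolding Q_def by (rule minus_carrier_mat) simp
    have Qe: "Q $$ (a,b) = P $$ (a,b) - matpoly n m B $$ (a,b)" if "a < n" "b < n" for a b
      unfolding Q_def using that Pc by (simp add: matpoly_def)
    have Qg: "has_grade n k Q"
      unfolding has_grade_def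
    proof (intro conjI allI impI Qc)
      fix a b assume ab: "a < n" "b < n"
      show "degree (Q $$ (a,b)) \<le> k"
        unfolding Qe[OF ab] using P ab order_trans[OF degree_matpoly[OF ab] mk]
        by (intro degree_diff_le) (auto simp: has_grade_def)
    qed
    have dv: "[:-z0, 1:] ^ (r + 1) dvd det Q"
      by (rule linear_power_dvd_det_of_indep_kernel_family[OF Qc \<xi>[folded Q_def]])
    show "?lhs \<le> ennreal (\<nu> (block_row n m B))"
    proof (rule ennreal_le_epsilon)
      fix e :: real assume e: "0 < e"
      \<comment> \<open>the number of entries of the coefficient row; \<open>1\<close> is added below to keep the quotient strictly positive\<close>
      define K where "K = real (n * ((k + 1) * n))"
      have K: "0 \<le> K" by (simp add: K_def)
      define \<epsilon> where "\<epsilon> = e / (K + 1)"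
      have \<epsilon>: "0 < \<epsilon>" using e K by (simp add: \<epsilon>_def)
      have R: "1 \<le> r + 1" "r + 1 \<le> k * n" using rn by auto
      obtain Q' x where Q': "has_grade n k Q'" "coeffs_near n \<epsilon> Q Q'" "det Q' \<noteq> 0"
        and x: "root_vector z0 (r + 1) Q' x"
        using root_vector_approx[OF Qg dv R \<epsilon>] by blast
      have Q'c: "Q' \<in> carrier_mat n n" using Q'(1) by (simp add: has_grade_def)
      obtain i0 where i0: "i0 < n" "poly (x $ i0) z0 \<noteq> 0"
        using x Q'c unfolding root_vector_def by auto
      have xd: "x \<in> carrier_vec n" "\<forall>a<n. [:-z0, 1:] ^ (r + 1) dvd (Q' *\<^sub>v x) $ a"
        using x Q'c unfolding root_vector_def by auto
      obtain j where j: "r + 1 \<le> j" "[:-z0, 1:] ^ j \<in> elementary_divisors n Q'"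
        by (rule elementary_divisor_of_root_vector[OF Q'c Q'(3) xd(1) i0 xd(2) R(1)]) (rule that)
      define C where "C = (\<lambda>i. mat n n (\<lambda>(a,b). coeff ((Q' - P) $$ (a,b)) i))"
      have dg: "has_grade n k (Q' - P)"
        using Q'(1) P by (auto simp: has_grade_def intro!: degree_diff_le)
      have PC: "P + matpoly n k C = Q'"
        unfolding C_def matpoly_of_coeffs[OF dg] using Pc Q'c by (intro eq_matI) auto
      have "?lhs \<le> ennreal (\<nu> (block_row n k C))"
        unfolding el_div_distance_def by (rule INF_lower) (use j PC in \<open>auto simp: C_def\<close>)
      also have "\<nu> (block_row n k C) \<le> \<nu> (block_row n m B) + e"
      proof -
        define Z where "Z = - block_row n k (zero_beyond n m B)"
        have Zc: "Z \<in> carrier_mat n ((k + 1) * n)" unfolding Z_def using block_row_carrier by simp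
        have Cc: "block_row n k C \<in> carrier_mat n ((k + 1) * n)" by (rule block_row_carrier)
        have "\<nu> (block_row n k C) \<le> \<nu> Z + frob_norm (block_row n k C - Z)"
          by (rule perturb[OF Cc Zc])
        also have "\<nu> Z \<le> \<nu> (block_row n m B)"
          unfolding Z_def by (rule order_trans[OF neg[OF block_row_carrier] cut(2)])
        also have "frob_norm (block_row n k C - Z) \<le> K * \<epsilon>"
          unfolding K_def
        proof (rule frob_norm_entry_bound[OF minus_carrier_mat[OF Zc] less_imp_le[OF \<epsilon>]])
          fix a c assume ac: "a < n" "c < (k + 1) * n"
          obtain i b where ib: "i < k + 1" "b < n" "c = i * n + b" using ac(2) by (rule block_index_cases)
          have 1: "block_row n k C $$ (a,c) = coeff (Q' $$ (a,b)) i - coeff (P $$ (a,b)) i"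
          proof -
            have "block_row n k C $$ (a,c) = C i $$ (a,b)"
              unfolding ib(3) by (rule block_row_index) (use ac ib in auto)
            also have "\<dots> = coeff (Q' $$ (a,b)) i - coeff (P $$ (a,b)) i"
              unfolding C_def using ac ib Pc Q'c by simp
            finally show ?thesis .
          qed
          have 2: "block_row n k (zero_beyond n m B) $$ (a,c) = coeff (matpoly n m B $$ (a,b)) i"
          proof -
            have "block_row n k (zero_beyond n m B) $$ (a,c) = zero_beyond n m B i $$ (a,b)"
              unfolding ib(3) by (rule block_row_index) (use ac ib in auto)
            then show ?thesis using ac ib by (simp add: coeff_matpoly zero_beyond_def)
          qed
          have "(block_row n k C - Z) $$ (a,c) = block_row n k C $$ (a,c) + block_row n k (zero_beyond n m B) $$ (a,c)"
            using ac carrier_matD[OF block_row_carrier[of n k "zero_beyond n m B"]] Zc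
            by (simp add: Z_def)
          also have "\<dots> = coeff (Q' $$ (a,b)) i - coeff (Q $$ (a,b)) i"
            unfolding 1 2 Qe[OF ac(1) ib(2)] by simp
          finally show "cmod ((block_row n k C - Z) $$ (a,c)) \<le> \<epsilon>"
            using Q'(2) ac(1) ib(2) unfolding coeffs_near_def by (simp add: less_imp_le)
        qed
        also have "K * \<epsilon> \<le> e"
        proof -
          have "K * \<epsilon> = K / (K + 1) * e" by (simp add: \<epsilon>_def)
          also have "\<dots> \<le> 1 * e" by (rule mult_right_mono) (use K e in auto)
          finally show ?thesis by simp
        qed
        finally show ?thesis by simp
      qed
      then have "ennreal (\<nu> (block_row n k C)) \<le> ennreal (\<nu> (block_row n m B) + e)" by (rule ennreal_leI)
      also have "\<dots> = ennreal (\<nu> (block_row n m B)) + ennreal e"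
        by (rule ennreal_plus) (use nonneg[OF block_row_carrier] e in auto)
      finally show "?lhs \<le> ennreal (\<nu> (block_row n m B)) + ennreal e" .
    qed
  qed
qed

lemma INF_ennreal_scale:
  assumes c: "0 < (c::real)" and g: "\<And>x. x \<in> X \<Longrightarrow> 0 \<le> g x"
  shows "(INF x\<in>X. ennreal (g x)) = ennreal (1 / c) * (INF x\<in>X. ennreal (c * g x))"
proof (rule antisym)
  have cc: "ennreal c * ennreal (1 / c) = 1" "ennreal (1 / c) * ennreal c = 1"
    using c by (simp_all add: ennreal_mult'[symmetric])
  show "ennreal (1 / c) * (INF x\<in>X. ennreal (c * g x)) \<le> (INF x\<in>X. ennreal (g x))"
  proof (rule INF_greatest)
    fix x assume x: "x \<in> X"
    have "ennreal (1 / c) * (INF x\<in>X. ennreal (c * g x)) \<le> ennreal (1 / c) * ennreal (c * g x)"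
      by (intro mult_left_mono INF_lower x) simp
    also have "\<dots> = ennreal (g x)" using c g[OF x] by (simp add: ennreal_mult'[symmetric])
    finally show "ennreal (1 / c) * (INF x\<in>X. ennreal (c * g x)) \<le> ennreal (g x)" .
  qed
  have "ennreal c * (INF x\<in>X. ennreal (g x)) \<le> (INF x\<in>X. ennreal (c * g x))"
  proof (rule INF_greatest)
    fix x assume x: "x \<in> X"
    have "ennreal c * (INF x\<in>X. ennreal (g x)) \<le> ennreal c * ennreal (g x)"
      by (intro mult_left_mono INF_lower x) simp
    then show "ennreal c * (INF x\<in>X. ennreal (g x)) \<le> ennreal (c * g x)"
      using c by (simp add: ennreal_mult')
  qed
  then have "ennreal (1 / c) * (ennreal c * (INF x\<in>X. ennreal (g x))) \<le> ennreal (1 / c) * (INF x\<in>X. ennreal (c * g x))"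
    by (rule mult_left_mono) simp
  then show "(INF x\<in>X. ennreal (g x)) \<le> ennreal (1 / c) * (INF x\<in>X. ennreal (c * g x))"
    unfolding mult.assoc[symmetric] cc by simp
qed

lemma inverse_inverse_ennreal: "inverse (inverse (x :: ennreal)) = x"
proof (cases x)
  case (real c)
  then show ?thesis by (cases "c = 0") (simp_all add: inverse_ennreal)
qed simp

text \<open>The two inversions cancel also for the values \<open>0\<close> and \<open>\<infinity>\<close>.\<close>

lemma inverse_gen_mu_block_class:
  assumes P: "P \<in> carrier_mat n n" and nz: "poly (det P) z0 \<noteq> 0"
    and F: "F \<in> carrier_mat ((r + 1) * ((m + 1) * n)) ((r + 1) * n)"
    and DF: "\<And>B. kron (1\<^sub>m (r + 1)) (block_row n m B) * F = T_mat n r (matpoly n m B) z0"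
  shows "inverse (gen_mu \<nu> (block_class n r m) (r + 1) (F * the (mat_inverse (T_mat n r P z0)))) =
    (INF B \<in> {B. (\<forall>i\<le>m. B i \<in> carrier_mat n n) \<and>
        (\<exists>x. indep_kernel_family (T_mat n r (P - matpoly n m B) z0) (r + 1) x)}.
      ennreal (\<nu> (kron (1\<^sub>m (r + 1)) (block_row n m B))))"
proof -
  let ?M = "F * the (mat_inverse (T_mat n r P z0))"
  let ?D = "\<lambda>B. kron (1\<^sub>m (r + 1)) (block_row n m B)"
  have rank: "vec_space.rank (dim_col ?M) (1\<^sub>m (dim_col ?M) - ?D B * ?M) + (r + 1) \<le> dim_col ?M \<longleftrightarrow>
      (\<exists>x. indep_kernel_family (T_mat n r (P - matpoly n m B) z0) (r + 1) x)" for B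
    by (rule rank_drop_iff_indep_kernel_family(2)[OF P matpoly_carrier nz kron_one_carrier[OF block_row_carrier] F DF])
  have "{D \<in> block_class n r m. vec_space.rank (dim_col ?M) (1\<^sub>m (dim_col ?M) - D * ?M) + (r + 1) \<le> dim_col ?M} =
      ?D ` {B. (\<forall>i\<le>m. B i \<in> carrier_mat n n) \<and>
        (\<exists>x. indep_kernel_family (T_mat n r (P - matpoly n m B) z0) (r + 1) x)}"
    unfolding rank[symmetric] block_class_def by blast
  then show ?thesis unfolding gen_mu_def by (simp only: inverse_inverse_ennreal image_image)
qed

lemma frob_norm_pull_out:
  "(INF B \<in> {B. (\<forall>i\<le>m. B i \<in> carrier_mat n n) \<and> \<Phi> B}. ennreal (frob_norm (block_row n m B))) =
    ennreal (1 / sqrt (real R)) *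
      (INF B \<in> {B. (\<forall>i\<le>m. B i \<in> carrier_mat n n) \<and> \<Phi> B}. ennreal (frob_norm (kron (1\<^sub>m R) (block_row n m B))))"
  if "0 < R"
  unfolding frob_norm_kron_one[OF block_row_carrier]
  by (rule INF_ennreal_scale) (use that frob_norm_nonneg in auto)

lemma el_div_distance_formulas:
  assumes P: "has_grade n k P" and rn: "r < k * n" and nz: "poly (det P) z0 \<noteq> 0"
    and mk: "m \<le> k" and trunc: "m = k \<or> z0 = 0 \<and> r \<le> m"
    and F: "F \<in> carrier_mat ((r + 1) * ((m + 1) * n)) ((r + 1) * n)"
    and DF: "\<And>B. kron (1\<^sub>m (r + 1)) (block_row n m B) * F = T_mat n r (matpoly n m B) z0"
  shows "el_div_distance (triple_norm_2 n k) n k P z0 (r + 1) =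
      inverse (gen_mu spec_norm (block_class n r m) (r + 1) (F * the (mat_inverse (T_mat n r P z0))))"
    and "el_div_distance (triple_norm_F k) n k P z0 (r + 1) =
      ennreal (1 / sqrt (real (r + 1))) *
      inverse (gen_mu frob_norm (block_class n r m) (r + 1) (F * the (mat_inverse (T_mat n r P z0))))"
proof -
  have r1: "0 < r + 1" by simp
  have Pc: "P \<in> carrier_mat n n" using P by (simp add: has_grade_def)
  note mu = inverse_gen_mu_block_class[OF Pc nz F DF]
  note cut = block_row_truncate_norms[OF mk, of n]
  have "el_div_distance (triple_norm_2 n k) n k P z0 (r + 1) =
      el_div_distance (\<lambda>B. spec_norm (block_row n k B)) n k P z0 (r + 1)"
    unfolding triple_norm_2_def[abs_def] ..
  also have "\<dots> = inverse (gen_mu spec_norm (block_class n r m) (r + 1) (F * the (mat_inverse (T_mat n r P z0))))"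
    unfolding mu spec_norm_kron_one[OF block_row_carrier, of "r + 1", OF r1]
    by (rule el_div_distance_eq_INF_kernel[OF P rn mk trunc spec_norm_perturb norms_uminus(1) spec_norm_nonneg cut(1) cut(3)])
  finally show "el_div_distance (triple_norm_2 n k) n k P z0 (r + 1) =
      inverse (gen_mu spec_norm (block_class n r m) (r + 1) (F * the (mat_inverse (T_mat n r P z0))))" .
  have "el_div_distance (triple_norm_F k) n k P z0 (r + 1) =
      el_div_distance (\<lambda>B. frob_norm (block_row n k B)) n k P z0 (r + 1)"
    unfolding el_div_distance_def by (rule INF_cong[OF refl]) (simp add: frob_norm_block_row)
  also have "\<dots> = ennreal (1 / sqrt (real (r + 1))) *
      inverse (gen_mu frob_norm (block_class n r m) (r + 1) (F * the (mat_inverse (T_mat n r P z0))))"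
    unfolding mu frob_norm_pull_out[of "r + 1", OF r1, symmetric]
    by (rule el_div_distance_eq_INF_kernel[OF P rn mk trunc frob_norm_perturb norms_uminus(2) frob_norm_nonneg cut(2) cut(4)])
  finally show "el_div_distance (triple_norm_F k) n k P z0 (r + 1) = ennreal (1 / sqrt (real (r + 1))) *
      inverse (gen_mu frob_norm (block_class n r m) (r + 1) (F * the (mat_inverse (T_mat n r P z0))))" .
qed

theorem theorem5p4:
  fixes n k r :: nat and A :: "nat \<Rightarrow> complex mat" and P :: "complex poly mat" and z0 :: complex
  assumes A: "\<forall>i\<le>k. A i \<in> carrier_mat n n"
    and degree_k: "A k \<noteq> 0\<^sub>m n n"
    and P: "P = matpoly n k A"
    and regular: "regular_matpoly P"
    and r: "1 \<le> r" "r < k * n"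
    and not_eigenvalue: "z0 \<notin> matpoly_eigenvalues P"
  shows "el_div_distance (triple_norm_2 n k) n k P z0 (r + 1) =
      (if z0 \<noteq> 0
       then inverse (gen_mu spec_norm (block_class n r k) (r + 1)
              (kron (1\<^sub>m (r + 1)) (M_mat n k r z0) * E_mat n k r * the (mat_inverse (T_mat n r P z0))))
       else inverse (gen_mu spec_norm (block_class n r (min r k)) (r + 1)
              (E_mat n k r * the (mat_inverse (T_mat n r P 0)))))
    \<and> el_div_distance (triple_norm_F k) n k P z0 (r + 1) =
      (if z0 \<noteq> 0
       then ennreal (1 / sqrt (real (r + 1))) *
            inverse (gen_mu frob_norm (block_class n r k) (r + 1)
              (kron (1\<^sub>m (r + 1)) (M_mat n k r z0) * E_mat n k r * the (mat_inverse (T_mat n r P z0))))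
       else ennreal (1 / sqrt (real (r + 1))) *
            inverse (gen_mu frob_norm (block_class n r (min r k)) (r + 1)
              (E_mat n k r * the (mat_inverse (T_mat n r P 0)))))"
proof -
  have grade: "has_grade n k P" unfolding P has_grade_def by (simp add: degree_matpoly)
  have nz: "poly (det P) z0 \<noteq> 0" using not_eigenvalue by (simp add: matpoly_eigenvalues_def)
  show ?thesis
  proof (cases "z0 = 0")
    case False
    have F: "kron (1\<^sub>m (r + 1)) (M_mat n k r z0) * E_mat n k r \<in> carrier_mat ((r + 1) * ((k + 1) * n)) ((r + 1) * n)"
      by (rule mult_carrier_mat[OF kron_one_carrier[OF M_mat_carrier] E_mat_carrier])
    note f = el_div_distance_formulas[OF grade r(2) nz order_refl disjI1[OF refl] F perturbation_product]
    show ?thesis unfolding f using False by (simp only: if_True simp_thms)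
  next
    case True
    have "min r k = k \<or> z0 = 0 \<and> r \<le> min r k" using True by linarith
    note f = el_div_distance_formulas[OF grade r(2) nz min.cobounded2 this E_mat_carrier]
    have "kron (1\<^sub>m (r + 1)) (block_row n (min r k) B) * E_mat n k r = T_mat n r (matpoly n (min r k) B) z0" for B
      unfolding True by (rule perturbation_product_at_0)
    note f = f[OF this]
    show ?thesis unfolding f unfolding True by (simp only: if_False simp_thms)
  qed
qed

end
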